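(* Let $M$ be a smooth manifold, $H$ a real closed 3-form on $M$, and let $F$ be an orthogonal automorphism of the bundle $T\oplus T^*$ over $M$, covering a diffeomorphism $\varphi:M\to M$, and preserving the $H$-twisted Courant bracket. Then $F=\varphi_* e^B$ for a unique 2-form $B\in\Omega^2(M)$ satisfying $\varphi^*H-H=dB$.
   Context: $T=TM$. The inner product on $T\oplus T^*$ is $\langle X+\xi,Y+\eta\rangle=\tfrac12(\xi(Y)+\eta(X))$; "orthogonal" means preserving it. The $H$-twisted Courant bracket on smooth sections of $T\oplus T^*$ is $$[X+\xi,Y+\eta]_H=[X,Y]+\mathcal L_X\eta-i_Yd\xi+i_Xi_YH .$$ An automorphism $F$ covering $\varphi$ acts on sections by pushforward, and it preserves the bracket if $F[F^{-1}a,F^{-1}b]_H=[a,b]_H$ for all sections $a,b$. For a 2-form $B$, $e^B$ is the bundle map $X+\xi\mapsto X+\xi+i_XB$. For a diffeomorphism $\varphi$, $\varphi_*$ denotes its lift $\begin{pmatrix}\varphi_*&0\\0&(\varphi^* )^{-1}\end{pmatrix}$ to $T\oplus T^*$. *)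

theory Defs
  imports "HOL-Analysis.Analysis"
begin

section \<open>Smooth maps between open subsets of finite-dimensional spaces\<close>

text \<open>
  Continuous differentiability of order \<open>n\<close> is expressed through iterated directional
  derivatives. The notion is meant for an open set in a finite-dimensional space, where this
  agrees with the usual definition.
\<close>

primrec Ck_on :: "nat \<Rightarrow> 'a::real_normed_vector set \<Rightarrow> ('a \<Rightarrow> 'b::real_normed_vector) \<Rightarrow> bool"
where
  "Ck_on 0 S f \<longleftrightarrow> continuous_on S f"
| "Ck_on (Suc n) S f \<longleftrightarrow>
     (\<forall>x\<in>S. f differentiable (at x)) \<and>
     (\<forall>v. Ck_on n S (\<lambda>x. frechet_derivative f (at x) v))"

definition smooth_on :: "'a::real_normed_vector set \<Rightarrow> ('a \<Rightarrow> 'b::real_normed_vector) \<Rightarrow> bool"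
  where "smooth_on S f \<longleftrightarrow> (\<forall>n. Ck_on n S f)"

section \<open>Smooth manifolds\<close>

type_synonym ('m, 'e) chart = "'m set \<times> ('m \<Rightarrow> 'e)"
type_synonym ('m, 'e) atlas = "('m, 'e) chart set"

definition chart_inv :: "('m, 'e) chart \<Rightarrow> 'e \<Rightarrow> 'm"
  where "chart_inv k = inv_into (fst k) (snd k)"

definition chart_image :: "('m, 'e) chart \<Rightarrow> 'e set"
  where "chart_image k = snd k ` fst k"

text \<open>
  The points of the manifold are all elements of the type \<open>'m\<close>, with the topology given by its
  type classes (Hausdorff, second countable); \<open>M\<close> is a smooth atlas, not necessarily maximal.
  The model space \<open>'e\<close> is required to have a finite orthonormal basis, instead of being in class
  \<open>euclidean_space\<close>, because that class excludes the zero space and with it the manifolds of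
  dimension 0.
\<close>

locale smooth_manifold =
  fixes M :: "('m::{t2_space, second_countable_topology}, 'e::real_inner) atlas"
  assumes model_space:
      "\<exists>B::'e set. finite B \<and> (\<forall>u\<in>B. \<forall>v\<in>B. u \<bullet> v = (if u = v then 1 else 0)) \<and> span B = UNIV"
    and covering: "(\<Union>k\<in>M. fst k) = UNIV"
    and open_domain: "k \<in> M \<Longrightarrow> open (fst k)"
    and open_image: "k \<in> M \<Longrightarrow> open (chart_image k)"
    and chart_homeomorphism:
      "k \<in> M \<Longrightarrow> homeomorphism (fst k) (chart_image k) (snd k) (chart_inv k)"
    and smooth_transition:
      "k \<in> M \<Longrightarrow> l \<in> M \<Longrightarrow> smooth_on (snd k ` (fst k \<inter> fst l)) (snd l \<circ> chart_inv k)"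

definition smooth_fun :: "('m, 'e::real_inner) atlas \<Rightarrow> ('m \<Rightarrow> real) \<Rightarrow> bool"
  where "smooth_fun M f \<longleftrightarrow> (\<forall>k\<in>M. smooth_on (chart_image k) (f \<circ> chart_inv k))"

definition smooth_map ::
    "('m::topological_space, 'e::real_inner) atlas \<Rightarrow> ('m \<Rightarrow> 'm) \<Rightarrow> bool"
  where "smooth_map M \<phi> \<longleftrightarrow> continuous_on UNIV \<phi> \<and>
    (\<forall>k\<in>M. \<forall>l\<in>M. smooth_on (snd k ` (fst k \<inter> \<phi> -` fst l)) (snd l \<circ> \<phi> \<circ> chart_inv k))"

definition diffeomorphism ::
    "('m::topological_space, 'e::real_inner) atlas \<Rightarrow> ('m \<Rightarrow> 'm) \<Rightarrow> bool"
  where "diffeomorphism M \<phi> \<longleftrightarrow> bij \<phi> \<and> smooth_map M \<phi> \<and> smooth_map M (inv \<phi>)"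

section \<open>Tangent vectors and vector fields\<close>

text \<open>
  A tangent vector at \<open>p\<close> is an operator on smooth functions of the form
  \<open>f \<mapsto> \<partial>\<^sub>e (f \<circ> k\<inverse>) (k p)\<close>, for a chart \<open>k\<close> around \<open>p\<close> and a direction \<open>e\<close>. On functions that
  are not smooth it is set to 0, so that equality of tangent vectors is equality in HOL.
\<close>

type_synonym 'm tvec = "('m \<Rightarrow> real) \<Rightarrow> real"

definition coord_vec ::
    "('m, 'e::real_inner) atlas \<Rightarrow> ('m, 'e) chart \<Rightarrow> 'm \<Rightarrow> 'e \<Rightarrow> 'm tvec"
  where "coord_vec M k p e =
    (\<lambda>f. if smooth_fun M f then frechet_derivative (f \<circ> chart_inv k) (at (snd k p)) e else 0)"

definition tangent_space :: "('m, 'e::real_inner) atlas \<Rightarrow> 'm \<Rightarrow> 'm tvec set"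
  where "tangent_space M p = {coord_vec M k p e | k e. k \<in> M \<and> p \<in> fst k}"

definition vec_comp ::
    "('m, 'e::real_inner) atlas \<Rightarrow> ('m, 'e) chart \<Rightarrow> 'm \<Rightarrow> 'm tvec \<Rightarrow> 'e"
  where "vec_comp M k p v = (THE e. coord_vec M k p e = v)"

definition vector_fields :: "('m, 'e::real_inner) atlas \<Rightarrow> ('m \<Rightarrow> 'm tvec) set"
  where "vector_fields M =
    {X. (\<forall>p. X p \<in> tangent_space M p) \<and>
        (\<forall>k\<in>M. smooth_on (chart_image k)
           (\<lambda>x. vec_comp M k (chart_inv k x) (X (chart_inv k x))))}"

text \<open>
  If \<open>f\<close> is not smooth, then both summands vanish, so the bracket again has value 0 there.
\<close>

definition lie_bracket :: "('m \<Rightarrow> 'm tvec) \<Rightarrow> ('m \<Rightarrow> 'm tvec) \<Rightarrow> 'm \<Rightarrow> 'm tvec"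
  where "lie_bracket X Y p = (\<lambda>f. X p (\<lambda>q. Y q f) - Y p (\<lambda>q. X q f))"

section \<open>Differential forms\<close>

definition lincomb :: "real \<Rightarrow> ('t \<Rightarrow> real) \<Rightarrow> real \<Rightarrow> ('t \<Rightarrow> real) \<Rightarrow> 't \<Rightarrow> real"
  where "lincomb a x b y = (\<lambda>t. a * x t + b * y t)"

text \<open>
  An alternating \<open>n\<close>-form on the tangent space at \<open>p\<close> takes the list of its \<open>n\<close> arguments, and is
  0 on lists that do not consist of \<open>n\<close> tangent vectors at \<open>p\<close>. The cotangent space is the case
  \<open>n = 1\<close>.
\<close>

type_synonym 'm covec = "'m tvec list \<Rightarrow> real"
type_synonym 'm form = "'m \<Rightarrow> 'm covec"

definition alt_forms :: "('m, 'e::real_inner) atlas \<Rightarrow> nat \<Rightarrow> 'm \<Rightarrow> 'm covec set"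
  where "alt_forms M n p =
    {\<theta>. (\<forall>vs. \<not> (length vs = n \<and> set vs \<subseteq> tangent_space M p) \<longrightarrow> \<theta> vs = 0) \<and>
        (\<forall>us ws a b. \<forall>v\<in>tangent_space M p. \<forall>w\<in>tangent_space M p.
           \<theta> (us @ lincomb a v b w # ws) = a * \<theta> (us @ v # ws) + b * \<theta> (us @ w # ws)) \<and>
        (\<forall>vs. \<not> distinct vs \<longrightarrow> \<theta> vs = 0)}"

abbreviation cotangent_space :: "('m, 'e::real_inner) atlas \<Rightarrow> 'm \<Rightarrow> 'm covec set"
  where "cotangent_space M \<equiv> alt_forms M 1"

definition forms :: "('m, 'e::real_inner) atlas \<Rightarrow> nat \<Rightarrow> 'm form set"
  where "forms M n =
    {\<omega>. (\<forall>p. \<omega> p \<in> alt_forms M n p) \<and>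
        (\<forall>k\<in>M. \<forall>es. length es = n \<longrightarrow> smooth_on (chart_image k)
           (\<lambda>x. \<omega> (chart_inv k x) (map (coord_vec M k (chart_inv k x)) es)))}"

definition contract :: "('m \<Rightarrow> 'm tvec) \<Rightarrow> 'm form \<Rightarrow> 'm form"
  where "contract X \<omega> = (\<lambda>p vs. \<omega> p (X p # vs))"

definition omit :: "nat \<Rightarrow> 'a list \<Rightarrow> 'a list"
  where "omit i xs = take i xs @ drop (Suc i) xs"

text \<open>
  The exterior derivative of an \<open>n\<close>-form is characterised by the invariant formula
  \[
    d\omega(X_0,\ldots,X_n) = \sum_i (-1)^i X_i(\omega(\ldots,\widehat{X_i},\ldots))
      + \sum_{i<j} (-1)^{i+j} \omega([X_i,X_j],\ldots,\widehat{X_i},\ldots,\widehat{X_j},\ldots)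
  \]
  for all vector fields on the manifold.
\<close>

definition ext_deriv :: "('m, 'e::real_inner) atlas \<Rightarrow> nat \<Rightarrow> 'm form \<Rightarrow> 'm form"
  where "ext_deriv M n \<omega> = (THE \<zeta>. \<zeta> \<in> forms M (Suc n) \<and>
    (\<forall>Xs p. length Xs = Suc n \<and> set Xs \<subseteq> vector_fields M \<longrightarrow>
      \<zeta> p (map (\<lambda>X. X p) Xs) =
        (\<Sum>i<Suc n. (- 1) ^ i * (Xs ! i) p (\<lambda>q. \<omega> q (map (\<lambda>X. X q) (omit i Xs)))) +
        (\<Sum>j<Suc n. \<Sum>i<j. (- 1) ^ (i + j) *
           \<omega> p (lie_bracket (Xs ! i) (Xs ! j) p # map (\<lambda>X. X p) (omit i (omit j Xs))))))"

text \<open>Cartan's formula; the degree \<open>n\<close> of \<open>\<omega>\<close> is positive.\<close>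

definition lie_deriv ::
    "('m, 'e::real_inner) atlas \<Rightarrow> nat \<Rightarrow> ('m \<Rightarrow> 'm tvec) \<Rightarrow> 'm form \<Rightarrow> 'm form"
  where "lie_deriv M n X \<omega> = (\<lambda>p vs.
    contract X (ext_deriv M n \<omega>) p vs + ext_deriv M (n - 1) (contract X \<omega>) p vs)"

text \<open>
  Push-forward of tangent vectors and pull-back of alternating forms, both pointwise. For a
  diffeomorphism they preserve the value 0 outside smooth functions and tangent vectors.
\<close>

definition push_vec :: "('m \<Rightarrow> 'm) \<Rightarrow> 'm tvec \<Rightarrow> 'm tvec"
  where "push_vec \<phi> v = (\<lambda>f. v (f \<circ> \<phi>))"

definition pull_covec :: "('m \<Rightarrow> 'm) \<Rightarrow> 'm covec \<Rightarrow> 'm covec"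
  where "pull_covec \<phi> \<theta> = (\<lambda>vs. \<theta> (map (push_vec \<phi>) vs))"

definition pull_form :: "('m \<Rightarrow> 'm) \<Rightarrow> 'm form \<Rightarrow> 'm form"
  where "pull_form \<phi> \<omega> = (\<lambda>p. pull_covec \<phi> (\<omega> (\<phi> p)))"

section \<open>The bundle \<open>T \<oplus> T*\<close> and the twisted Courant bracket\<close>

type_synonym 'm gvec = "'m tvec \<times> 'm covec"

definition gen_tangent :: "('m, 'e::real_inner) atlas \<Rightarrow> 'm \<Rightarrow> 'm gvec set"
  where "gen_tangent M p = tangent_space M p \<times> cotangent_space M p"

definition gen_inner :: "'m gvec \<Rightarrow> 'm gvec \<Rightarrow> real"
  where "gen_inner a b = (snd a [fst b] + snd b [fst a]) / 2"

definition gen_sections :: "('m, 'e::real_inner) atlas \<Rightarrow> ('m \<Rightarrow> 'm gvec) set"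
  where "gen_sections M = {s. fst \<circ> s \<in> vector_fields M \<and> snd \<circ> s \<in> forms M 1}"

definition courant ::
    "('m, 'e::real_inner) atlas \<Rightarrow> 'm form \<Rightarrow> ('m \<Rightarrow> 'm gvec) \<Rightarrow> ('m \<Rightarrow> 'm gvec) \<Rightarrow> 'm \<Rightarrow> 'm gvec"
  where "courant M H a b =
    (let X = fst \<circ> a; \<xi> = snd \<circ> a; Y = fst \<circ> b; \<eta> = snd \<circ> b in
      (\<lambda>p. (lie_bracket X Y p,
            \<lambda>vs. lie_deriv M 1 X \<eta> p vs - contract Y (ext_deriv M 1 \<xi>) p vs
               + contract X (contract Y H) p vs)))"

section \<open>Bundle automorphisms\<close>

text \<open>
  The local trivialisation of the bundle over a chart \<open>k\<close> identifies the fibre at \<open>p\<close> with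
  \<open>'e \<times> 'e\<close>; a covector is represented by means of the inner product of the model space.
\<close>

definition covec_comp ::
    "('m, 'e::real_inner) atlas \<Rightarrow> ('m, 'e) chart \<Rightarrow> 'm \<Rightarrow> 'm covec \<Rightarrow> 'e"
  where "covec_comp M k p \<theta> = (THE t. \<forall>e. \<theta> [coord_vec M k p e] = t \<bullet> e)"

definition coord_covec ::
    "('m, 'e::real_inner) atlas \<Rightarrow> ('m, 'e) chart \<Rightarrow> 'm \<Rightarrow> 'e \<Rightarrow> 'm covec"
  where "coord_covec M k p t =
    (THE \<theta>. \<theta> \<in> cotangent_space M p \<and> (\<forall>e. \<theta> [coord_vec M k p e] = t \<bullet> e))"

definition to_fibre ::
    "('m, 'e::real_inner) atlas \<Rightarrow> ('m, 'e) chart \<Rightarrow> 'm \<Rightarrow> 'e \<times> 'e \<Rightarrow> 'm gvec"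
  where "to_fibre M k p z = (coord_vec M k p (fst z), coord_covec M k p (snd z))"

definition from_fibre ::
    "('m, 'e::real_inner) atlas \<Rightarrow> ('m, 'e) chart \<Rightarrow> 'm \<Rightarrow> 'm gvec \<Rightarrow> 'e \<times> 'e"
  where "from_fibre M k p a = (vec_comp M k p (fst a), covec_comp M k p (snd a))"

text \<open>
  A fibre-wise linear map covering \<open>\<phi>\<close> is given by its restrictions \<open>F p\<close> to the fibres. It is
  smooth if its expressions in the local trivialisations of the total space are smooth; the
  base component of these expressions is that of \<open>\<phi>\<close>.
\<close>

definition bundle_map ::
    "('m::topological_space, 'e::real_inner) atlas \<Rightarrow> ('m \<Rightarrow> 'm) \<Rightarrow>
      ('m \<Rightarrow> 'm gvec \<Rightarrow> 'm gvec) \<Rightarrow> bool"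
  where "bundle_map M \<phi> F \<longleftrightarrow> smooth_map M \<phi> \<and>
    (\<forall>p. \<forall>a\<in>gen_tangent M p. F p a \<in> gen_tangent M (\<phi> p)) \<and>
    (\<forall>p r s. \<forall>a\<in>gen_tangent M p. \<forall>b\<in>gen_tangent M p.
       F p (lincomb r (fst a) s (fst b), lincomb r (snd a) s (snd b)) =
         (lincomb r (fst (F p a)) s (fst (F p b)), lincomb r (snd (F p a)) s (snd (F p b)))) \<and>
    (\<forall>k\<in>M. \<forall>l\<in>M. smooth_on ((snd k ` (fst k \<inter> \<phi> -` fst l)) \<times> UNIV)
       (\<lambda>(x, z). from_fibre M l (\<phi> (chart_inv k x))
          (F (chart_inv k x) (to_fibre M k (chart_inv k x) z))))"

definition inverse_map ::
    "('m, 'e::real_inner) atlas \<Rightarrow> ('m \<Rightarrow> 'm) \<Rightarrow>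
      ('m \<Rightarrow> 'm gvec \<Rightarrow> 'm gvec) \<Rightarrow> 'm \<Rightarrow> 'm gvec \<Rightarrow> 'm gvec"
  where "inverse_map M \<phi> F q = inv_into (gen_tangent M (inv \<phi> q)) (F (inv \<phi> q))"

definition bundle_automorphism ::
    "('m::topological_space, 'e::real_inner) atlas \<Rightarrow> ('m \<Rightarrow> 'm) \<Rightarrow>
      ('m \<Rightarrow> 'm gvec \<Rightarrow> 'm gvec) \<Rightarrow> bool"
  where "bundle_automorphism M \<phi> F \<longleftrightarrow>
    bundle_map M \<phi> F \<and>
    (\<forall>p. bij_betw (F p) (gen_tangent M p) (gen_tangent M (\<phi> p))) \<and>
    bundle_map M (inv \<phi>) (inverse_map M \<phi> F)"

definition orthogonal_map ::
    "('m, 'e::real_inner) atlas \<Rightarrow> ('m \<Rightarrow> 'm gvec \<Rightarrow> 'm gvec) \<Rightarrow> bool"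
  where "orthogonal_map M F \<longleftrightarrow>
    (\<forall>p. \<forall>a\<in>gen_tangent M p. \<forall>b\<in>gen_tangent M p. gen_inner (F p a) (F p b) = gen_inner a b)"

definition push_section ::
    "('m \<Rightarrow> 'm) \<Rightarrow> ('m \<Rightarrow> 'm gvec \<Rightarrow> 'm gvec) \<Rightarrow> ('m \<Rightarrow> 'm gvec) \<Rightarrow> 'm \<Rightarrow> 'm gvec"
  where "push_section \<phi> F s = (\<lambda>q. F (inv \<phi> q) (s (inv \<phi> q)))"

definition preserves_courant ::
    "('m, 'e::real_inner) atlas \<Rightarrow> 'm form \<Rightarrow> ('m \<Rightarrow> 'm) \<Rightarrow>
      ('m \<Rightarrow> 'm gvec \<Rightarrow> 'm gvec) \<Rightarrow> bool"
  where "preserves_courant M H \<phi> F \<longleftrightarrow>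
    (\<forall>a\<in>gen_sections M. \<forall>b\<in>gen_sections M.
       push_section \<phi> F
         (courant M H (push_section (inv \<phi>) (inverse_map M \<phi> F) a)
                      (push_section (inv \<phi>) (inverse_map M \<phi> F) b)) =
       courant M H a b)"

definition exp_form :: "'m form \<Rightarrow> 'm \<Rightarrow> 'm gvec \<Rightarrow> 'm gvec"
  where "exp_form B p a = (fst a, \<lambda>vs. snd a vs + B p (fst a # vs))"

text \<open>For bijective \<open>\<phi>\<close>, pull-back along \<open>inv \<phi>\<close> is the inverse of pull-back along \<open>\<phi>\<close>.\<close>

definition lift_diffeo :: "('m \<Rightarrow> 'm) \<Rightarrow> 'm gvec \<Rightarrow> 'm gvec"
  where "lift_diffeo \<phi> a = (push_vec \<phi> (fst a), pull_covec (inv \<phi>) (snd a))"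

end

theory Submission
  imports Defs
begin

text \<open>
  The bracket satisfies \<open>[a, f b] = f [a, b] + (X f) b\<close>, where \<open>X\<close> is the vector part of \<open>a\<close>. Since \<open>F\<close>
  preserves the bracket, it follows that \<open>F\<close> induces \<open>\<phi>\<^sub>*\<close> on vector parts. Orthogonality then forces
  \<open>F (v + \<theta>) = \<phi>\<^sub>* (v + \<theta> + B(v, _))\<close> with a skew form \<open>B\<close>. Pairing the preservation of \<open>[X, Y]\<close> for vector
  fields \<open>X, Y\<close> with a third field \<open>Z\<close> gives \<open>\<phi>\<^sup>*H - H\<close> on \<open>X, Y, Z\<close> as exactly the invariant formula
  for \<open>dB\<close>. The exterior derivative being defined through global vector fields, all of this rests on
  extending tangent vectors by means of bump functions.
\<close>

section \<open>Calculus of smooth maps\<close>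

text \<open>\<open>ext_deriv\<close> is a definite description, so its value is known only once some
  form has been shown to satisfy the invariant formula. The bracket involves it in degrees 0 and 1,
  where such a form is constructed: the differential of a function, and the antisymmetrised
  derivative in a chart. In degree 2 nothing has to be constructed: the pull-back of
  \<open>H\<close> minus \<open>H\<close> is at hand as a smooth 3-form and only has to satisfy the
  formula for \<open>B\<close>. The model space is given by the mere existence of a finite
  orthonormal basis, possibly empty. Compactness of balls, the chain rule for iterated derivatives
  and smoothness in a varying direction are therefore all obtained by expansion along such a
  basis.\<close>

abbreviation FD :: "('a::real_normed_vector \<Rightarrow> 'b::real_normed_vector) \<Rightarrow> 'a \<Rightarrow> 'a \<Rightarrow> 'b"
  where "FD f x \<equiv> frechet_derivative f (at x)"

text \<open>The condition \<open>model_space\<close> as a predicate. It is also needed for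
  \<open>real\<close> and for products of model spaces, since the chain rule
  \<open>Ck_on_compose\<close> asks for a basis of the intermediate space.\<close>

definition onb :: "'e::real_inner set \<Rightarrow> bool"
  where "onb B \<longleftrightarrow> finite B \<and> (\<forall>u\<in>B. \<forall>v\<in>B. u \<bullet> v = (if u = v then 1 else 0)) \<and> span B = UNIV"

lemma onb_expand: "onb B \<Longrightarrow> (\<Sum>b\<in>B. (x \<bullet> b) *\<^sub>R b) = x"
  by (rule orthonormal_basis_expand)
     (auto simp: onb_def pairwise_def orthogonal_def norm_eq_sqrt_inner)

lemma has_FD: "f differentiable (at x) \<Longrightarrow> (f has_derivative FD f x) (at x)"
  by (simp add: frechet_derivative_works)

lemma FD_eq: "(f has_derivative f') (at x) \<Longrightarrow> FD f x v = f' v"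
  using frechet_derivative_at by metis

lemma linear_FD: "f differentiable (at x) \<Longrightarrow> linear (FD f x)"
  using has_FD has_derivative_linear by blast

text \<open>Openness of \<open>S\<close> matters because \<open>FD\<close> is the derivative in the
  ambient space: at a boundary point it would see values of \<open>f\<close> and \<open>g\<close>
  outside \<open>S\<close>.\<close>

lemma Ck_on_cong:
  assumes "open S" "\<And>x. x \<in> S \<Longrightarrow> f x = g x" "Ck_on n S f"
  shows "Ck_on n S g"
  using assms(2,3)
proof (induction n arbitrary: f g)
  case 0
  then show ?case using continuous_on_cong[of S S f g] by simp
next
  case (Suc n)
  have d: "f differentiable (at x)" if "x \<in> S" for x using Suc that by simp
  have "(g has_derivative FD f x) (at x)" if "x \<in> S" for x
    using has_derivative_transform_within_open[OF has_FD[OF d[OF that]] assms(1) that] Suc by blast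
  moreover from this have "FD f x v = FD g x v" if "x \<in> S" for x v
    using FD_eq that by metis
  ultimately show ?case
    using Suc.IH[of "\<lambda>x. FD f x v" "\<lambda>x. FD g x v" for v] Suc.prems(2)
    unfolding Ck_on.simps differentiable_def by blast
qed

lemma Ck_on_SucI:
  assumes "open S" "\<And>x. x \<in> S \<Longrightarrow> (f has_derivative f' x) (at x)"
    "\<And>v. Ck_on n S (\<lambda>x. f' x v)"
  shows "Ck_on (Suc n) S f"
proof -
  have "Ck_on n S (\<lambda>x. FD f x v)" for v
    by (rule Ck_on_cong[OF assms(1) _ assms(3)[of v]]) (simp add: FD_eq[OF assms(2)])
  then show ?thesis using assms(2) by (auto simp: differentiable_def)
qed

lemma Ck_on_subset: "Ck_on n S f \<Longrightarrow> T \<subseteq> S \<Longrightarrow> Ck_on n T f"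
  by (induction n arbitrary: f) (auto intro: continuous_on_subset)

lemma Ck_on_local:
  assumes "\<And>x. x \<in> S \<Longrightarrow> \<exists>U. open U \<and> x \<in> U \<and> Ck_on n U f"
  shows "Ck_on n S f"
  using assms
proof (induction n arbitrary: f)
  case 0
  show ?case
    unfolding Ck_on.simps
  proof (rule continuous_at_imp_continuous_on, rule ballI)
    fix x assume "x \<in> S"
    with 0 obtain U where "open U" "x \<in> U" "continuous_on U f" by auto
    then show "isCont f x" using continuous_on_eq_continuous_at by blast
  qed
next
  case (Suc n)
  have "\<forall>x\<in>S. f differentiable at x" using Suc.prems by fastforce
  moreover have "Ck_on n S (\<lambda>x. FD f x v)" for v
    by (rule Suc.IH) (use Suc.prems in fastforce)
  ultimately show ?case by simp
qed

lemma Ck_on_continuous: "Ck_on n S f \<Longrightarrow> continuous_on S f"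
  by (cases n)
     (auto intro!: continuous_at_imp_continuous_on differentiable_imp_continuous_within)

text \<open>The product and chain rules leave undifferentiated factors, which have to be lowered by
  one order before the induction hypothesis applies.\<close>

lemma Ck_on_Suc_imp: "Ck_on (Suc n) S f \<Longrightarrow> Ck_on n S f"
proof (induction n arbitrary: f)
  case 0
  then show ?case using Ck_on_continuous[OF 0] by simp
next
  case (Suc n)
  have "Ck_on n S (\<lambda>x. FD f x v)" for v
    by (rule Suc.IH) (use Suc.prems in auto)
  then show ?case using Suc.prems by simp
qed

lemma Ck_on_const: "Ck_on n S (\<lambda>x. c)"
  by (induction n arbitrary: c) auto

lemma Ck_on_bounded_linear:
  assumes "bounded_linear L" "open S" "Ck_on n S f"
  shows "Ck_on n S (\<lambda>x. L (f x))"
  using assms(3)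
proof (induction n arbitrary: f)
  case 0
  then show ?case using bounded_linear.continuous_on[OF assms(1)] by simp
next
  case (Suc n)
  show ?case
  proof (rule Ck_on_SucI[OF assms(2)])
    fix x assume "x \<in> S"
    then show "((\<lambda>x. L (f x)) has_derivative (\<lambda>v. L (FD f x v))) (at x)"
      using Suc.prems has_FD by (auto intro!: bounded_linear.has_derivative[OF assms(1)])
  qed (use Suc in auto)
qed

lemma Ck_on_add:
  assumes "open S" "Ck_on n S f" "Ck_on n S g"
  shows "Ck_on n S (\<lambda>x. f x + g x)"
  using assms(2,3)
proof (induction n arbitrary: f g)
  case 0
  then show ?case by (simp add: continuous_on_add)
next
  case (Suc n)
  show ?case
  proof (rule Ck_on_SucI[OF assms(1)])
    fix x assume "x \<in> S"
    then show "((\<lambda>x. f x + g x) has_derivative (\<lambda>v. FD f x v + FD g x v)) (at x)"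
      using Suc.prems has_FD by (auto intro!: has_derivative_add)
  qed (use Suc in auto)
qed

lemma Ck_on_bilinear:
  assumes "bounded_bilinear p" "open S" "Ck_on n S f" "Ck_on n S g"
  shows "Ck_on n S (\<lambda>x. p (f x) (g x))"
  using assms(3,4)
proof (induction n arbitrary: f g)
  case 0
  then show ?case using bounded_bilinear.continuous_on[OF assms(1)] by auto
next
  case (Suc n)
  show ?case
  proof (rule Ck_on_SucI[OF assms(2)])
    fix x assume "x \<in> S"
    then show "((\<lambda>x. p (f x) (g x)) has_derivative (\<lambda>v. p (f x) (FD g x v) + p (FD f x v) (g x))) (at x)"
      using Suc.prems by (auto intro!: bounded_bilinear.FDERIV[OF assms(1)] has_FD)
  next
    fix v
    show "Ck_on n S (\<lambda>x. p (f x) (FD g x v) + p (FD f x v) (g x))"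
      by (intro Ck_on_add[OF assms(2)] Suc.IH Ck_on_Suc_imp[OF Suc.prems(1)] 
          Ck_on_Suc_imp[OF Suc.prems(2)]) (use Suc.prems in auto)
  qed
qed

lemma Ck_on_sum:
  assumes "open S" "\<And>i. i \<in> I \<Longrightarrow> Ck_on n S (f i)"
  shows "Ck_on n S (\<lambda>x. \<Sum>i\<in>I. f i x)"
  using assms(2)
  by (induction I rule: infinite_finite_induct) (auto intro!: Ck_on_const Ck_on_add assms(1))

text \<open>\<open>Ck_on\<close> speaks of derivatives of \<open>g\<close> in fixed directions only,
  whereas the chain rule produces the moving direction \<open>FD f x v\<close>. Expanding it along
  \<open>B\<close> gives a finite sum of scalar functions times \<open>FD g (f x) b\<close> with
  fixed \<open>b\<close>, to which the induction hypothesis applies.\<close>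

lemma Ck_on_compose:
  fixes f :: "'a::real_normed_vector \<Rightarrow> 'e::real_inner" and B :: "'e set"
  assumes B: "onb B" and S: "open S" and T: "open T" and ST: "f ` S \<subseteq> T"
    and "Ck_on n T g" "Ck_on n S f"
  shows "Ck_on n S (\<lambda>x. g (f x))"
  using assms(5,6)
proof (induction n arbitrary: g)
  case 0
  then show ?case using continuous_on_compose2 ST by auto
next
  case (Suc n)
  show ?case
  proof (rule Ck_on_SucI[OF S])
    fix x assume x: "x \<in> S"
    then have fx: "g differentiable (at (f x))" "f differentiable (at x)" using ST Suc.prems by auto
    have "((\<lambda>x. g (f x)) has_derivative (\<lambda>v. FD g (f x) (FD f x v))) (at x)"
      using diff_chain_at[OF has_FD[OF fx(2)] has_FD[OF fx(1)]] by (simp add: o_def)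
    moreover have "FD g (f x) (FD f x v) = (\<Sum>b\<in>B. (FD f x v \<bullet> b) *\<^sub>R FD g (f x) b)" for v
    proof -
      have "FD g (f x) (FD f x v) = FD g (f x) (\<Sum>b\<in>B. (FD f x v \<bullet> b) *\<^sub>R b)"
        using onb_expand[OF B] by simp
      then show ?thesis using linear_FD[OF fx(1)] by (simp add: linear_sum linear_scale)
    qed
    ultimately show "((\<lambda>x. g (f x)) has_derivative (\<lambda>v. \<Sum>b\<in>B. (FD f x v \<bullet> b) *\<^sub>R FD g (f x) b)) (at x)"
      by simp
  next
    fix v
    show "Ck_on n S (\<lambda>x. \<Sum>b\<in>B. (FD f x v \<bullet> b) *\<^sub>R FD g (f x) b)"
    proof (intro Ck_on_sum[OF S] Ck_on_bilinear[OF bounded_bilinear_scaleR S])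
      fix b assume "b \<in> B"
      show "Ck_on n S (\<lambda>x. FD f x v \<bullet> b)"
        using Ck_on_bounded_linear[OF bounded_linear_inner_left S, of n "\<lambda>x. FD f x v" b] Suc.prems 
        by simp
      show "Ck_on n S (\<lambda>x. FD g (f x) b)"
        using Suc.IH[of "\<lambda>y. FD g y b"] Suc.prems Ck_on_Suc_imp by auto
    qed
  qed
qed

section \<open>Rules for maps of class C-infinity\<close>

lemma smooth_on_cong: "open S \<Longrightarrow> smooth_on S f \<Longrightarrow> (\<And>x. x \<in> S \<Longrightarrow> f x = g x) \<Longrightarrow> smooth_on S g"
  unfolding smooth_on_def using Ck_on_cong by blast

lemma smooth_on_subset: "smooth_on S f \<Longrightarrow> T \<subseteq> S \<Longrightarrow> smooth_on T f"
  unfolding smooth_on_def using Ck_on_subset by blast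

lemma smooth_on_local:
  assumes "\<And>x. x \<in> S \<Longrightarrow> \<exists>U. open U \<and> x \<in> U \<and> smooth_on U f"
  shows "smooth_on S f"
  unfolding smooth_on_def
proof
  fix n show "Ck_on n S f"
    by (rule Ck_on_local) (use assms in \<open>auto simp: smooth_on_def\<close>)
qed

lemma smooth_on_continuous: "smooth_on S f \<Longrightarrow> continuous_on S f"
  unfolding smooth_on_def using Ck_on_continuous by blast

lemma smooth_on_differentiable:
  assumes "smooth_on S f" "x \<in> S"
  shows "f differentiable (at x)"
proof -
  have "Ck_on (Suc 0) S f" using assms(1) unfolding smooth_on_def by blast
  then show ?thesis using assms(2) by simp
qed

lemma smooth_on_FD:
  assumes "smooth_on S f"
  shows "smooth_on S (\<lambda>x. FD f x v)"
  unfolding smooth_on_def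
proof
  fix n
  have "Ck_on (Suc n) S f" using assms(1) unfolding smooth_on_def by blast
  then show "Ck_on n S (\<lambda>x. FD f x v)" by simp
qed

lemma smooth_on_const: "smooth_on S (\<lambda>x. c)"
  unfolding smooth_on_def using Ck_on_const by blast

lemma smooth_on_bounded_linear:
  "bounded_linear L \<Longrightarrow> open S \<Longrightarrow> smooth_on S f \<Longrightarrow> smooth_on S (\<lambda>x. L (f x))"
  unfolding smooth_on_def using Ck_on_bounded_linear by blast

lemma smooth_on_ident: "open S \<Longrightarrow> smooth_on S (\<lambda>x. x)"
  unfolding smooth_on_def
proof
  fix n assume "open S"
  then show "Ck_on n S (\<lambda>x. x)"
    by (cases n) (auto intro!: Ck_on_SucI[where f' = "\<lambda>_ v. v"] has_derivative_ident Ck_on_const 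
      simp del: Ck_on.simps(2))
qed

lemma smooth_on_add:
  "open S \<Longrightarrow> smooth_on S f \<Longrightarrow> smooth_on S g \<Longrightarrow> smooth_on S (\<lambda>x. f x + g x)"
  unfolding smooth_on_def using Ck_on_add by blast

lemma smooth_on_bilinear:
  "bounded_bilinear p \<Longrightarrow> open S \<Longrightarrow> smooth_on S f \<Longrightarrow> smooth_on S g \<Longrightarrow> smooth_on S (\<lambda>x. p (f x) (g x))"
  unfolding smooth_on_def using Ck_on_bilinear by blast

lemmas smooth_on_scaleR = smooth_on_bilinear[OF bounded_bilinear_scaleR]
lemmas smooth_on_inner = smooth_on_bilinear[OF bounded_bilinear_inner]
lemmas smooth_on_mult = smooth_on_bilinear[OF bounded_bilinear_mult]

lemma smooth_on_minus: "open S \<Longrightarrow> smooth_on S f \<Longrightarrow> smooth_on S (\<lambda>x. - f x)"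
  using smooth_on_bounded_linear[OF bounded_linear_minus[OF bounded_linear_ident]] .

lemma smooth_on_diff:
  "open S \<Longrightarrow> smooth_on S f \<Longrightarrow> smooth_on S g \<Longrightarrow> smooth_on S (\<lambda>x. f x - g x)"
  using smooth_on_add[of S f "\<lambda>x. - g x"] smooth_on_minus[of S g] by simp

lemma smooth_on_sum:
  "open S \<Longrightarrow> (\<And>i. i \<in> I \<Longrightarrow> smooth_on S (f i)) \<Longrightarrow> smooth_on S (\<lambda>x. \<Sum>i\<in>I. f i x)"
  unfolding smooth_on_def by (auto intro: Ck_on_sum)

lemma smooth_on_compose:
  fixes f :: "'a::real_normed_vector \<Rightarrow> 'e::real_inner" and B :: "'e set"
  assumes "onb B" "open S" "open T" "f ` S \<subseteq> T" "smooth_on T g" "smooth_on S f"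
  shows "smooth_on S (\<lambda>x. g (f x))"
  unfolding smooth_on_def
proof
  fix n
  show "Ck_on n S (\<lambda>x. g (f x))"
    using Ck_on_compose[OF assms(1-4), of n g] assms(5,6) unfolding smooth_on_def by blast
qed

lemma FD_onb:
  fixes f :: "'e::real_inner \<Rightarrow> 'b::real_normed_vector" and B :: "'e set"
  assumes "onb B" "f differentiable (at x)"
  shows "FD f x v = (\<Sum>b\<in>B. (v \<bullet> b) *\<^sub>R FD f x b)"
proof -
  have "FD f x v = FD f x (\<Sum>b\<in>B. (v \<bullet> b) *\<^sub>R b)"
    using onb_expand[OF assms(1)] by simp
  then show ?thesis using linear_FD[OF assms(2)] by (simp add: linear_sum linear_scale)
qed

text \<open>Base point and direction both move here. Derivatives along vector fields, brackets and
  push-forwards have this shape in coordinates.\<close>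

lemma smooth_on_FD_apply:
  fixes f :: "'e::real_inner \<Rightarrow> 'b::real_normed_vector" and B :: "'e set"
  assumes "onb B" "open S" "open T" "y ` S \<subseteq> T" "smooth_on S y" "smooth_on T f" "smooth_on S g"
  shows "smooth_on S (\<lambda>x. FD f (y x) (g x))"
proof (rule smooth_on_cong[OF assms(2)])
  show "smooth_on S (\<lambda>x. \<Sum>b\<in>B. (g x \<bullet> b) *\<^sub>R FD f (y x) b)"
    by (intro smooth_on_sum smooth_on_scaleR smooth_on_inner assms smooth_on_const 
      smooth_on_compose[OF assms(1-4), of "\<lambda>y. FD f y b" for b] smooth_on_FD)
  fix x assume "x \<in> S"
  then have "f differentiable (at (y x))" using assms smooth_on_differentiable by blast
  then show "(\<Sum>b\<in>B. (g x \<bullet> b) *\<^sub>R FD f (y x) b) = FD f (y x) (g x)"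
    using FD_onb[OF assms(1)] by metis
qed

section \<open>Symmetry of second derivatives\<close>

lemma DERIV_line:
  assumes "f differentiable (at (a + t *\<^sub>R v))"
  shows "((\<lambda>t. f (a + t *\<^sub>R v)) has_real_derivative FD f (a + t *\<^sub>R v) v) (at t)"
proof -
  have "((\<lambda>t. a + t *\<^sub>R v) has_derivative (\<lambda>t. t *\<^sub>R v)) (at t)"
    by (auto intro!: derivative_eq_intros)
  from diff_chain_at[OF this has_FD[OF assms]]
  have "((\<lambda>t. f (a + t *\<^sub>R v)) has_derivative (\<lambda>s. FD f (a + t *\<^sub>R v) (s *\<^sub>R v))) (at t)"
    by (simp add: o_def)
  moreover have "FD f (a + t *\<^sub>R v) (s *\<^sub>R v) = FD f (a + t *\<^sub>R v) v * s" for s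
    using linear_scale[OF linear_FD[OF assms]] by simp
  ultimately show ?thesis by (simp add: has_field_derivative_def)
qed

text \<open>The mean value theorem is used along \<open>v\<close>, for the increment in direction
  \<open>w\<close>, and then along \<open>w\<close>, for the derivative in direction
  \<open>v\<close>. Exchanging \<open>v\<close> and \<open>w\<close> leaves the left side unchanged
  and turns the right side into the other mixed derivative.\<close>

lemma second_difference:
  fixes f :: "'a::real_normed_vector \<Rightarrow> real"
  assumes f: "smooth_on S f" and h: "h > 0"
    and S: "\<And>s t. 0 \<le> s \<Longrightarrow> s \<le> h \<Longrightarrow> 0 \<le> t \<Longrightarrow> t \<le> h \<Longrightarrow> x + s *\<^sub>R v + t *\<^sub>R w \<in> S"
  shows "\<exists>s t. 0 < s \<and> s < h \<and> 0 < t \<and> t < h \<and>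
    f (x + h *\<^sub>R v + h *\<^sub>R w) - f (x + h *\<^sub>R v) - (f (x + h *\<^sub>R w) - f x) =
      h * (h * FD (\<lambda>y. FD f y v) (x + s *\<^sub>R v + t *\<^sub>R w) w)"
proof -
  have d1: "((\<lambda>s. f (x + h *\<^sub>R w + s *\<^sub>R v) - f (x + s *\<^sub>R v)) has_real_derivative
      FD f (x + h *\<^sub>R w + s *\<^sub>R v) v - FD f (x + s *\<^sub>R v) v) (at s)" if "0 \<le> s" "s \<le> h" for s
    using S[of s h] S[of s 0] h that
    by (intro DERIV_diff DERIV_line smooth_on_differentiable[OF f]) (simp_all add: algebra_simps)
  obtain s where s: "0 < s" "s < h"
    "(f (x + h *\<^sub>R w + h *\<^sub>R v) - f (x + h *\<^sub>R v)) - (f (x + h *\<^sub>R w) - f x) =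
      h * (FD f (x + h *\<^sub>R w + s *\<^sub>R v) v - FD f (x + s *\<^sub>R v) v)"
    using MVT2[OF h d1] by auto
  have d2: "((\<lambda>t. FD f (x + s *\<^sub>R v + t *\<^sub>R w) v) has_real_derivative
      FD (\<lambda>y. FD f y v) (x + s *\<^sub>R v + t *\<^sub>R w) w) (at t)" if "0 \<le> t" "t \<le> h" for t
    using S[of s t] s that
    by (intro DERIV_line[where f = "\<lambda>y. FD f y v"] smooth_on_differentiable[OF smooth_on_FD[OF f]]) simp_all
  obtain t where t: "0 < t" "t < h"
    "FD f (x + s *\<^sub>R v + h *\<^sub>R w) v - FD f (x + s *\<^sub>R v) v =
      h * FD (\<lambda>y. FD f y v) (x + s *\<^sub>R v + t *\<^sub>R w) w"
    using MVT2[OF h d2] by auto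
  show ?thesis using s t by (intro exI[of _ s] exI[of _ t]) (simp add: algebra_simps)
qed

text \<open>If the mixed derivatives differed at \<open>x\<close>, continuity would keep each of
  them near its own value, within half the distance of the two. The second difference, computed in
  both orders, makes a value of one equal to a value of the other close to \<open>x\<close>.\<close>

lemma FD_FD_commute:
  fixes f :: "'a::real_normed_vector \<Rightarrow> real"
  assumes S: "open S" and f: "smooth_on S f" and x: "x \<in> S"
  shows "FD (\<lambda>y. FD f y v) x w = FD (\<lambda>y. FD f y w) x v"
proof (rule ccontr)
  define P where "P = (\<lambda>y. FD (\<lambda>y. FD f y v) y w)"
  define Q where "Q = (\<lambda>y. FD (\<lambda>y. FD f y w) y v)"
  assume "FD (\<lambda>y. FD f y v) x w \<noteq> FD (\<lambda>y. FD f y w) x v"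
  then have d: "dist (P x) (Q x) / 2 > 0" by (simp add: P_def Q_def)
  have "isCont P x" "isCont Q x"
    unfolding P_def Q_def using smooth_on_continuous[OF smooth_on_FD[OF smooth_on_FD[OF f]]]
      continuous_on_eq_continuous_at[OF S] x by blast+
  then obtain e1 e2 where e: "e1 > 0" "e2 > 0" "\<And>y. dist y x < e1 \<Longrightarrow> dist (P y) (P x) < dist (P x) (Q x) / 2"
    "\<And>y. dist y x < e2 \<Longrightarrow> dist (Q y) (Q x) < dist (P x) (Q x) / 2"
    unfolding continuous_at_eps_delta using d by metis
  obtain r where r: "r > 0" "ball x r \<subseteq> S" using S x openE by blast
  define m where "m = min r (min e1 e2)"
  \<comment> \<open>With this \<open>c\<close> and the next \<open>h\<close>, the parallelogram
    spanned by \<open>h\<close> times \<open>v\<close> and \<open>h\<close> times \<open>w\<close>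
    stays within \<open>m / 2\<close> of \<open>x\<close>. The summand 1 keeps \<open>c\<close>
    positive when both directions vanish.\<close>
  define c where "c = norm v + norm w + 1"
  define h where "h = m / (2 * c)"
  have c: "c > 0" unfolding c_def by (simp add: add_nonneg_pos)
  have m: "m > 0" unfolding m_def using r e by simp
  have h: "h > 0" unfolding h_def using c m by simp
  have near: "dist (x + s *\<^sub>R v + t *\<^sub>R w) x < m" if "0 \<le> s" "s \<le> h" "0 \<le> t" "t \<le> h" for s t
  proof -
    have "dist (x + s *\<^sub>R v + t *\<^sub>R w) x = norm (s *\<^sub>R v + t *\<^sub>R w)"
      by (simp add: dist_norm add.assoc)
    also have "\<dots> \<le> norm (s *\<^sub>R v) + norm (t *\<^sub>R w)" by (rule norm_triangle_ineq)
    also have "\<dots> \<le> h * norm v + h * norm w"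
      using that by (intro add_mono) (simp_all add: mult_right_mono)
    also have "\<dots> \<le> h * c" using h by (simp add: c_def algebra_simps)
    also have "\<dots> = m / 2" using c by (simp add: h_def)
    also have "\<dots> < m" using m by simp
    finally show ?thesis .
  qed
  then have inS: "x + s *\<^sub>R v + t *\<^sub>R w \<in> S" if "0 \<le> s" "s \<le> h" "0 \<le> t" "t \<le> h" for s t
    using that r(2) by (force simp: m_def dist_commute)
  obtain s t where 1: "0 < s" "s < h" "0 < t" "t < h"
    "f (x + h *\<^sub>R v + h *\<^sub>R w) - f (x + h *\<^sub>R v) - (f (x + h *\<^sub>R w) - f x) =
      h * (h * P (x + s *\<^sub>R v + t *\<^sub>R w))"
    using second_difference[OF f h, of x v w] inS unfolding P_def by blast
  have inS': "x + s *\<^sub>R w + t *\<^sub>R v \<in> S" if "0 \<le> s" "s \<le> h" "0 \<le> t" "t \<le> h" for s t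
    using inS[OF that(3,4,1,2)] by (simp add: algebra_simps)
  obtain s' t' where 2: "0 < s'" "s' < h" "0 < t'" "t' < h"
    "f (x + h *\<^sub>R w + h *\<^sub>R v) - f (x + h *\<^sub>R w) - (f (x + h *\<^sub>R v) - f x) =
      h * (h * Q (x + s' *\<^sub>R w + t' *\<^sub>R v))"
    using second_difference[OF f h, of x w v] inS' unfolding Q_def by blast
  have "P (x + s *\<^sub>R v + t *\<^sub>R w) = Q (x + t' *\<^sub>R v + s' *\<^sub>R w)"
  proof -
    have "h * (h * P (x + s *\<^sub>R v + t *\<^sub>R w)) = h * (h * Q (x + s' *\<^sub>R w + t' *\<^sub>R v))"
      unfolding 1(5)[symmetric] 2(5)[symmetric] by (simp add: algebra_simps)
    then show ?thesis using h by (simp add: algebra_simps)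
  qed
  moreover have "dist (P (x + s *\<^sub>R v + t *\<^sub>R w)) (P x) < dist (P x) (Q x) / 2"
    using near[of s t] 1 by (intro e) (simp add: m_def)
  moreover have "dist (Q (x + t' *\<^sub>R v + s' *\<^sub>R w)) (Q x) < dist (P x) (Q x) / 2"
    using near[of t' s'] 2 by (intro e) (simp add: m_def)
  ultimately show False
    by (metis dist_commute dist_triangle_half_r less_irrefl)
qed

section \<open>Bump functions\<close>

text \<open>The family is closed under differentiation up to linear combinations, so its smoothness
  follows by one induction for all \<open>k\<close> at once.\<close>

definition flat :: "nat \<Rightarrow> real \<Rightarrow> real"
  where "flat k t = (if t > 0 then inverse t ^ k * exp (- inverse t) else 0)"

lemma flat_tendsto_0: "(flat k \<longlongrightarrow> 0) (at 0)"
proof (rule filterlim_split_at)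
  have "(flat k \<longlongrightarrow> 0) (at_left 0) \<longleftrightarrow> ((\<lambda>_. 0::real) \<longlongrightarrow> 0) (at_left (0::real))"
    by (rule filterlim_cong) (auto simp: flat_def eventually_at_filter)
  then show "(flat k \<longlongrightarrow> 0) (at_left 0)" by simp
  have "((\<lambda>t. inverse t ^ k / exp (inverse t)) \<longlongrightarrow> 0) (at_right (0::real))"
    by (rule filterlim_compose[OF tendsto_power_div_exp_0 filterlim_inverse_at_top_right])
  moreover have "(flat k \<longlongrightarrow> 0) (at_right 0) \<longleftrightarrow>
      ((\<lambda>t. inverse t ^ k / exp (inverse t)) \<longlongrightarrow> 0) (at_right (0::real))"
    by (rule filterlim_cong) (auto simp: flat_def eventually_at_filter exp_minus divide_inverse)
  ultimately show "(flat k \<longlongrightarrow> 0) (at_right 0)" by simp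
qed

lemma DERIV_flat:
  "(flat k has_real_derivative (flat (k + 2) t - real k * flat (k + 1) t)) (at t)"
proof (cases t "0::real" rule: linorder_cases)
  case less
  have "((\<lambda>_. 0) has_real_derivative 0) (at t)" by simp
  from has_field_derivative_transform_within_open[OF this, of "{..<0}" "flat k"] less
  show ?thesis by (simp add: flat_def)
next
  case equal
  \<comment> \<open>The difference quotient at 0 is the next member of the family, also at
    \<open>y = 0\<close>, where division by 0 returns 0. So \<open>flat_tendsto_0\<close> yields the
    derivative.\<close>
  have "(\<lambda>y. (flat k y - flat k 0) / (y - 0)) = flat (k + 1)"
    by (rule ext) (simp add: flat_def divide_inverse)
  moreover have "flat (k + 2) 0 - real k * flat (k + 1) 0 = 0" by (simp add: flat_def)
  ultimately show ?thesis
    unfolding equal has_field_derivative_iff using flat_tendsto_0[of "k + 1"] by metis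
next
  case greater
  have "((\<lambda>t. inverse t ^ k * exp (- inverse t)) has_real_derivative
      inverse t ^ k * (exp (- inverse t) * inverse t ^ 2) +
      real k * (inverse t ^ (k - Suc 0) * - (inverse t ^ 2)) * exp (- inverse t)) (at t)"
    using greater by (auto intro!: derivative_eq_intros simp: power2_eq_square)
  also have "inverse t ^ k * (exp (- inverse t) * inverse t ^ 2) +
      real k * (inverse t ^ (k - Suc 0) * - (inverse t ^ 2)) * exp (- inverse t) =
      flat (k + 2) t - real k * flat (k + 1) t"
    \<comment> \<open>For \<open>k = 0\<close> the truncated exponent \<open>k - Suc 0\<close> does
      no harm because of the factor \<open>real k\<close>.\<close>
    using greater by (cases k) (simp_all add: flat_def power2_eq_square)
  finally show ?thesis
    using has_field_derivative_transform_within_open[of "\<lambda>t. inverse t ^ k * exp (- inverse t)" _ t "{0<..}" "flat k"]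
      greater by (simp add: flat_def)
qed

lemma smooth_on_flat: "smooth_on UNIV (flat k)"
  unfolding smooth_on_def
proof
  fix n show "Ck_on n UNIV (flat k)"
  proof (induction n arbitrary: k)
    case 0
    then show ?case
      by (auto intro!: continuous_at_imp_continuous_on DERIV_isCont[OF DERIV_flat])
  next
    case (Suc n)
    show ?case
    proof (rule Ck_on_SucI)
      show "(flat k has_derivative (\<lambda>v. (flat (k + 2) t + - real k * flat (k + 1) t) * v)) (at t)" for t
        using DERIV_flat[of k t] by (simp add: has_field_derivative_def)
      show "Ck_on n UNIV (\<lambda>t. (flat (k + 2) t + - real k * flat (k + 1) t) * v)" for v
        by (intro Ck_on_add Ck_on_bilinear[OF bounded_bilinear_mult] Ck_on_const Suc.IH) simp_all
    qed simp
  qed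
qed

text \<open>The squared distance is used because, unlike the distance, it is smooth at the centre
  too. The denominator is the value of the numerator at the centre.\<close>

definition bump :: "'e::real_inner \<Rightarrow> real \<Rightarrow> 'e \<Rightarrow> real"
  where "bump c r x = flat 0 (r\<^sup>2 - (x - c) \<bullet> (x - c)) / flat 0 (r\<^sup>2)"

lemma smooth_on_bump: "smooth_on UNIV (bump c r)"
proof -
  have b: "onb {1::real}"
    unfolding onb_def by (auto simp: span_singleton)
  have "smooth_on UNIV (\<lambda>x. r\<^sup>2 - (x - c) \<bullet> (x - c))"
    by (intro smooth_on_diff smooth_on_inner smooth_on_const smooth_on_ident) simp_all
  from smooth_on_compose[OF b _ _ _ smooth_on_flat this]
  have "smooth_on UNIV (\<lambda>x. flat 0 (r\<^sup>2 - (x - c) \<bullet> (x - c)))" by simp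
  then have "smooth_on UNIV (\<lambda>x. flat 0 (r\<^sup>2 - (x - c) \<bullet> (x - c)) * inverse (flat 0 (r\<^sup>2)))"
    by (intro smooth_on_mult smooth_on_const) simp_all
  moreover have "bump c r = (\<lambda>x. flat 0 (r\<^sup>2 - (x - c) \<bullet> (x - c)) * inverse (flat 0 (r\<^sup>2)))"
    by (simp add: fun_eq_iff bump_def divide_inverse)
  ultimately show ?thesis by simp
qed

lemma bump_centre: "r > 0 \<Longrightarrow> bump c r c = 1"
  by (simp add: bump_def flat_def)

lemma bump_outside: "r > 0 \<Longrightarrow> x \<notin> cball c r \<Longrightarrow> bump c r x = 0"
proof -
  assume "r > 0" "x \<notin> cball c r"
  then have "r \<le> norm (x - c)" by (simp add: dist_norm norm_minus_commute)
  then have "r\<^sup>2 \<le> (x - c) \<bullet> (x - c)"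
    using \<open>r > 0\<close> by (simp add: power_mono flip: power2_norm_eq_inner)
  then show ?thesis by (simp add: bump_def flat_def)
qed

text \<open>The ball is a closed subset of the set \<open>K B\<close> of combinations with bounded
  coefficients, and \<open>K B\<close> is compact as a continuous image of a product, built one
  basis vector at a time. Compactness is what will make the preimage of a ball under a chart closed
  in the manifold.\<close>

lemma compact_cball_onb:
  fixes c :: "'e::real_inner"
  assumes B: "onb (B :: 'e set)"
  shows "compact (cball c r)"
proof -
  \<comment> \<open>\<open>norm c + r\<close> bounds the norm of every point of the ball, hence by
    Cauchy-Schwarz its coefficient along each unit vector of \<open>B\<close>.\<close>
  define K where "K A = {\<Sum>b\<in>A. f b *\<^sub>R b | f. \<forall>b\<in>A. \<bar>f b\<bar> \<le> (norm c + r)}" for A :: "'e set"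
  have "compact (K A)" if "finite A" for A
    using that
  proof (induction A)
    case empty
    then show ?case by (simp add: K_def)
  next
    case (insert a A)
    have "K (insert a A) = (\<lambda>(s, y). s *\<^sub>R a + y) ` ({-(norm c + r)..norm c + r} \<times> K A)" (is "_ = ?R")
    proof
      show "K (insert a A) \<subseteq> ?R"
        unfolding K_def using insert by (fastforce simp: abs_le_iff)
      show "?R \<subseteq> K (insert a A)"
      proof clarsimp
        fix s y assume s: "- norm c - r \<le> s" "s \<le> norm c + r" and "y \<in> K A"
        then obtain f where f: "y = (\<Sum>b\<in>A. f b *\<^sub>R b)" "\<forall>b\<in>A. \<bar>f b\<bar> \<le> norm c + r"
          unfolding K_def by auto
        have "(\<Sum>b\<in>insert a A. (f(a := s)) b *\<^sub>R b) = s *\<^sub>R a + y"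
          using insert f by (auto intro: sum.cong)
        moreover have "\<forall>b\<in>insert a A. \<bar>(f(a := s)) b\<bar> \<le> norm c + r"
          using f s by (auto simp: abs_le_iff)
        ultimately show "s *\<^sub>R a + y \<in> K (insert a A)" unfolding K_def
          by (intro CollectI exI[of _ "f(a := s)"]) simp
      qed
    qed
    moreover have "compact ?R"
      by (intro compact_continuous_image compact_Times insert.IH compact_Icc)
         (auto simp: case_prod_unfold intro!: continuous_intros)
    ultimately show ?case by simp
  qed
  then have "compact (K B)" using B by (simp add: onb_def)
  moreover have "cball c r \<subseteq> K B"
  proof
    fix x assume "x \<in> cball c r"
    then have "norm x \<le> norm c + r"
      using norm_triangle_ineq[of c "x - c"] by (simp add: dist_norm norm_minus_commute)
    moreover have "\<bar>x \<bullet> b\<bar> \<le> norm x" if "b \<in> B" for b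
    proof -
      have "norm b = 1" using B that by (simp add: onb_def norm_eq_sqrt_inner)
      then show ?thesis using Cauchy_Schwarz_ineq2[of x b] by simp
    qed
    ultimately have "\<forall>b\<in>B. \<bar>x \<bullet> b\<bar> \<le> norm c + r" by force
    then show "x \<in> K B" unfolding K_def
      using onb_expand[OF B, of x] by (intro CollectI exI[of _ "\<lambda>b. x \<bullet> b"]) simp
  qed
  ultimately show ?thesis using compact_Int_closed[of "K B" "cball c r"] by (simp add: Int_absorb1)
qed

section \<open>Linear functionals that depend smoothly on a parameter\<close>

lemma FD_cong:
  assumes "f differentiable (at x)" "open S" "x \<in> S" "\<And>y. y \<in> S \<Longrightarrow> f y = g y"
  shows "FD g x v = FD f x v"
  using frechet_derivative_transform_within_open[OF assms] by simp

lemma linear_onb: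
  assumes "onb B" "linear L"
  shows "L v = (\<Sum>b\<in>B. (v \<bullet> b) *\<^sub>R L b)"
proof -
  have "L v = L (\<Sum>b\<in>B. (v \<bullet> b) *\<^sub>R b)"
    using onb_expand[OF assms(1)] by simp
  then show ?thesis using assms(2) by (simp add: linear_sum linear_scale)
qed

text \<open>The intended \<open>G y\<close> evaluates a form, with its other arguments given, on a
  coordinate vector at the point with coordinate \<open>y\<close>. Linearity reduces a moving
  argument to the basis vectors.\<close>

lemma smooth_on_linear_family:
  fixes G :: "'a::real_normed_vector \<Rightarrow> 'e::real_inner \<Rightarrow> real" and B :: "'e set"
  assumes "onb B" "open S" "\<And>y. y \<in> S \<Longrightarrow> linear (G y)" "\<And>v. smooth_on S (\<lambda>y. G y v)"
    "smooth_on S g"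
  shows "smooth_on S (\<lambda>y. G y (g y))"
proof (rule smooth_on_cong[OF assms(2)])
  show "smooth_on S (\<lambda>y. \<Sum>b\<in>B. (g y \<bullet> b) * G y b)"
    by (intro smooth_on_sum smooth_on_mult smooth_on_inner assms smooth_on_const)
  show "(\<Sum>b\<in>B. (g y \<bullet> b) * G y b) = G y (g y)" if "y \<in> S" for y
    using linear_onb[OF assms(1) assms(3)[OF that], of "g y"] by simp
qed

text \<open>This separates the derivative of the components of a vector field from the derivative of
  the functional into which the field is inserted. Both \<open>X (Y f)\<close> and
  \<open>X (\<omega> (Y))\<close> are computed with it.\<close>

lemma FD_linear_family:
  fixes G :: "'a::real_normed_vector \<Rightarrow> 'e::real_inner \<Rightarrow> real" and B :: "'e set"
  assumes B: "onb B" and S: "open S" "x \<in> S" and G: "\<And>y. y \<in> S \<Longrightarrow> linear (G y)"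
    "\<And>v. smooth_on S (\<lambda>y. G y v)" and g: "smooth_on S g"
  shows "FD (\<lambda>y. G y (g y)) x u = G x (FD g x u) + FD (\<lambda>y. G y (g x)) x u"
proof -
  have *: "FD (\<lambda>y. G y (h y)) x u =
      (\<Sum>b\<in>B. (h x \<bullet> b) * FD (\<lambda>y. G y b) x u + (FD h x u \<bullet> b) * G x b)"
    if h: "smooth_on S h" for h
  proof -
    have "((\<lambda>y. \<Sum>b\<in>B. (h y \<bullet> b) * G y b) has_derivative
       (\<lambda>u. \<Sum>b\<in>B. (h x \<bullet> b) * FD (\<lambda>y. G y b) x u + (FD h x u \<bullet> b) * G x b)) (at x)"
      by (intro has_derivative_sum has_derivative_mult has_FD bounded_linear.has_derivative[OF bounded_linear_inner_left]
         smooth_on_differentiable[OF G(2)] smooth_on_differentiable[OF h] S)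
    then have "((\<lambda>y. G y (h y)) has_derivative
       (\<lambda>u. \<Sum>b\<in>B. (h x \<bullet> b) * FD (\<lambda>y. G y b) x u + (FD h x u \<bullet> b) * G x b)) (at x)"
      by (rule has_derivative_transform_within_open[OF _ S])
         (use linear_onb[OF B G(1)] in simp)
    then show ?thesis by (rule FD_eq)
  qed
  \<comment> \<open>\<open>*\<close> is used for \<open>g\<close> and for the constant
    \<open>g x\<close>. The constant has no derivative, so comparing the two isolates the
    contribution of \<open>FD g x u\<close>.\<close>
  show ?thesis
    using *[OF g] *[OF smooth_on_const[of S "g x"]] linear_onb[OF B G(1)[OF S(2)], of "FD g x u"]
    by (simp add: sum.distrib)
qed

section \<open>Charts and tangent vectors\<close>

lemma smooth_mapD:
  assumes "smooth_map M \<phi>" "k \<in> M" "l \<in> M"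
  shows "smooth_on (snd k ` (fst k \<inter> \<phi> -` fst l)) (\<lambda>x. snd l (\<phi> (chart_inv k x)))"
  using assms by (simp add: smooth_map_def o_def)

lemma linear_FD_param:
  fixes G :: "'a::real_normed_vector \<Rightarrow> 'e::real_normed_vector \<Rightarrow> real"
  assumes S: "open S" "x \<in> S" and G: "\<And>y. y \<in> S \<Longrightarrow> linear (G y)" "\<And>v. smooth_on S (\<lambda>y. G y v)"
  shows "linear (\<lambda>v. FD (\<lambda>y. G y v) x u)"
proof (rule linearI)
  have d: "((\<lambda>y. G y v) has_derivative FD (\<lambda>y. G y v) x) (at x)" for v
    by (rule has_FD[OF smooth_on_differentiable[OF G(2) S(2)]])
  fix v w and c :: real
  have "((\<lambda>y. G y (v + w)) has_derivative (\<lambda>u. FD (\<lambda>y. G y v) x u + FD (\<lambda>y. G y w) x u)) (at x)"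
    by (rule has_derivative_transform_within_open[OF has_derivative_add[OF d d] S])
       (simp add: linear_add[OF G(1)])
  then show "FD (\<lambda>y. G y (v + w)) x u = FD (\<lambda>y. G y v) x u + FD (\<lambda>y. G y w) x u"
    by (rule FD_eq)
  have "((\<lambda>y. G y (c *\<^sub>R v)) has_derivative (\<lambda>u. c *\<^sub>R FD (\<lambda>y. G y v) x u)) (at x)"
    by (rule has_derivative_transform_within_open[OF has_derivative_scaleR_right[OF d] S])
       (simp add: linear_scale[OF G(1)])
  then show "FD (\<lambda>y. G y (c *\<^sub>R v)) x u = c *\<^sub>R FD (\<lambda>y. G y v) x u"
    by (rule FD_eq)
qed

text \<open>In local trivialisations \<open>F\<close> is a function on a threefold product of model
  spaces, and composing with it requires a basis there.\<close>

lemma onb_Times: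
  assumes "onb A" "onb B"
  shows "onb ((\<lambda>u. (u, 0)) ` A \<union> (\<lambda>v. (0, v)) ` B)" (is "onb ?C")
  unfolding onb_def
proof (intro conjI)
  show "finite ?C" using assms by (simp add: onb_def)
  \<comment> \<open>Otherwise the zero pair could belong to both halves of the union and spoil
    orthogonality.\<close>
  have "0 \<notin> A" "0 \<notin> B"
    using assms unfolding onb_def by (metis inner_zero_left zero_neq_one)+
  moreover have "u \<bullet> v = (if u = v then 1 else 0)" if "u \<in> A" "v \<in> A" for u v
    using assms(1) that by (simp add: onb_def)
  moreover have "u \<bullet> v = (if u = v then 1 else 0)" if "u \<in> B" "v \<in> B" for u v
    using assms(2) that by (simp add: onb_def)
  ultimately show "\<forall>u\<in>?C. \<forall>v\<in>?C. u \<bullet> v = (if u = v then 1 else 0)"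
    by (auto split: if_splits)
  have "(u, v) \<in> span ?C" for u v
  proof -
    have "linear (\<lambda>u. (u, 0 :: 'b))" "linear (\<lambda>v. (0 :: 'a, v))"
      by (auto intro!: linearI)
    then have "(u, 0) = (\<Sum>b\<in>A. (u \<bullet> b) *\<^sub>R (b, 0 :: 'b))" "(0, v) = (\<Sum>b\<in>B. (v \<bullet> b) *\<^sub>R (0 :: 'a, b))"
      using linear_onb[OF assms(1), of "\<lambda>u. (u, 0)" u] linear_onb[OF assms(2), of "\<lambda>v. (0, v)" v] by blast+
    moreover have "(\<Sum>b\<in>A. (u \<bullet> b) *\<^sub>R (b, 0)) \<in> span ?C" "(\<Sum>b\<in>B. (v \<bullet> b) *\<^sub>R (0, b)) \<in> span ?C"
      by (intro span_sum span_scale span_base; simp)+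
    ultimately have "(u, 0) + (0, v) \<in> span ?C" by (metis span_add)
    then show ?thesis by simp
  qed
  then show "span ?C = UNIV" by auto
qed

lemma smooth_on_Pair:
  assumes "open S" "smooth_on S f" "smooth_on S g"
  shows "smooth_on S (\<lambda>x. (f x, g x))"
proof -
  have "smooth_on S (\<lambda>x. (f x, 0) + (0, g x))"
    by (intro smooth_on_add smooth_on_bounded_linear[where L = "\<lambda>u. (u, 0)"] smooth_on_bounded_linear[where L = "\<lambda>u. (0, u)"]
      bounded_linear_Pair bounded_linear_ident bounded_linear_zero assms)
  then show ?thesis by simp
qed

lemma push_vec_lincomb: "push_vec \<phi> (lincomb a v b w) = lincomb a (push_vec \<phi> v) b (push_vec \<phi> w)"
  by (simp add: push_vec_def lincomb_def)

lemma push_vec_inv: "bij \<phi> \<Longrightarrow> push_vec (inv \<phi>) (push_vec \<phi> v) = v" "bij \<phi> \<Longrightarrow> push_vec \<phi> (push_vec (inv \<phi>) v) = v"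
  by (simp_all add: push_vec_def o_def bij_is_inj bij_is_surj surj_f_inv_f)

context smooth_manifold
begin

definition ebasis :: "'e set"
  where "ebasis = (SOME B. onb B)"

lemma onb_ebasis: "onb ebasis"
  unfolding ebasis_def using model_space by (intro someI_ex[where P = onb]) (simp add: onb_def)

lemma chart_inv_chart [simp]: "k \<in> M \<Longrightarrow> p \<in> fst k \<Longrightarrow> chart_inv k (snd k p) = p"
  using chart_homeomorphism[of k] unfolding homeomorphism_def by blast

lemma chart_chart_inv [simp]: "k \<in> M \<Longrightarrow> x \<in> chart_image k \<Longrightarrow> snd k (chart_inv k x) = x"
  using chart_homeomorphism[of k] unfolding homeomorphism_def by blast

lemma chart_in_image [simp]: "p \<in> fst k \<Longrightarrow> snd k p \<in> chart_image k"
  by (simp add: chart_image_def)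

lemma chart_inv_in [simp]: "k \<in> M \<Longrightarrow> x \<in> chart_image k \<Longrightarrow> chart_inv k x \<in> fst k"
  using chart_homeomorphism[of k] unfolding homeomorphism_def by blast

lemma ex_chart: "\<exists>k\<in>M. p \<in> fst k"
  using covering by auto

lemma open_chart_image_subset:
  assumes "k \<in> M" "open W"
  shows "open (snd k ` (fst k \<inter> W))"
proof -
  have "snd k ` (fst k \<inter> W) = chart_image k \<inter> chart_inv k -` W"
    using assms by (force simp: chart_image_def)
  moreover have "continuous_on (chart_image k) (chart_inv k)"
    using chart_homeomorphism assms by (auto simp: homeomorphism_def)
  ultimately show ?thesis
    using continuous_open_preimage open_image assms by metis
qed

lemma open_chart_image_subset': "k \<in> M \<Longrightarrow> open W \<Longrightarrow> W \<subseteq> fst k \<Longrightarrow> open (snd k ` W)"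
  using open_chart_image_subset[of k W] by (simp add: Int_absorb1)

lemma smooth_funD: "smooth_fun M f \<Longrightarrow> k \<in> M \<Longrightarrow> smooth_on (chart_image k) (\<lambda>x. f (chart_inv k x))"
  by (simp add: smooth_fun_def o_def)

lemma smooth_map_domain_open:
  assumes "smooth_map M \<phi>" "k \<in> M" "l \<in> M" "open W"
  shows "open (snd k ` (fst k \<inter> \<phi> -` W))"
  using assms by (intro open_chart_image_subset) (auto simp: smooth_map_def intro!: open_vimage)

text \<open>Transition maps are the coordinate expressions of the identity, so facts about a change
  of chart become special cases of facts about smooth maps.\<close>

lemma smooth_map_id: "smooth_map M (\<lambda>p. p)"
  using smooth_transition by (auto simp: smooth_map_def vimage_def o_def Int_def continuous_on_id)

text \<open>One suitable chart near each point is enough, since any other chart differs from it by a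
  transition map. Functions extended by zero are treated this way, with different charts near the
  support and away from it.\<close>

lemma smooth_funI:
  assumes "\<And>p. \<exists>k\<in>M. \<exists>W. open W \<and> p \<in> W \<and> W \<subseteq> fst k \<and> smooth_on (snd k ` W) (\<lambda>x. f (chart_inv k x))"
  shows "smooth_fun M f"
  unfolding smooth_fun_def o_def
proof (intro ballI smooth_on_local)
  fix l x assume l: "l \<in> M" and "x \<in> chart_image l"
  then obtain p where p: "p \<in> fst l" "x = snd l p" by (auto simp: chart_image_def)
  obtain k W where k: "k \<in> M" and W: "open W" "p \<in> W" "W \<subseteq> fst k"
    "smooth_on (snd k ` W) (\<lambda>x. f (chart_inv k x))" using assms by blast
  let ?U = "snd l ` (fst l \<inter> W)"
  have U: "open ?U" by (rule open_chart_image_subset[OF l W(1)])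
  have "smooth_on ?U (\<lambda>x. f (chart_inv k (snd k (chart_inv l x))))"
  proof (rule smooth_on_compose[OF onb_ebasis U _ _ W(4)])
    show "open (snd k ` W)" by (rule open_chart_image_subset'[OF k W(1,3)])
    show "smooth_on ?U (\<lambda>x. snd k (chart_inv l x))"
      by (rule smooth_on_subset[OF smooth_mapD[OF smooth_map_id l k]]) (use W in auto)
  qed (use l in auto)
  then have "smooth_on ?U (\<lambda>x. f (chart_inv l x))"
    by (rule smooth_on_cong[OF U]) (use W k l in auto)
  then show "\<exists>U. open U \<and> x \<in> U \<and> smooth_on U (\<lambda>x. f (chart_inv l x))"
    using U p W by blast
qed

lemma smooth_fun_const: "smooth_fun M (\<lambda>p. c)"
  by (auto simp: smooth_fun_def o_def intro: smooth_on_const)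

lemma smooth_fun_mult: "smooth_fun M f \<Longrightarrow> smooth_fun M g \<Longrightarrow> smooth_fun M (\<lambda>p. f p * g p)"
  by (auto simp: smooth_fun_def o_def intro!: smooth_on_mult open_image)

lemma smooth_fun_comp:
  assumes \<phi>: "smooth_map M \<phi>" and f: "smooth_fun M f"
  shows "smooth_fun M (f \<circ> \<phi>)"
proof (rule smooth_funI)
  fix p
  obtain k l where k: "k \<in> M" "p \<in> fst k" and l: "l \<in> M" "\<phi> p \<in> fst l"
    using ex_chart by blast
  let ?W = "fst k \<inter> \<phi> -` fst l"
  have W: "open ?W"
    using \<phi> open_domain[OF k(1)] open_domain[OF l(1)]
    by (auto simp: smooth_map_def intro!: open_Int open_vimage)
  have U: "open (snd k ` ?W)" by (rule smooth_map_domain_open[OF \<phi> k(1) l(1) open_domain[OF l(1)]])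
  have "smooth_on (snd k ` ?W) (\<lambda>x. f (chart_inv l (snd l (\<phi> (chart_inv k x)))))"
    by (rule smooth_on_compose[OF onb_ebasis U open_image[OF l(1)] _ smooth_funD[OF f l(1)] smooth_mapD[OF \<phi> k(1) l(1)]])
       (use k in auto)
  then have "smooth_on (snd k ` ?W) (\<lambda>x. (f \<circ> \<phi>) (chart_inv k x))"
    by (rule smooth_on_cong[OF U]) (use k l in auto)
  then show "\<exists>k\<in>M. \<exists>W. open W \<and> p \<in> W \<and> W \<subseteq> fst k \<and> smooth_on (snd k ` W) (\<lambda>x. (f \<circ> \<phi>) (chart_inv k x))"
    using k l W by blast
qed

text \<open>\<open>C\<close> is closed in the whole manifold, not merely in the chart domain. Its
  complement is then an open set on which the function vanishes, and this makes extension by zero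
  smooth. The value 1 is demanded at \<open>p\<close> only.\<close>

definition cutoff :: "('m, 'e) chart \<Rightarrow> 'm \<Rightarrow> ('m \<Rightarrow> real) \<Rightarrow> bool"
  where "cutoff k p \<rho> \<longleftrightarrow> smooth_fun M \<rho> \<and> \<rho> p = 1 \<and>
    (\<exists>C. closed C \<and> C \<subseteq> fst k \<and> (\<forall>q. q \<notin> C \<longrightarrow> \<rho> q = 0))"

lemma ex_cutoff:
  assumes k: "k \<in> M" "p \<in> fst k"
  obtains \<rho> where "cutoff k p \<rho>"
proof -
  obtain r where r: "r > 0" "cball (snd k p) r \<subseteq> chart_image k"
    using open_image[OF k(1)] k open_contains_cball by (metis chart_in_image)
  define C where "C = chart_inv k ` cball (snd k p) r"
  have "continuous_on (chart_image k) (chart_inv k)"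
    using chart_homeomorphism k by (auto simp: homeomorphism_def)
  then have "compact C"
    unfolding C_def using compact_cball_onb[OF onb_ebasis] r continuous_on_subset
    by (blast intro: compact_continuous_image)
  \<comment> \<open>The Hausdorff property of the manifold enters here.\<close>
  then have C: "closed C" by (rule compact_imp_closed)
  have Ck: "C \<subseteq> fst k" using r k by (auto simp: C_def)
  define \<rho> where "\<rho> q = (if q \<in> fst k then bump (snd k p) r (snd k q) else 0)" for q
  have \<rho>0: "\<rho> q = 0" if "q \<notin> C" for q
  proof (cases "q \<in> fst k")
    case True
    then have "snd k q \<notin> cball (snd k p) r" using that k unfolding C_def by (metis chart_inv_chart image_eqI)
    then show ?thesis using bump_outside[OF r(1), of "snd k q" "snd k p"] by (simp add: \<rho>_def)
  qed (simp add: \<rho>_def)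
  have "smooth_fun M \<rho>"
  proof (rule smooth_funI)
    fix q
    show "\<exists>k\<in>M. \<exists>W. open W \<and> q \<in> W \<and> W \<subseteq> fst k \<and> smooth_on (snd k ` W) (\<lambda>x. \<rho> (chart_inv k x))"
    proof (cases "q \<in> fst k")
      case True
      have "smooth_on (chart_image k) (\<lambda>x. \<rho> (chart_inv k x))"
        by (rule smooth_on_cong[OF open_image[OF k(1)] smooth_on_subset[OF smooth_on_bump[of "snd k p" r]]])
           (use k in \<open>auto simp: \<rho>_def\<close>)
      then show ?thesis
        using True k open_domain by (intro bexI[of _ k] exI[of _ "fst k"]) (auto simp: chart_image_def)
    next
      case False
      obtain l where l: "l \<in> M" "q \<in> fst l" using ex_chart by blast
      have o: "open (fst l - C)" using l C open_domain by blast
      have "smooth_on (snd l ` (fst l - C)) (\<lambda>x. \<rho> (chart_inv l x))"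
        by (rule smooth_on_cong[OF open_chart_image_subset'[OF l(1) o] smooth_on_const[of _ 0]])
           (use l \<rho>0 in auto)
      then show ?thesis using l o False Ck by (intro bexI[of _ l] exI[of _ "fst l - C"]) auto
    qed
  qed
  moreover have "\<rho> p = 1" using k bump_centre[OF r(1)] by (simp add: \<rho>_def)
  ultimately show ?thesis using that C Ck \<rho>0 unfolding cutoff_def by blast
qed

lemma smooth_fun_cutoff:
  assumes k: "k \<in> M" and \<rho>: "cutoff k p \<rho>" and g: "smooth_on (chart_image k) g"
  shows "smooth_fun M (\<lambda>q. if q \<in> fst k then \<rho> q * g (snd k q) else 0)" (is "smooth_fun M ?f")
proof (rule smooth_funI)
  fix q
  obtain C where C: "closed C" "C \<subseteq> fst k" "\<forall>q. q \<notin> C \<longrightarrow> \<rho> q = 0" and \<rho>s: "smooth_fun M \<rho>"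
    using \<rho> unfolding cutoff_def by blast
  show "\<exists>k\<in>M. \<exists>W. open W \<and> q \<in> W \<and> W \<subseteq> fst k \<and> smooth_on (snd k ` W) (\<lambda>x. ?f (chart_inv k x))"
  proof (cases "q \<in> fst k")
    case True
    have "smooth_on (chart_image k) (\<lambda>x. ?f (chart_inv k x))"
      by (rule smooth_on_cong[OF open_image[OF k] smooth_on_mult[OF open_image[OF k] smooth_funD[OF \<rho>s k] g]])
         (use k in auto)
    then show ?thesis
        using True k open_domain by (intro bexI[of _ k] exI[of _ "fst k"]) (auto simp: chart_image_def)
  next
    case False
    obtain l where l: "l \<in> M" "q \<in> fst l" using ex_chart by blast
    have o: "open (fst l - C)" using l C open_domain by blast
    have "smooth_on (snd l ` (fst l - C)) (\<lambda>x. ?f (chart_inv l x))"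
      by (rule smooth_on_cong[OF open_chart_image_subset'[OF l(1) o] smooth_on_const[of _ 0]])
         (use l C in auto)
    then show ?thesis using l o False C by (intro bexI[of _ l] exI[of _ "fst l - C"]) auto
  qed
qed

section \<open>Tangent vectors in charts\<close>

lemma coord_vec_smooth: "smooth_fun M f \<Longrightarrow> coord_vec M k p e f = FD (\<lambda>x. f (chart_inv k x)) (snd k p) e"
  by (simp add: coord_vec_def o_def)

lemma coord_vec_nonsmooth: "\<not> smooth_fun M f \<Longrightarrow> coord_vec M k p e f = 0"
  by (simp add: coord_vec_def)

lemma smooth_fun_differentiable:
  "smooth_fun M f \<Longrightarrow> k \<in> M \<Longrightarrow> p \<in> fst k \<Longrightarrow> (\<lambda>x. f (chart_inv k x)) differentiable (at (snd k p))"
  using smooth_on_differentiable[OF smooth_funD] by simp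

lemma coord_vec_comp:
  assumes \<phi>: "smooth_map M \<phi>" and k: "k \<in> M" "p \<in> fst k" and l: "l \<in> M" "\<phi> p \<in> fst l"
    and f: "smooth_fun M f"
  shows "coord_vec M k p e (f \<circ> \<phi>) =
    coord_vec M l (\<phi> p) (FD (\<lambda>x. snd l (\<phi> (chart_inv k x))) (snd k p) e) f"
proof -
  let ?U = "snd k ` (fst k \<inter> \<phi> -` fst l)" and ?g = "\<lambda>x. snd l (\<phi> (chart_inv k x))"
  have U: "open ?U" "snd k p \<in> ?U" 
    using smooth_map_domain_open[OF \<phi> k(1) l(1) open_domain[OF l(1)]] k l by auto
  have g: "?g differentiable (at (snd k p))"
    using smooth_on_differentiable[OF smooth_mapD[OF \<phi> k(1) l(1)] U(2)] .
  have f': "(\<lambda>x. f (chart_inv l x)) differentiable (at (?g (snd k p)))"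
    using smooth_fun_differentiable[OF f l] k by simp
  have "((\<lambda>x. f (chart_inv l (?g x))) has_derivative
      (\<lambda>e. FD (\<lambda>x. f (chart_inv l x)) (?g (snd k p)) (FD ?g (snd k p) e))) (at (snd k p))"
    using diff_chain_at[OF has_FD[OF g] has_FD[OF f']] by (simp add: o_def)
  then have "((\<lambda>x. f (\<phi> (chart_inv k x))) has_derivative
      (\<lambda>e. FD (\<lambda>x. f (chart_inv l x)) (?g (snd k p)) (FD ?g (snd k p) e))) (at (snd k p))"
    by (rule has_derivative_transform_within_open[OF _ U]) (use k l in auto)
  from FD_eq[OF this] show ?thesis
    using coord_vec_smooth[OF smooth_fun_comp[OF \<phi> f]] coord_vec_smooth[OF f] k by simp
qed

lemma coord_vec_change:
  assumes "k \<in> M" "p \<in> fst k" "l \<in> M" "p \<in> fst l"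
  shows "coord_vec M k p e = coord_vec M l p (FD (\<lambda>x. snd l (chart_inv k x)) (snd k p) e)"
proof
  fix f show "coord_vec M k p e f = coord_vec M l p (FD (\<lambda>x. snd l (chart_inv k x)) (snd k p) e) f"
    using coord_vec_comp[OF smooth_map_id assms] by (cases "smooth_fun M f") (auto simp: o_def coord_vec_nonsmooth)
qed

text \<open>The definition admits vectors from all charts around \<open>p\<close>; the
  transformation law \<open>coord_vec_change\<close> rewrites each of them in the given
  chart.\<close>

lemma tangent_space_chart:
  assumes "k \<in> M" "p \<in> fst k"
  shows "tangent_space M p = range (coord_vec M k p)"
proof
  show "tangent_space M p \<subseteq> range (coord_vec M k p)"
  proof
    fix v assume "v \<in> tangent_space M p"
    then obtain l e where l: "l \<in> M" "p \<in> fst l" "v = coord_vec M l p e"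
      unfolding tangent_space_def by blast
    show "v \<in> range (coord_vec M k p)"
      unfolding l(3) coord_vec_change[OF l(1,2) assms] by (rule rangeI)
  qed
  show "range (coord_vec M k p) \<subseteq> tangent_space M p"
    using assms unfolding tangent_space_def by blast
qed

lemma coord_vec_tangent [simp]: "k \<in> M \<Longrightarrow> p \<in> fst k \<Longrightarrow> coord_vec M k p e \<in> tangent_space M p"
  using tangent_space_chart by auto

lemma tangentE:
  assumes "v \<in> tangent_space M p" "k \<in> M" "p \<in> fst k"
  obtains e where "v = coord_vec M k p e"
  using assms tangent_space_chart by auto

lemma coord_vec_lincomb:
  assumes "k \<in> M" "p \<in> fst k"
  shows "lincomb a (coord_vec M k p u) b (coord_vec M k p v) = coord_vec M k p (a *\<^sub>R u + b *\<^sub>R v)"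
proof
  fix f
  show "lincomb a (coord_vec M k p u) b (coord_vec M k p v) f = coord_vec M k p (a *\<^sub>R u + b *\<^sub>R v) f"
  proof (cases "smooth_fun M f")
    case True
    then show ?thesis
      using linear_FD[OF smooth_fun_differentiable[OF True assms]]
      by (simp add: lincomb_def coord_vec_smooth linear_add linear_scale)
  qed (simp add: lincomb_def coord_vec_nonsmooth)
qed

lemma tangent_lincomb:
  "v \<in> tangent_space M p \<Longrightarrow> w \<in> tangent_space M p \<Longrightarrow> lincomb a v b w \<in> tangent_space M p"
  using ex_chart[of p] coord_vec_lincomb tangent_space_chart by (auto 0 3)

lemma tangent_nonsmooth: "v \<in> tangent_space M p \<Longrightarrow> \<not> smooth_fun M f \<Longrightarrow> v f = 0"
  by (auto simp: tangent_space_def coord_vec_nonsmooth)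

lemma tangent_scale: "v \<in> tangent_space M p \<Longrightarrow> (\<lambda>f. a * v f) \<in> tangent_space M p"
  using tangent_lincomb[of v p v a 0] by (simp add: lincomb_def)

text \<open>Differentials of global functions realise every covector at \<open>p\<close>. This is why tangent vectors,
  defined as operators on global functions, are determined by their chart components.\<close>

lemma ex_smooth_differential:
  assumes k: "k \<in> M" "p \<in> fst k"
  shows "\<exists>f. smooth_fun M f \<and> (\<forall>e. coord_vec M k p e f = u \<bullet> e)"
proof -
  obtain \<rho> where \<rho>: "cutoff k p \<rho>" using ex_cutoff[OF k] .
  \<comment> \<open>As \<open>g\<close> vanishes at the image of \<open>p\<close>, the derivative of
    \<rho> drops out of the product rule, so it is enough that \<rho> is 1 at the single point
    \<open>p\<close>.\<close>
  define g where "g x = u \<bullet> (x - snd k p)" for x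
  have g: "smooth_on S g" if "open S" for S
    unfolding g_def by (intro smooth_on_inner smooth_on_diff smooth_on_const smooth_on_ident that)
  define f where "f q = (if q \<in> fst k then \<rho> q * g (snd k q) else 0)" for q
  have f: "smooth_fun M f"
    unfolding f_def by (rule smooth_fun_cutoff[OF k(1) \<rho> g[OF open_image[OF k(1)]]])
  have "coord_vec M k p e f = u \<bullet> e" for e
  proof -
    have \<rho>s: "smooth_fun M \<rho>" "\<rho> p = 1" using \<rho> by (auto simp: cutoff_def)
    have "((\<lambda>x. \<rho> (chart_inv k x) * g x) has_derivative
        (\<lambda>e. \<rho> (chart_inv k (snd k p)) * (u \<bullet> e) + FD (\<lambda>x. \<rho> (chart_inv k x)) (snd k p) e * g (snd k p))) (at (snd k p))"
      by (intro has_derivative_mult has_FD smooth_fun_differentiable[OF \<rho>s(1) k])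
         (auto simp: g_def intro!: derivative_eq_intros)
    then have "((\<lambda>x. f (chart_inv k x)) has_derivative
        (\<lambda>e. \<rho> (chart_inv k (snd k p)) * (u \<bullet> e) + FD (\<lambda>x. \<rho> (chart_inv k x)) (snd k p) e * g (snd k p))) (at (snd k p))"
      by (rule has_derivative_transform_within_open[OF _ open_image[OF k(1)]]) (use k in \<open>auto simp: f_def\<close>)
    from FD_eq[OF this] show ?thesis
      using coord_vec_smooth[OF f] \<rho>s k by (simp add: g_def)
  qed
  then show ?thesis using f by blast
qed

lemma coord_vec_inj:
  assumes k: "k \<in> M" "p \<in> fst k" and "coord_vec M k p u = coord_vec M k p v"
  shows "u = v"
proof -
  have "(u - v) \<bullet> u = (u - v) \<bullet> v"
    using ex_smooth_differential[OF k, of "u - v"] assms(3) by metis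
  then have "(u - v) \<bullet> (u - v) = 0" by (simp add: inner_diff_right)
  then show ?thesis by simp
qed

lemma vec_comp_coord_vec [simp]:
  "k \<in> M \<Longrightarrow> p \<in> fst k \<Longrightarrow> vec_comp M k p (coord_vec M k p e) = e"
  unfolding vec_comp_def using coord_vec_inj by blast

lemma coord_vec_vec_comp:
  "k \<in> M \<Longrightarrow> p \<in> fst k \<Longrightarrow> v \<in> tangent_space M p \<Longrightarrow> coord_vec M k p (vec_comp M k p v) = v"
  using tangent_space_chart by auto

section \<open>Vector fields\<close>

abbreviation vcomp :: "('m, 'e) chart \<Rightarrow> ('m \<Rightarrow> 'm tvec) \<Rightarrow> 'e \<Rightarrow> 'e"
  where "vcomp k X x \<equiv> vec_comp M k (chart_inv k x) (X (chart_inv k x))"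

lemma VF_tangent: "X \<in> vector_fields M \<Longrightarrow> X p \<in> tangent_space M p"
  by (simp add: vector_fields_def)

lemma VF_smooth: "X \<in> vector_fields M \<Longrightarrow> k \<in> M \<Longrightarrow> smooth_on (chart_image k) (vcomp k X)"
  by (simp add: vector_fields_def)

lemma VF_coord: "X \<in> vector_fields M \<Longrightarrow> k \<in> M \<Longrightarrow> p \<in> fst k \<Longrightarrow> X p = coord_vec M k p (vcomp k X (snd k p))"
  using coord_vec_vec_comp VF_tangent by simp

text \<open>A change of chart applies the derivative of the transition map to the components, so
  smooth components in one chart near each point suffice.\<close>

lemma VF_I:
  assumes "\<And>p. \<exists>k\<in>M. \<exists>W g. open W \<and> p \<in> W \<and> W \<subseteq> fst k \<and> smooth_on (snd k ` W) g \<and>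
    (\<forall>q\<in>W. X q = coord_vec M k q (g (snd k q)))"
  shows "X \<in> vector_fields M"
  unfolding vector_fields_def
proof (intro CollectI conjI allI ballI smooth_on_local)
  fix p show "X p \<in> tangent_space M p"
    using assms[of p] by force
next
  fix l x assume l: "l \<in> M" and "x \<in> chart_image l"
  then obtain p where p: "p \<in> fst l" "x = snd l p" by (auto simp: chart_image_def)
  obtain k W g where k: "k \<in> M" and W: "open W" "p \<in> W" "W \<subseteq> fst k"
    "smooth_on (snd k ` W) g" "\<forall>q\<in>W. X q = coord_vec M k q (g (snd k q))" using assms by blast
  let ?U = "snd l ` (fst l \<inter> W)" and ?V = "snd k ` (fst k \<inter> fst l)"
  have U: "open ?U" by (rule open_chart_image_subset[OF l W(1)])
  have t: "smooth_on ?U (\<lambda>x. snd k (chart_inv l x))"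
    by (rule smooth_on_subset[OF smooth_mapD[OF smooth_map_id l k]]) (use W in auto)
  have "smooth_on ?U (\<lambda>x. FD (\<lambda>x. snd l (chart_inv k x)) (snd k (chart_inv l x)) (g (snd k (chart_inv l x))))"
  proof (rule smooth_on_FD_apply[OF onb_ebasis U _ _ t])
    show "open ?V" using open_chart_image_subset[OF k open_domain[OF l]] .
    show "smooth_on ?V (\<lambda>x. snd l (chart_inv k x))"
      using smooth_mapD[OF smooth_map_id k l] by (simp add: vimage_def)
    show "smooth_on ?U (\<lambda>x. g (snd k (chart_inv l x)))"
      by (rule smooth_on_compose[OF onb_ebasis U _ _ W(4) t])
         (use l k W open_chart_image_subset' in auto)
  qed (use l k W in auto)
  then have "smooth_on ?U (vcomp l X)"
    by (rule smooth_on_cong[OF U]) (use l k W coord_vec_change[of k _ l] in auto)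
  then show "\<exists>U. open U \<and> x \<in> U \<and> smooth_on U (vcomp l X)"
    using U p W by blast
qed

text \<open>The extension is a constant coordinate field times a cutoff function. Through it an
  identity for all global vector fields becomes an identity for tangent vectors at each
  point.\<close>

lemma VF_extend:
  assumes v: "v \<in> tangent_space M p"
  obtains X where "X \<in> vector_fields M" "X p = v"
proof -
  obtain k where k: "k \<in> M" "p \<in> fst k" using ex_chart by blast
  obtain e where e: "v = coord_vec M k p e" using tangentE[OF v k] .
  obtain \<rho> where \<rho>: "cutoff k p \<rho>" using ex_cutoff[OF k] .
  then obtain C where C: "closed C" "C \<subseteq> fst k" "\<forall>q. q \<notin> C \<longrightarrow> \<rho> q = 0" and \<rho>s: "smooth_fun M \<rho>" "\<rho> p = 1"
    unfolding cutoff_def by blast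
  \<comment> \<open>The zero operator has zero components in every chart. This is used off
    \<open>C\<close>, in charts other than the given one.\<close>
  have c0: "coord_vec M k q 0 = (\<lambda>f. 0)" if "k \<in> M" "q \<in> fst k" for k q
    using coord_vec_lincomb[OF that, of 0 0 0 0] by (simp add: lincomb_def)
  define X where "X q = (if q \<in> fst k then coord_vec M k q (\<rho> q *\<^sub>R e) else (\<lambda>f. 0))" for q
  have "X \<in> vector_fields M"
  proof (rule VF_I)
    fix q
    show "\<exists>k\<in>M. \<exists>W g. open W \<and> q \<in> W \<and> W \<subseteq> fst k \<and> smooth_on (snd k ` W) g \<and>
      (\<forall>q\<in>W. X q = coord_vec M k q (g (snd k q)))"
    proof (cases "q \<in> fst k")
      case True
      have "smooth_on (snd k ` fst k) (\<lambda>x. \<rho> (chart_inv k x) *\<^sub>R e)"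
        using smooth_on_scaleR[OF open_image smooth_funD[OF \<rho>s(1)] smooth_on_const] k by (simp add: chart_image_def)
      then show ?thesis 
        using True k open_domain by (intro bexI[of _ k] exI[of _ "fst k"] exI[of _ "\<lambda>x. \<rho> (chart_inv k x) *\<^sub>R e"]) (auto simp: X_def)
    next
      case False
      obtain l where l: "l \<in> M" "q \<in> fst l" using ex_chart by blast
      have o: "open (fst l - C)" using l C open_domain by blast
      show ?thesis using l o False C k
        by (intro bexI[of _ l] exI[of _ "fst l - C"] exI[of _ "\<lambda>x. 0"]) (auto simp: c0 X_def smooth_on_const)
    qed
  qed
  moreover have "X p = v" using k \<rho>s e by (simp add: X_def)
  ultimately show ?thesis using that by blast
qed

lemma tangent_const:
  assumes v: "v \<in> tangent_space M p"
  shows "v (\<lambda>q. c) = 0"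
proof -
  obtain k where k: "k \<in> M" "p \<in> fst k" using ex_chart by blast
  obtain e where e: "v = coord_vec M k p e" using tangentE[OF v k] .
  show ?thesis
    unfolding e by (simp add: coord_vec_smooth smooth_fun_const)
qed

lemma tangent_mult:
  assumes v: "v \<in> tangent_space M p" and f: "smooth_fun M f" "smooth_fun M g"
  shows "v (\<lambda>q. f q * g q) = f p * v g + v f * g p"
proof -
  obtain k where k: "k \<in> M" "p \<in> fst k" using ex_chart by blast
  obtain e where e: "v = coord_vec M k p e" using tangentE[OF v k] .
  have "((\<lambda>x. f (chart_inv k x) * g (chart_inv k x)) has_derivative
     (\<lambda>e. f (chart_inv k (snd k p)) * FD (\<lambda>x. g (chart_inv k x)) (snd k p) e + 
       FD (\<lambda>x. f (chart_inv k x)) (snd k p) e * g (chart_inv k (snd k p)))) (at (snd k p))"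
    by (intro has_derivative_mult has_FD smooth_fun_differentiable k f)
  from FD_eq[OF this] show ?thesis
    unfolding e using smooth_fun_mult[OF f] f k by (simp add: coord_vec_smooth)
qed

lemma VF_apply_coord:
  assumes X: "X \<in> vector_fields M" and f: "smooth_fun M f" and k: "k \<in> M" "x \<in> chart_image k"
  shows "X (chart_inv k x) f = FD (\<lambda>x. f (chart_inv k x)) x (vcomp k X x)"
  using fun_cong[OF VF_coord[OF X k(1) chart_inv_in[OF k]], of f] k
  unfolding coord_vec_smooth[OF f] by simp

lemma VF_apply_smooth:
  assumes X: "X \<in> vector_fields M" and f: "smooth_fun M f"
  shows "smooth_fun M (\<lambda>p. X p f)"
  unfolding smooth_fun_def o_def
proof
  fix k assume k: "k \<in> M"
  have "smooth_on (chart_image k) (\<lambda>x. FD (\<lambda>x. f (chart_inv k x)) x (vcomp k X x))"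
    by (rule smooth_on_FD_apply[OF onb_ebasis open_image[OF k] open_image[OF k]])
       (use k X f in \<open>auto intro: smooth_on_ident open_image smooth_funD VF_smooth\<close>)
  then show "smooth_on (chart_image k) (\<lambda>x. X (chart_inv k x) f)"
    by (rule smooth_on_cong[OF open_image[OF k]]) (use VF_apply_coord[OF X f k] in simp)
qed

lemma VF_scale:
  assumes X: "X \<in> vector_fields M" and f: "smooth_fun M f"
  shows "(\<lambda>p g. f p * X p g) \<in> vector_fields M"
proof (rule VF_I)
  fix p
  obtain k where k: "k \<in> M" "p \<in> fst k" using ex_chart by blast
  have "smooth_on (snd k ` fst k) (\<lambda>x. f (chart_inv k x) *\<^sub>R vcomp k X x)"
    using smooth_on_scaleR[OF open_image smooth_funD[OF f] VF_smooth[OF X]] k by (simp add: chart_image_def)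
  moreover have "(\<lambda>g. f q * X q g) = coord_vec M k q (f q *\<^sub>R vcomp k X (snd k q))" if "q \<in> fst k" for q
    using coord_vec_lincomb[OF k(1) that, of "f q" "vcomp k X (snd k q)" 0 0] VF_coord[OF X k(1) that]
    by (simp add: lincomb_def)
  ultimately show "\<exists>k\<in>M. \<exists>W g. open W \<and> p \<in> W \<and> W \<subseteq> fst k \<and> smooth_on (snd k ` W) g \<and>
      (\<forall>q\<in>W. (\<lambda>g. f q * X q g) = coord_vec M k q (g (snd k q)))"
    using k open_domain 
    by (intro bexI[of _ k] exI[of _ "fst k"] exI[of _ "\<lambda>x. f (chart_inv k x) *\<^sub>R vcomp k X x"]) auto
qed

text \<open>The first term carries the derivative of the components of \<open>Y\<close>. The second
  contains second derivatives of \<open>f\<close> in two frozen directions, so it is symmetric in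
  the two fields.\<close>

lemma VF_apply_apply:
  assumes X: "X \<in> vector_fields M" and Y: "Y \<in> vector_fields M" and f: "smooth_fun M f"
    and k: "k \<in> M" "p \<in> fst k"
  shows "X p (\<lambda>q. Y q f) =
    FD (\<lambda>x. f (chart_inv k x)) (snd k p) (FD (vcomp k Y) (snd k p) (vcomp k X (snd k p))) +
    FD (\<lambda>y. FD (\<lambda>x. f (chart_inv k x)) y (vcomp k Y (snd k p))) (snd k p) (vcomp k X (snd k p))"
proof -
  let ?f = "\<lambda>x. f (chart_inv k x)" and ?x = "snd k p" and ?S = "chart_image k"
  note S = open_image[OF k(1)] chart_in_image[OF k(2)]
  note fs = smooth_funD[OF f k(1)]
  have "X p (\<lambda>q. Y q f) = FD (\<lambda>x. Y (chart_inv k x) f) ?x (vcomp k X ?x)"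
    using VF_apply_coord[OF X VF_apply_smooth[OF Y f] k(1) S(2)] k by simp
  also have "\<dots> = FD (\<lambda>y. FD ?f y (vcomp k Y y)) ?x (vcomp k X ?x)"
    by (rule FD_cong[OF _ S, symmetric])
       (use VF_apply_coord[OF Y f k(1)] smooth_fun_differentiable[OF VF_apply_smooth[OF Y f] k] in auto)
  also have "\<dots> = FD ?f ?x (FD (vcomp k Y) ?x (vcomp k X ?x)) + FD (\<lambda>y. FD ?f y (vcomp k Y ?x)) ?x (vcomp k X ?x)"
    by (rule FD_linear_family[OF onb_ebasis S])
       (auto intro: linear_FD smooth_on_differentiable[OF fs] smooth_on_FD[OF fs] VF_smooth[OF Y k(1)])
  finally show ?thesis .
qed

text \<open>The second derivatives of \<open>f\<close> cancel by \<open>FD_FD_commute\<close>; this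
  is why the commutator of two fields is again of first order.\<close>

lemma lie_bracket_coord:
  assumes X: "X \<in> vector_fields M" and Y: "Y \<in> vector_fields M" and k: "k \<in> M" "p \<in> fst k"
  shows "lie_bracket X Y p = coord_vec M k p
    (FD (vcomp k Y) (snd k p) (vcomp k X (snd k p)) - FD (vcomp k X) (snd k p) (vcomp k Y (snd k p)))"
proof
  fix f
  show "lie_bracket X Y p f = coord_vec M k p
    (FD (vcomp k Y) (snd k p) (vcomp k X (snd k p)) - FD (vcomp k X) (snd k p) (vcomp k Y (snd k p))) f"
  proof (cases "smooth_fun M f")
    case True
    show ?thesis
      unfolding lie_bracket_def VF_apply_apply[OF X Y True k] VF_apply_apply[OF Y X True k] coord_vec_smooth[OF True]
      using FD_FD_commute[OF open_image[OF k(1)] smooth_funD[OF True k(1)] chart_in_image[OF k(2)], 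
          of "vcomp k X (snd k p)" "vcomp k Y (snd k p)"]
        linear_FD[OF smooth_fun_differentiable[OF True k]]
      by (simp add: linear_diff)
  next
    case False
    then have "(\<lambda>q. Y q f) = (\<lambda>q. 0)" "(\<lambda>q. X q f) = (\<lambda>q. 0)"
      using tangent_nonsmooth VF_tangent X Y by blast+
    then show ?thesis
      using False tangent_const[OF VF_tangent[OF X]] tangent_const[OF VF_tangent[OF Y]]
      by (simp add: lie_bracket_def coord_vec_nonsmooth)
  qed
qed

lemma lie_bracket_VF:
  assumes X: "X \<in> vector_fields M" and Y: "Y \<in> vector_fields M"
  shows "lie_bracket X Y \<in> vector_fields M"
proof (rule VF_I)
  fix p
  obtain k where k: "k \<in> M" "p \<in> fst k" using ex_chart by blast
  let ?g = "\<lambda>x. FD (vcomp k Y) x (vcomp k X x) - FD (vcomp k X) x (vcomp k Y x)"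
  note S = open_image[OF k(1)] 
  have "smooth_on (chart_image k) ?g"
    by (intro smooth_on_diff smooth_on_FD_apply[OF onb_ebasis S S _ smooth_on_ident[OF S]] S VF_smooth X Y k) auto
  then show "\<exists>k\<in>M. \<exists>W g. open W \<and> p \<in> W \<and> W \<subseteq> fst k \<and> smooth_on (snd k ` W) g \<and>
      (\<forall>q\<in>W. lie_bracket X Y q = coord_vec M k q (g (snd k q)))"
    using k open_domain lie_bracket_coord[OF X Y k(1)]
    by (intro bexI[of _ k] exI[of _ "fst k"] exI[of _ ?g]) (auto simp: chart_image_def)
qed

lemma lie_bracket_scale_right:
  assumes X: "X \<in> vector_fields M" and Y: "Y \<in> vector_fields M" and f: "smooth_fun M f"
  shows "lie_bracket X (\<lambda>p g. f p * Y p g) p = (\<lambda>g. f p * lie_bracket X Y p g + X p f * Y p g)"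
proof
  fix g
  show "lie_bracket X (\<lambda>p g. f p * Y p g) p g = f p * lie_bracket X Y p g + X p f * Y p g"
  proof (cases "smooth_fun M g")
    case True
    then show ?thesis
      using tangent_mult[OF VF_tangent[OF X] f VF_apply_smooth[OF Y True]]
      by (simp add: lie_bracket_def algebra_simps)
  next
    case False
    then have "(\<lambda>q. Y q g) = (\<lambda>q. 0)" "(\<lambda>q. X q g) = (\<lambda>q. 0)"
      using tangent_nonsmooth VF_tangent X Y by blast+
    then show ?thesis
      using False tangent_const[OF VF_tangent[OF X]] tangent_const[OF VF_tangent[OF Y]]
      by (simp add: lie_bracket_def fun_eq_iff)
  qed
qed

lemma lie_bracket_swap: "lie_bracket X Y p = (\<lambda>g. - lie_bracket Y X p g)"
  by (simp add: lie_bracket_def)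

lemma lie_bracket_scale_left:
  assumes X: "X \<in> vector_fields M" and Y: "Y \<in> vector_fields M" and f: "smooth_fun M f"
  shows "lie_bracket (\<lambda>p g. f p * X p g) Y p = (\<lambda>g. f p * lie_bracket X Y p g - Y p f * X p g)"
  using lie_bracket_scale_right[OF Y X f, of p] 
  by (simp add: lie_bracket_swap[of "\<lambda>p g. f p * X p g" Y] lie_bracket_swap[of X Y])

section \<open>Forms and the exterior derivative\<close>

lemma alt_zero: "\<theta> \<in> alt_forms M n p \<Longrightarrow> \<not> (length vs = n \<and> set vs \<subseteq> tangent_space M p) \<Longrightarrow> \<theta> vs = 0"
  by (simp add: alt_forms_def)

lemma alt_not_distinct: "\<theta> \<in> alt_forms M n p \<Longrightarrow> \<not> distinct vs \<Longrightarrow> \<theta> vs = 0"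
  by (simp add: alt_forms_def)

lemma alt_lincomb:
  "\<theta> \<in> alt_forms M n p \<Longrightarrow> v \<in> tangent_space M p \<Longrightarrow> w \<in> tangent_space M p \<Longrightarrow>
   \<theta> (us @ lincomb a v b w # ws) = a * \<theta> (us @ v # ws) + b * \<theta> (us @ w # ws)"
  by (simp add: alt_forms_def)

lemma alt_scale:
  "\<theta> \<in> alt_forms M n p \<Longrightarrow> v \<in> tangent_space M p \<Longrightarrow> \<theta> (us @ (\<lambda>f. a * v f) # ws) = a * \<theta> (us @ v # ws)"
  using alt_lincomb[of \<theta> n p v v us a 0 ws] by (simp add: lincomb_def)

lemma alt_linear:
  assumes "\<theta> \<in> alt_forms M n p" "k \<in> M" "p \<in> fst k"
  shows "linear (\<lambda>e. \<theta> (us @ coord_vec M k p e # ws))"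
proof (rule linearI)
  fix u v and c :: real
  show "\<theta> (us @ coord_vec M k p (u + v) # ws) = \<theta> (us @ coord_vec M k p u # ws) + \<theta> (us @ coord_vec M k p v # ws)"
    using alt_lincomb[OF assms(1) coord_vec_tangent[OF assms(2,3)] coord_vec_tangent[OF assms(2,3)], of us 1 u 1 v ws]
    by (simp add: coord_vec_lincomb[OF assms(2,3)])
  show "\<theta> (us @ coord_vec M k p (c *\<^sub>R u) # ws) = c *\<^sub>R \<theta> (us @ coord_vec M k p u # ws)"
    using alt_lincomb[OF assms(1) coord_vec_tangent[OF assms(2,3)] coord_vec_tangent[OF assms(2,3)], of us c u 0 u ws]
    by (simp add: coord_vec_lincomb[OF assms(2,3)])
qed

text \<open>Alternation is encoded as vanishing on lists with a repetition. Polarisation, expanding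
  the value on a repeated sum, recovers the sign.\<close>

lemma alt_swap:
  assumes "\<theta> \<in> alt_forms M n p" "v \<in> tangent_space M p" "w \<in> tangent_space M p"
  shows "\<theta> (v # w # ws) = - \<theta> (w # v # ws)"
proof -
  let ?s = "lincomb 1 v 1 w"
  have s: "?s \<in> tangent_space M p" using tangent_lincomb assms by blast
  have "0 = \<theta> (?s # ?s # ws)" using alt_not_distinct[OF assms(1)] by simp
  also have "\<dots> = \<theta> (v # ?s # ws) + \<theta> (w # ?s # ws)"
    using alt_lincomb[OF assms, of "[]" 1 1 "?s # ws"] by simp
  also have "\<dots> = \<theta> (v # w # ws) + \<theta> (w # v # ws)"
    using alt_lincomb[OF assms, of "[v]" 1 1 ws] alt_lincomb[OF assms, of "[w]" 1 1 ws]
      alt_not_distinct[OF assms(1), of "v # v # ws"] alt_not_distinct[OF assms(1), of "w # w # ws"] by simp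
  finally show ?thesis by simp
qed

lemma alt_eqI:
  assumes "\<theta> \<in> alt_forms M n p" "\<theta>' \<in> alt_forms M n p"
    "\<And>vs. length vs = n \<Longrightarrow> set vs \<subseteq> tangent_space M p \<Longrightarrow> \<theta> vs = \<theta>' vs"
  shows "\<theta> = \<theta>'"
proof
  fix vs show "\<theta> vs = \<theta>' vs"
    using assms(3) alt_zero[OF assms(1)] alt_zero[OF assms(2)]
    by (cases "length vs = n \<and> set vs \<subseteq> tangent_space M p") auto
qed

lemma alt_combination:
  assumes "\<theta> \<in> alt_forms M n p" "\<theta>' \<in> alt_forms M n p"
  shows "(\<lambda>vs. a * \<theta> vs + b * \<theta>' vs) \<in> alt_forms M n p"
  unfolding alt_forms_def
  using alt_lincomb[OF assms(1)] alt_lincomb[OF assms(2)] alt_zero[OF assms(1)] alt_zero[OF assms(2)]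
    alt_not_distinct[OF assms(1)] alt_not_distinct[OF assms(2)]
  by (simp add: algebra_simps)

lemma alt_contract:
  assumes \<theta>: "\<theta> \<in> alt_forms M (Suc n) p" and v: "v \<in> tangent_space M p"
  shows "(\<lambda>vs. \<theta> (v # vs)) \<in> alt_forms M n p"
  unfolding alt_forms_def
proof (intro CollectI conjI allI ballI impI)
  show "\<theta> (v # vs) = 0" if "\<not> (length vs = n \<and> set vs \<subseteq> tangent_space M p)" for vs
    using alt_zero[OF \<theta>, of "v # vs"] that by auto
  show "\<theta> (v # us @ lincomb a u b w # ws) = a * \<theta> (v # us @ u # ws) + b * \<theta> (v # us @ w # ws)"
    if "u \<in> tangent_space M p" "w \<in> tangent_space M p" for us ws a b u w
    using alt_lincomb[OF \<theta> that, of "v # us"] by simp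
  show "\<theta> (v # vs) = 0" if "\<not> distinct vs" for vs
    using alt_not_distinct[OF \<theta>, of "v # vs"] that by auto
qed

definition form1 :: "'m \<Rightarrow> ('m tvec \<Rightarrow> real) \<Rightarrow> 'm covec"
  where "form1 p L vs = (if length vs = 1 \<and> set vs \<subseteq> tangent_space M p then L (hd vs) else 0)"

definition form2 :: "'m \<Rightarrow> ('m tvec \<Rightarrow> 'm tvec \<Rightarrow> real) \<Rightarrow> 'm covec"
  where "form2 p L vs = (if length vs = 2 \<and> set vs \<subseteq> tangent_space M p then L (vs ! 0) (vs ! 1) else 0)"

lemma form1_alt:
  assumes "\<And>v w a b. v \<in> tangent_space M p \<Longrightarrow> w \<in> tangent_space M p \<Longrightarrow>
    L (lincomb a v b w) = a * L v + b * L w"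
  shows "form1 p L \<in> alt_forms M 1 p"
  unfolding alt_forms_def
proof (intro CollectI conjI allI ballI impI)
  show "form1 p L vs = 0" if "\<not> (length vs = 1 \<and> set vs \<subseteq> tangent_space M p)" for vs
    using that by (auto simp: form1_def)
  show "form1 p L vs = 0" if "\<not> distinct vs" for vs
    using that by (auto simp: form1_def length_Suc_conv)
  show "form1 p L (us @ lincomb a v b w # ws) = a * form1 p L (us @ v # ws) + b * form1 p L (us @ w # ws)"
    if "v \<in> tangent_space M p" "w \<in> tangent_space M p" for us ws a b v w
    using that assms[OF that] tangent_lincomb[OF that] by (auto simp: form1_def)
qed

text \<open>Skewness carries linearity from the first slot to the second and forces the value 0 on a
  repeated vector.\<close>

lemma form2_alt:
  assumes "\<And>v w z a b. v \<in> tangent_space M p \<Longrightarrow> w \<in> tangent_space M p \<Longrightarrow> z \<in> tangent_space M p \<Longrightarrow>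
    L (lincomb a v b w) z = a * L v z + b * L w z"
    and skew: "\<And>v w. v \<in> tangent_space M p \<Longrightarrow> w \<in> tangent_space M p \<Longrightarrow> L v w = - L w v"
  shows "form2 p L \<in> alt_forms M 2 p"
  unfolding alt_forms_def
proof (intro CollectI conjI allI ballI impI)
  show "form2 p L vs = 0" if "\<not> (length vs = 2 \<and> set vs \<subseteq> tangent_space M p)" for vs
    using that by (auto simp: form2_def)
  show "form2 p L vs = 0" if d: "\<not> distinct vs" for vs
  proof (cases "length vs = 2 \<and> set vs \<subseteq> tangent_space M p")
    case True
    then obtain v where "vs = [v, v]" using d by (auto simp: length_Suc_conv numeral_2_eq_2)
    then show ?thesis using skew[of v v] True by (simp add: form2_def)
  qed (auto simp: form2_def)
  fix us ws a b v w 
  assume vw: "v \<in> tangent_space M p" "w \<in> tangent_space M p"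
  have vw': "lincomb a v b w \<in> tangent_space M p" by (rule tangent_lincomb[OF vw])
  show "form2 p L (us @ lincomb a v b w # ws) = a * form2 p L (us @ v # ws) + b * form2 p L (us @ w # ws)"
  proof (cases "length us + length ws = 1 \<and> set us \<subseteq> tangent_space M p \<and> set ws \<subseteq> tangent_space M p")
    case True
    then consider z where "us = []" "ws = [z]" "z \<in> tangent_space M p" 
      | z where "us = [z]" "ws = []" "z \<in> tangent_space M p"
      by (cases us; cases ws) auto
    then show ?thesis
    proof cases
      case 1
      then show ?thesis using vw vw' assms(1)[OF vw] by (simp add: form2_def)
    next
      case 2
      then show ?thesis using vw vw' assms(1)[OF vw] skew[of z] by (simp add: form2_def)
    qed
  next
    case False
    then show ?thesis by (auto simp: form2_def)
  qed
qed

section \<open>Smooth forms\<close>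

lemma forms_alt: "\<omega> \<in> forms M n \<Longrightarrow> \<omega> p \<in> alt_forms M n p"
  by (simp add: forms_def)

lemma forms_smooth:
  "\<omega> \<in> forms M n \<Longrightarrow> k \<in> M \<Longrightarrow> length es = n \<Longrightarrow>
   smooth_on (chart_image k) (\<lambda>x. \<omega> (chart_inv k x) (map (coord_vec M k (chart_inv k x)) es))"
  by (simp add: forms_def)

text \<open>\<open>forms\<close> grants smoothness for constant coordinate vectors only. The
  induction lets one slot after the other vary, while \<open>es\<close> holds the slots that are
  still constant. The map \<open>y\<close> lets the base point move as well, as pull-backs
  require.\<close>

lemma forms_smooth_family:
  fixes y :: "'a::real_normed_vector \<Rightarrow> 'e"
  assumes \<omega>: "\<omega> \<in> forms M n" and l: "l \<in> M" and S: "open S" "y ` S \<subseteq> chart_image l" "smooth_on S y"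
    and "\<And>g. g \<in> set gs \<Longrightarrow> smooth_on S g" "length es + length gs = n"
  shows "smooth_on S (\<lambda>x. \<omega> (chart_inv l (y x))
    (map (coord_vec M l (chart_inv l (y x))) (es @ map (\<lambda>g. g x) gs)))"
  using assms(6,7)
proof (induction gs arbitrary: es)
  case Nil
  then show ?case
    using smooth_on_compose[OF onb_ebasis S(1) open_image[OF l] S(2) forms_smooth[OF \<omega> l] S(3)] by simp
next
  case (Cons g gs)
  have "smooth_on S (\<lambda>x. (\<lambda>e. \<omega> (chart_inv l (y x))
    (map (coord_vec M l (chart_inv l (y x))) (es @ e # map (\<lambda>g. g x) gs))) (g x))"
  proof (rule smooth_on_linear_family[OF onb_ebasis S(1)])
    fix x assume "x \<in> S"
    then show "linear (\<lambda>e. \<omega> (chart_inv l (y x))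
        (map (coord_vec M l (chart_inv l (y x))) (es @ e # map (\<lambda>g. g x) gs)))"
      using alt_linear[OF forms_alt[OF \<omega>] l chart_inv_in[OF l]] S(2) by (simp add: image_subset_iff)
  next
    fix e
    show "smooth_on S (\<lambda>x. \<omega> (chart_inv l (y x))
        (map (coord_vec M l (chart_inv l (y x))) (es @ e # map (\<lambda>g. g x) gs)))"
      using Cons.IH[of "es @ [e]"] Cons.prems by simp
  qed (use Cons.prems in simp)
  then show ?case by simp
qed

lemma form_apply_smooth:
  assumes \<omega>: "\<omega> \<in> forms M n" and Xs: "set Xs \<subseteq> vector_fields M" "length Xs = n"
  shows "smooth_fun M (\<lambda>p. \<omega> p (map (\<lambda>X. X p) Xs))"
  unfolding smooth_fun_def o_def
proof
  fix k assume k: "k \<in> M"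
  note S = open_image[OF k]
  have "smooth_on (chart_image k) (\<lambda>x. \<omega> (chart_inv k x)
      (map (coord_vec M k (chart_inv k x)) ([] @ map (\<lambda>g. g x) (map (vcomp k) Xs))))"
    by (rule forms_smooth_family[OF \<omega> k S _ smooth_on_ident[OF S]]) (use Xs VF_smooth[OF _ k] in auto)
  then show "smooth_on (chart_image k) (\<lambda>x. \<omega> (chart_inv k x) (map (\<lambda>X. X (chart_inv k x)) Xs))"
  proof (rule smooth_on_cong[OF S])
    fix x assume x: "x \<in> chart_image k"
    have "coord_vec M k (chart_inv k x) (vcomp k X x) = X (chart_inv k x)" if "X \<in> set Xs" for X
      using coord_vec_vec_comp[OF k chart_inv_in[OF k x]] VF_tangent Xs that by blast
    then show "\<omega> (chart_inv k x) (map (coord_vec M k (chart_inv k x)) ([] @ map (\<lambda>g. g x) (map (vcomp k) Xs))) =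
      \<omega> (chart_inv k x) (map (\<lambda>X. X (chart_inv k x)) Xs)"
      by (simp add: comp_def cong: map_cong)
  qed
qed

lemma forms_scale:
  assumes \<omega>: "\<omega> \<in> forms M n" and f: "smooth_fun M f"
  shows "(\<lambda>p vs. f p * \<omega> p vs) \<in> forms M n"
  unfolding forms_def
proof (intro CollectI conjI allI ballI impI)
  fix p show "(\<lambda>vs. f p * \<omega> p vs) \<in> alt_forms M n p"
    using alt_combination[OF forms_alt[OF \<omega>] forms_alt[OF \<omega>], of "f p" p 0] by simp
next
  fix k es assume k: "k \<in> M" and es: "length (es :: 'e list) = n"
  show "smooth_on (chart_image k) (\<lambda>x. f (chart_inv k x) * \<omega> (chart_inv k x) (map (coord_vec M k (chart_inv k x)) es))"
    by (intro smooth_on_mult open_image k smooth_funD f forms_smooth[OF \<omega>] es)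
qed

lemma forms_zero: "(\<lambda>p vs. 0) \<in> forms M n"
  by (simp add: forms_def alt_forms_def smooth_on_const)

section \<open>The exterior derivative\<close>

lemma VF_extend_list:
  "set vs \<subseteq> tangent_space M p \<Longrightarrow>
   \<exists>Xs. length Xs = length vs \<and> set Xs \<subseteq> vector_fields M \<and> map (\<lambda>X. X p) Xs = vs"
proof (induction vs)
  case (Cons v vs)
  then obtain Xs where Xs: "length Xs = length vs" "set Xs \<subseteq> vector_fields M" "map (\<lambda>X. X p) Xs = vs" by auto
  obtain X where "X \<in> vector_fields M" "X p = v" using VF_extend[of v p] Cons.prems by auto
  then show ?case using Xs by (intro exI[of _ "X # Xs"]) auto
qed simp

text \<open>Two forms that satisfy the invariant formula agree on values of global fields, and by
  \<open>VF_extend_list\<close> these exhaust the lists of tangent vectors. Hence one form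
  satisfying the formula determines the definite description.\<close>

lemma ext_deriv_eqI:
  assumes \<zeta>: "\<zeta> \<in> forms M (Suc n)"
    and "\<And>Xs p. length Xs = Suc n \<Longrightarrow> set Xs \<subseteq> vector_fields M \<Longrightarrow>
      \<zeta> p (map (\<lambda>X. X p) Xs) =
        (\<Sum>i<Suc n. (- 1) ^ i * (Xs ! i) p (\<lambda>q. \<omega> q (map (\<lambda>X. X q) (omit i Xs)))) +
        (\<Sum>j<Suc n. \<Sum>i<j. (- 1) ^ (i + j) *
           \<omega> p (lie_bracket (Xs ! i) (Xs ! j) p # map (\<lambda>X. X p) (omit i (omit j Xs))))"
  shows "ext_deriv M n \<omega> = \<zeta>"
  unfolding ext_deriv_def
proof (rule the_equality)
  fix \<zeta>'
  assume *: "\<zeta>' \<in> forms M (Suc n) \<and> (\<forall>Xs p. length Xs = Suc n \<and> set Xs \<subseteq> vector_fields M \<longrightarrow>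
      \<zeta>' p (map (\<lambda>X. X p) Xs) =
        (\<Sum>i<Suc n. (- 1) ^ i * (Xs ! i) p (\<lambda>q. \<omega> q (map (\<lambda>X. X q) (omit i Xs)))) +
        (\<Sum>j<Suc n. \<Sum>i<j. (- 1) ^ (i + j) *
           \<omega> p (lie_bracket (Xs ! i) (Xs ! j) p # map (\<lambda>X. X p) (omit i (omit j Xs)))))"
  show "\<zeta>' = \<zeta>"
  proof
    fix p
    show "\<zeta>' p = \<zeta> p"
    proof (rule alt_eqI)
      fix vs assume "length vs = Suc n" "set vs \<subseteq> tangent_space M p"
      then obtain Xs where Xs: "length Xs = Suc n" "set Xs \<subseteq> vector_fields M" "map (\<lambda>X. X p) Xs = vs"
        using VF_extend_list by metis
      show "\<zeta>' p vs = \<zeta> p vs"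
        using * assms(2)[OF Xs(1,2)] Xs unfolding Xs(3)[symmetric] by simp
    qed (use * \<zeta> forms_alt in blast)+
  qed
qed (use assms in blast)

definition dfun :: "('m \<Rightarrow> real) \<Rightarrow> 'm form"
  where "dfun f p = form1 p (\<lambda>v. v f)"

lemma dfun_forms:
  assumes f: "smooth_fun M f"
  shows "dfun f \<in> forms M 1"
  unfolding forms_def
proof (intro CollectI conjI allI ballI impI)
  fix p show "dfun f p \<in> alt_forms M 1 p"
    unfolding dfun_def by (rule form1_alt) (simp add: lincomb_def)
next
  fix k es assume k: "k \<in> M" and es: "length (es :: 'e list) = 1"
  then obtain e where e: "es = [e]" by (auto simp: length_Suc_conv)
  show "smooth_on (chart_image k) (\<lambda>x. dfun f (chart_inv k x) (map (coord_vec M k (chart_inv k x)) es))"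
    by (rule smooth_on_cong[OF open_image[OF k] smooth_on_FD[OF smooth_funD[OF f k], of e]])
       (use k e f in \<open>simp add: dfun_def form1_def coord_vec_smooth\<close>)
qed

lemma dfun_apply: "v \<in> tangent_space M p \<Longrightarrow> dfun f p [v] = v f"
  by (simp add: dfun_def form1_def)

text \<open>In degree 0 the invariant formula sees \<omega> only on the empty list, that is as a
  function. This case serves Cartan's formula, where a 1-form is contracted with a field.\<close>

lemma ext_deriv_0:
  assumes "smooth_fun M (\<lambda>p. \<omega> p [])"
  shows "ext_deriv M 0 \<omega> = dfun (\<lambda>p. \<omega> p [])"
proof (rule ext_deriv_eqI)
  show "dfun (\<lambda>p. \<omega> p []) \<in> forms M (Suc 0)"
    using dfun_forms[OF assms] by simp
  fix Xs :: "('m \<Rightarrow> 'm tvec) list" and p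
  assume Xs: "length Xs = Suc 0" "set Xs \<subseteq> vector_fields M"
  then obtain X where X: "Xs = [X]" by (auto simp: length_Suc_conv)
  then show "dfun (\<lambda>p. \<omega> p []) p (map (\<lambda>X. X p) Xs) =
        (\<Sum>i<Suc 0. (- 1) ^ i * (Xs ! i) p (\<lambda>q. \<omega> q (map (\<lambda>X. X q) (omit i Xs)))) +
        (\<Sum>j<Suc 0. \<Sum>i<j. (- 1) ^ (i + j) *
           \<omega> p (lie_bracket (Xs ! i) (Xs ! j) p # map (\<lambda>X. X p) (omit i (omit j Xs))))"
    using Xs VF_tangent by (simp add: omit_def dfun_apply)
qed

text \<open>The exterior derivative of a 1-form in the chart \<open>k\<close>. It does not depend on the chart because it
  satisfies the invariant formula for every pair of vector fields.\<close>

definition d1 :: "'m form \<Rightarrow> ('m, 'e) chart \<Rightarrow> 'm \<Rightarrow> 'm tvec \<Rightarrow> 'm tvec \<Rightarrow> real"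
  where "d1 \<omega> k p v w =
    FD (\<lambda>x. \<omega> (chart_inv k x) [coord_vec M k (chart_inv k x) (vec_comp M k p w)]) (snd k p) (vec_comp M k p v) -
    FD (\<lambda>x. \<omega> (chart_inv k x) [coord_vec M k (chart_inv k x) (vec_comp M k p v)]) (snd k p) (vec_comp M k p w)"

lemma form1_coord:
  assumes \<omega>: "\<omega> \<in> forms M 1" and k: "k \<in> M"
  shows "smooth_on (chart_image k) (\<lambda>x. \<omega> (chart_inv k x) [coord_vec M k (chart_inv k x) e])"
    "x \<in> chart_image k \<Longrightarrow> linear (\<lambda>e. \<omega> (chart_inv k x) [coord_vec M k (chart_inv k x) e])"
  using forms_smooth[OF \<omega> k, of "[e]"] alt_linear[OF forms_alt[OF \<omega>] k chart_inv_in[OF k], of x "[]" "[]"] by simp_all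

lemma form1_apply_smooth:
  assumes "\<omega> \<in> forms M 1" "X \<in> vector_fields M"
  shows "smooth_fun M (\<lambda>q. \<omega> q [X q])"
  using form_apply_smooth[OF assms(1), of "[X]"] assms(2) by simp

text \<open>In the chart, \<open>X (\<omega> (Y))\<close> splits into \<omega> on the derivative of
  the components of \<open>Y\<close> and the derivative of the coefficients of \<omega>. After
  antisymmetrisation the first kind of term is \<omega> on the bracket, the second is
  \<open>d1\<close>.\<close>

lemma d1_formula:
  assumes \<omega>: "\<omega> \<in> forms M 1" and X: "X \<in> vector_fields M" and Y: "Y \<in> vector_fields M"
    and k: "k \<in> M" "p \<in> fst k"
  shows "d1 \<omega> k p (X p) (Y p) =
    X p (\<lambda>q. \<omega> q [Y q]) - Y p (\<lambda>q. \<omega> q [X q]) - \<omega> p [lie_bracket X Y p]"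
proof -
  note S = open_image[OF k(1)] chart_in_image[OF k(2)]
  define G where "G x e = \<omega> (chart_inv k x) [coord_vec M k (chart_inv k x) e]" for x e
  have G: "smooth_on (chart_image k) (\<lambda>x. G x e)" "x \<in> chart_image k \<Longrightarrow> linear (G x)" for x e
    using form1_coord[OF \<omega> k(1)] by (simp_all add: G_def[abs_def])
  have *: "X p (\<lambda>q. \<omega> q [Y q]) = G (snd k p) (FD (vcomp k Y) (snd k p) (vcomp k X (snd k p))) +
      FD (\<lambda>x. G x (vcomp k Y (snd k p))) (snd k p) (vcomp k X (snd k p))"
    if X: "X \<in> vector_fields M" and Y: "Y \<in> vector_fields M" for X Y
  proof -
    have "X p (\<lambda>q. \<omega> q [Y q]) = FD (\<lambda>x. \<omega> (chart_inv k x) [Y (chart_inv k x)]) (snd k p) (vcomp k X (snd k p))"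
      using VF_apply_coord[OF X form1_apply_smooth[OF \<omega> Y] k(1) S(2)] k by simp
    also have "\<dots> = FD (\<lambda>x. G x (vcomp k Y x)) (snd k p) (vcomp k X (snd k p))"
      by (rule FD_cong[OF _ S, symmetric])
         (use smooth_fun_differentiable[OF form1_apply_smooth[OF \<omega> Y] k] k VF_tangent[OF Y] in 
           \<open>simp_all add: G_def coord_vec_vec_comp\<close>)
    also have "\<dots> = G (snd k p) (FD (vcomp k Y) (snd k p) (vcomp k X (snd k p))) +
      FD (\<lambda>x. G x (vcomp k Y (snd k p))) (snd k p) (vcomp k X (snd k p))"
      by (rule FD_linear_family[OF onb_ebasis S G(2,1) VF_smooth[OF Y k(1)]])
    finally show ?thesis .
  qed
  have "\<omega> p [lie_bracket X Y p] = G (snd k p) 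
      (FD (vcomp k Y) (snd k p) (vcomp k X (snd k p)) - FD (vcomp k X) (snd k p) (vcomp k Y (snd k p)))"
    unfolding lie_bracket_coord[OF X Y k] using k by (simp add: G_def)
  then show ?thesis
    unfolding *[OF X Y] *[OF Y X] linear_diff[OF G(2)[OF S(2)]] using k by (simp add: d1_def G_def)
qed

lemma d1_chart:
  assumes \<omega>: "\<omega> \<in> forms M 1" and k: "k \<in> M" "p \<in> fst k" and l: "l \<in> M" "p \<in> fst l"
    and v: "v \<in> tangent_space M p" "w \<in> tangent_space M p"
  shows "d1 \<omega> k p v w = d1 \<omega> l p v w"
proof -
  obtain X where X: "X \<in> vector_fields M" "X p = v" using VF_extend[OF v(1)] .
  obtain Y where Y: "Y \<in> vector_fields M" "Y p = w" using VF_extend[OF v(2)] .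
  show ?thesis using d1_formula[OF \<omega> X(1) Y(1) k] d1_formula[OF \<omega> X(1) Y(1) l] X Y by simp
qed

lemma vec_comp_lincomb:
  assumes "k \<in> M" "p \<in> fst k" "v \<in> tangent_space M p" "w \<in> tangent_space M p"
  shows "vec_comp M k p (lincomb a v b w) = a *\<^sub>R vec_comp M k p v + b *\<^sub>R vec_comp M k p w"
proof -
  obtain e where "v = coord_vec M k p e" using tangentE[OF assms(3,1,2)] .
  moreover obtain e' where "w = coord_vec M k p e'" using tangentE[OF assms(4,1,2)] .
  ultimately show ?thesis using assms by (simp add: coord_vec_lincomb)
qed

lemma d1_lincomb:
  assumes \<omega>: "\<omega> \<in> forms M 1" and k: "k \<in> M" "p \<in> fst k"
    and v: "v \<in> tangent_space M p" "w \<in> tangent_space M p"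
  shows "d1 \<omega> k p (lincomb a v b w) z = a * d1 \<omega> k p v z + b * d1 \<omega> k p w z"
proof -
  note S = open_image[OF k(1)] chart_in_image[OF k(2)]
  let ?G = "\<lambda>x e. \<omega> (chart_inv k x) [coord_vec M k (chart_inv k x) e]"
  have 1: "linear (\<lambda>e. FD (\<lambda>x. ?G x e) (snd k p) u)" for u
    by (rule linear_FD_param[OF S form1_coord(2,1)[OF \<omega> k(1)]])
  have 2: "linear (FD (\<lambda>x. ?G x e) (snd k p))" for e
    by (rule linear_FD[OF smooth_on_differentiable[OF form1_coord(1)[OF \<omega> k(1)] S(2)]])
  show ?thesis
    unfolding d1_def vec_comp_lincomb[OF k v]
    using linear_add[OF 1] linear_scale[OF 1] linear_add[OF 2] linear_scale[OF 2]
    by (simp add: algebra_simps)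
qed

lemma ext_deriv_1:
  assumes \<omega>: "\<omega> \<in> forms M 1"
  shows "ext_deriv M 1 \<omega> \<in> forms M 2"
    and "\<And>X Y p. X \<in> vector_fields M \<Longrightarrow> Y \<in> vector_fields M \<Longrightarrow> ext_deriv M 1 \<omega> p [X p, Y p] =
      X p (\<lambda>q. \<omega> q [Y q]) - Y p (\<lambda>q. \<omega> q [X q]) - \<omega> p [lie_bracket X Y p]"
proof -
  \<comment> \<open>The chosen chart may jump from point to point. Where smoothness is checked,
    \<open>d1_chart\<close> replaces it by one fixed chart.\<close>
  define c where "c p = (SOME k. k \<in> M \<and> p \<in> fst k)" for p
  have "c p \<in> M \<and> p \<in> fst (c p)" for p
    unfolding c_def by (rule someI_ex) (use ex_chart[of p] in blast)
  then have c: "c p \<in> M" "p \<in> fst (c p)" for p by blast+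
  define \<zeta> where "\<zeta> p = form2 p (d1 \<omega> (c p) p)" for p
  have \<zeta>: "\<zeta> p [X p, Y p] = X p (\<lambda>q. \<omega> q [Y q]) - Y p (\<lambda>q. \<omega> q [X q]) - \<omega> p [lie_bracket X Y p]"
    if "X \<in> vector_fields M" "Y \<in> vector_fields M" for X Y p
    using d1_formula[OF \<omega> that c] that VF_tangent by (simp add: \<zeta>_def form2_def)
  have \<zeta>2: "\<zeta> \<in> forms M 2"
    unfolding forms_def
  proof (intro CollectI conjI allI ballI impI)
    fix p show "\<zeta> p \<in> alt_forms M 2 p"
      unfolding \<zeta>_def by (rule form2_alt) (use d1_lincomb[OF \<omega> c] in \<open>auto simp: d1_def\<close>)
  next
    fix k es assume k: "k \<in> M" and "length (es :: 'e list) = 2"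
    then obtain u v where es: "es = [u, v]" by (auto simp: length_Suc_conv numeral_2_eq_2)
    note S = open_image[OF k]
    let ?G = "\<lambda>x e. \<omega> (chart_inv k x) [coord_vec M k (chart_inv k x) e]"
    show "smooth_on (chart_image k) (\<lambda>x. \<zeta> (chart_inv k x) (map (coord_vec M k (chart_inv k x)) es))"
    proof (rule smooth_on_cong[OF S])
      show "smooth_on (chart_image k) (\<lambda>x. FD (\<lambda>x. ?G x v) x u - FD (\<lambda>x. ?G x u) x v)"
        by (intro smooth_on_diff S smooth_on_FD form1_coord[OF \<omega> k])
      fix x assume x: "x \<in> chart_image k"
      show "FD (\<lambda>x. ?G x v) x u - FD (\<lambda>x. ?G x u) x v = 
        \<zeta> (chart_inv k x) (map (coord_vec M k (chart_inv k x)) es)"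
        using d1_chart[OF \<omega> c k chart_inv_in[OF k x]] x k
        by (simp add: \<zeta>_def form2_def es) (simp add: d1_def)
    qed
  qed
  have "ext_deriv M 1 \<omega> = \<zeta>"
  proof (rule ext_deriv_eqI)
    show "\<zeta> \<in> forms M (Suc 1)" using \<zeta>2 by (simp add: numeral_2_eq_2)
    fix Xs :: "('m \<Rightarrow> 'm tvec) list" and p
    assume Xs: "length Xs = Suc 1" "set Xs \<subseteq> vector_fields M"
    then obtain X Y where X: "Xs = [X, Y]" by (auto simp: length_Suc_conv)
    then show "\<zeta> p (map (\<lambda>X. X p) Xs) =
        (\<Sum>i<Suc 1. (- 1) ^ i * (Xs ! i) p (\<lambda>q. \<omega> q (map (\<lambda>X. X q) (omit i Xs)))) +
        (\<Sum>j<Suc 1. \<Sum>i<j. (- 1) ^ (i + j) *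
           \<omega> p (lie_bracket (Xs ! i) (Xs ! j) p # map (\<lambda>X. X p) (omit i (omit j Xs))))"
      using Xs \<zeta>[of X Y] by (simp add: omit_def)
  qed
  then show "ext_deriv M 1 \<omega> \<in> forms M 2"
    and "\<And>X Y p. X \<in> vector_fields M \<Longrightarrow> Y \<in> vector_fields M \<Longrightarrow> ext_deriv M 1 \<omega> p [X p, Y p] =
      X p (\<lambda>q. \<omega> q [Y q]) - Y p (\<lambda>q. \<omega> q [X q]) - \<omega> p [lie_bracket X Y p]"
    using \<zeta>2 \<zeta> by simp_all
qed

section \<open>The Courant bracket\<close>

lemma gen_sectionsD:
  assumes "a \<in> gen_sections M"
  shows "fst \<circ> a \<in> vector_fields M" "snd \<circ> a \<in> forms M 1"
    "fst (a p) \<in> tangent_space M p" "snd (a p) \<in> cotangent_space M p"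
  using assms VF_tangent[of "fst \<circ> a" p] forms_alt[of "snd \<circ> a" 1 p] by (simp_all add: gen_sections_def)

lemma fst_courant: "fst (courant M H a b p) = lie_bracket (fst \<circ> a) (fst \<circ> b) p"
  by (simp add: courant_def Let_def)

lemma snd_courant:
  assumes a: "a \<in> gen_sections M" and b: "b \<in> gen_sections M"
  shows "snd (courant M H a b p) = (\<lambda>vs. ext_deriv M 1 (snd \<circ> b) p (fst (a p) # vs) +
    dfun (\<lambda>p. snd (b p) [fst (a p)]) p vs - ext_deriv M 1 (snd \<circ> a) p (fst (b p) # vs) +
    H p (fst (b p) # fst (a p) # vs))"
proof -
  have "ext_deriv M (1 - 1) (contract (fst \<circ> a) (snd \<circ> b)) = dfun (\<lambda>p. snd (b p) [fst (a p)])"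
    using ext_deriv_0[of "contract (fst \<circ> a) (snd \<circ> b)"] 
      form1_apply_smooth[OF gen_sectionsD(2)[OF b] gen_sectionsD(1)[OF a]] by (simp add: contract_def)
  then show ?thesis
    by (simp add: courant_def Let_def lie_deriv_def contract_def)
qed

text \<open>Write \<eta> for the covector part of \<open>b\<close> and \<open>X\<close> for the
  vector part of \<open>a\<close>. The term \<open>Z (\<eta> (X))\<close> in the derivative of
  \<eta> on \<open>X\<close> and \<open>Z\<close> cancels against the differential of
  \<open>\<eta> (X)\<close> on \<open>Z\<close>. The contraction with the field of \<open>b\<close>
  acts on \<open>H\<close> first, so that field stands in front.\<close>

lemma snd_courant_apply:
  assumes a: "a \<in> gen_sections M" and b: "b \<in> gen_sections M" and Z: "Z \<in> vector_fields M"
  shows "snd (courant M H a b p) [Z p] =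
    fst (a p) (\<lambda>q. snd (b q) [Z q]) - snd (b p) [lie_bracket (fst \<circ> a) Z p]
    - fst (b p) (\<lambda>q. snd (a q) [Z q]) + Z p (\<lambda>q. snd (a q) [fst (b q)]) + snd (a p) [lie_bracket (fst \<circ> b) Z p]
    + H p [fst (b p), fst (a p), Z p]"
  unfolding snd_courant[OF a b]
  using ext_deriv_1(2)[OF gen_sectionsD(2)[OF b] gen_sectionsD(1)[OF a] Z, of p]
    ext_deriv_1(2)[OF gen_sectionsD(2)[OF a] gen_sectionsD(1)[OF b] Z, of p]
  by (simp add: dfun_apply[OF VF_tangent[OF Z]])

text \<open>\<open>F\<close> is controlled on \<open>gen_tangent\<close> only, so the bracket must
  be known to lie there before \<open>F\<close> is applied to it.\<close>

lemma courant_gen_tangent: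
  assumes H: "H \<in> forms M 3" and a: "a \<in> gen_sections M" and b: "b \<in> gen_sections M"
  shows "courant M H a b p \<in> gen_tangent M p"
proof -
  have "lie_bracket (fst \<circ> a) (fst \<circ> b) p \<in> tangent_space M p"
    by (intro VF_tangent lie_bracket_VF gen_sectionsD a b)
  moreover have "snd (courant M H a b p) \<in> cotangent_space M p"
  proof -
    have 1: "(\<lambda>vs. ext_deriv M 1 (snd \<circ> b) p (fst (a p) # vs)) \<in> alt_forms M 1 p"
      using forms_alt[OF ext_deriv_1(1)[OF gen_sectionsD(2)[OF b]], of p]
      by (intro alt_contract[OF _ gen_sectionsD(3)[OF a]]) (simp only: numeral_2_eq_2 One_nat_def)
    have 2: "(\<lambda>vs. ext_deriv M 1 (snd \<circ> a) p (fst (b p) # vs)) \<in> alt_forms M 1 p"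
      using forms_alt[OF ext_deriv_1(1)[OF gen_sectionsD(2)[OF a]], of p]
      by (intro alt_contract[OF _ gen_sectionsD(3)[OF b]]) (simp only: numeral_2_eq_2 One_nat_def)
    have 3: "dfun (\<lambda>p. snd (b p) [fst (a p)]) p \<in> alt_forms M 1 p"
      using form1_apply_smooth[OF gen_sectionsD(2)[OF b] gen_sectionsD(1)[OF a]]
      by (intro forms_alt dfun_forms) simp
    have 4: "(\<lambda>vs. H p (fst (b p) # fst (a p) # vs)) \<in> alt_forms M 1 p"
      using forms_alt[OF H, of p]
      by (intro alt_contract[OF alt_contract] gen_sectionsD(3)[OF a] gen_sectionsD(3)[OF b]) (simp add: numeral_3_eq_3)
    show ?thesis
      unfolding snd_courant[OF a b]
      using alt_combination[OF alt_combination[OF 1 3, of 1 1] alt_combination[OF 2 4, of "-1" 1], of 1 1]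
      by (simp add: algebra_simps)
  qed
  ultimately show ?thesis by (simp add: gen_tangent_def mem_Times_iff fst_courant)
qed

lemma cotangent_eqI:
  assumes "\<theta> \<in> cotangent_space M p" "\<theta>' \<in> cotangent_space M p"
    "\<And>Z. Z \<in> vector_fields M \<Longrightarrow> \<theta> [Z p] = \<theta>' [Z p]"
  shows "\<theta> = \<theta>'"
proof (rule alt_eqI[OF assms(1,2)])
  fix vs assume "length vs = 1" "set vs \<subseteq> tangent_space M p"
  then obtain v where v: "vs = [v]" "v \<in> tangent_space M p" by (auto simp: length_Suc_conv)
  obtain Z where "Z \<in> vector_fields M" "Z p = v" using VF_extend[OF v(2)] .
  then show "\<theta> vs = \<theta>' vs" using assms(3)[of Z] v by simp
qed

section \<open>The Leibniz rule in the second argument\<close>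

definition scale_sec :: "('m \<Rightarrow> real) \<Rightarrow> ('m \<Rightarrow> 'm gvec) \<Rightarrow> 'm \<Rightarrow> 'm gvec"
  where "scale_sec f s p = (\<lambda>g. f p * fst (s p) g, \<lambda>vs. f p * snd (s p) vs)"

lemma scale_sec_gen_sections:
  assumes "s \<in> gen_sections M" "smooth_fun M f"
  shows "scale_sec f s \<in> gen_sections M"
  using VF_scale[of "fst \<circ> s" f] forms_scale[of "snd \<circ> s" 1 f] assms
  by (simp add: gen_sections_def scale_sec_def comp_def)

text \<open>With \<xi> the covector part of \<open>a\<close> and \<open>Y\<close> the vector part of
  \<open>b\<close>, the terms containing \<open>Z f\<close> come from \<open>Z (\<xi> (f Y))\<close>
  and from \<xi> on the bracket of \<open>f Y\<close> and \<open>Z\<close>. They have opposite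
  signs, so only the derivative of \<open>f\<close> along the vector part of \<open>a\<close>
  survives.\<close>

lemma courant_scale:
  assumes H: "H \<in> forms M 3" and a: "a \<in> gen_sections M" and b: "b \<in> gen_sections M" and f: "smooth_fun M f"
  shows "courant M H a (scale_sec f b) p =
    (lincomb (f p) (fst (courant M H a b p)) (fst (a p) f) (fst (b p)),
     lincomb (f p) (snd (courant M H a b p)) (fst (a p) f) (snd (b p)))"
proof (rule prod_eqI)
  note fb = scale_sec_gen_sections[OF b f]
  note ta = gen_sectionsD(3,4)[OF a, of p] and tb = gen_sectionsD(3,4)[OF b, of p]
  note aD = gen_sectionsD[OF a] and bD = gen_sectionsD[OF b]
  show "fst (courant M H a (scale_sec f b) p) = fst (lincomb (f p) (fst (courant M H a b p)) (fst (a p) f) (fst (b p)),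
     lincomb (f p) (snd (courant M H a b p)) (fst (a p) f) (snd (b p)))"
    using lie_bracket_scale_right[OF gen_sectionsD(1)[OF a] gen_sectionsD(1)[OF b] f, of p]
    by (simp add: fst_courant lincomb_def scale_sec_def comp_def)
  have "snd (courant M H a (scale_sec f b) p) = lincomb (f p) (snd (courant M H a b p)) (fst (a p) f) (snd (b p))"
  proof (rule cotangent_eqI)
    show "snd (courant M H a (scale_sec f b) p) \<in> cotangent_space M p"
      using courant_gen_tangent[OF H a fb] by (simp add: gen_tangent_def mem_Times_iff)
    show "lincomb (f p) (snd (courant M H a b p)) (fst (a p) f) (snd (b p)) \<in> cotangent_space M p"
      using courant_gen_tangent[OF H a b, of p] tb alt_combination[of "snd (courant M H a b p)" 1 p "snd (b p)"]
      by (simp add: gen_tangent_def mem_Times_iff lincomb_def)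
    fix Z assume Z: "Z \<in> vector_fields M"
    have 1: "fst (a p) (\<lambda>q. f q * snd (b q) [Z q]) = f p * fst (a p) (\<lambda>q. snd (b q) [Z q]) + fst (a p) f * snd (b p) [Z p]"
      using tangent_mult[OF ta(1) f form1_apply_smooth[OF bD(2) Z]] by simp
    have ab: "smooth_fun M (\<lambda>q. snd (a q) [fst (b q)])"
      using form1_apply_smooth[OF aD(2) bD(1)] by simp
    have 2: "Z p (\<lambda>q. snd (a q) [\<lambda>g. f q * fst (b q) g]) =
        f p * Z p (\<lambda>q. snd (a q) [fst (b q)]) + Z p f * snd (a p) [fst (b p)]"
    proof -
      have "snd (a q) [\<lambda>g. f q * fst (b q) g] = f q * snd (a q) [fst (b q)]" for q
        using alt_scale[OF gen_sectionsD(4)[OF a] gen_sectionsD(3)[OF b], of q "[]" "f q" "[]"] by simp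
      then show ?thesis using tangent_mult[OF VF_tangent[OF Z] f ab] by simp
    qed
    have br: "lie_bracket (fst \<circ> b) Z p \<in> tangent_space M p"
      by (intro VF_tangent lie_bracket_VF bD Z)
    have 3: "snd (a p) [lie_bracket (fst \<circ> scale_sec f b) Z p] = 
        f p * snd (a p) [lie_bracket (fst \<circ> b) Z p] - Z p f * snd (a p) [fst (b p)]"
      using alt_lincomb[OF ta(2) br tb(1), of "[]" "f p" "- Z p f" "[]"] lie_bracket_scale_left[OF bD(1) Z f, of p]
      by (simp add: scale_sec_def comp_def lincomb_def)
    have 4: "H p [\<lambda>g. f p * fst (b p) g, fst (a p), Z p] = f p * H p [fst (b p), fst (a p), Z p]"
      using alt_scale[OF forms_alt[OF H] tb(1), of "[]" "f p"] by simp
    show "snd (courant M H a (scale_sec f b) p) [Z p] = 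
      lincomb (f p) (snd (courant M H a b p)) (fst (a p) f) (snd (b p)) [Z p]"
      unfolding lincomb_def snd_courant_apply[OF a b Z] snd_courant_apply[OF a fb Z] 3
      by (simp add: scale_sec_def 1 2 4 algebra_simps)
  qed
  then show "snd (courant M H a (scale_sec f b) p) = snd (lincomb (f p) (fst (courant M H a b p)) (fst (a p) f) (fst (b p)),
     lincomb (f p) (snd (courant M H a b p)) (fst (a p) f) (snd (b p)))" by simp
qed

section \<open>Push-forward along a diffeomorphism\<close>

lemma diffeo_inv: "diffeomorphism M \<phi> \<Longrightarrow> diffeomorphism M (inv \<phi>)"
  by (simp add: diffeomorphism_def bij_imp_bij_inv inv_inv_eq)

lemma push_vec_coord:
  assumes \<phi>: "diffeomorphism M \<phi>" and k: "k \<in> M" "p \<in> fst k" and l: "l \<in> M" "\<phi> p \<in> fst l"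
  shows "push_vec \<phi> (coord_vec M k p e) = coord_vec M l (\<phi> p) (FD (\<lambda>x. snd l (\<phi> (chart_inv k x))) (snd k p) e)"
proof
  fix f
  show "push_vec \<phi> (coord_vec M k p e) f = coord_vec M l (\<phi> p) (FD (\<lambda>x. snd l (\<phi> (chart_inv k x))) (snd k p) e) f"
  proof (cases "smooth_fun M f")
    case True
    then show ?thesis using coord_vec_comp[of \<phi>, OF _ k l True] \<phi> by (simp add: push_vec_def diffeomorphism_def)
  next
    case False
    have "f \<circ> \<phi> \<circ> inv \<phi> = f" using \<phi> by (simp add: diffeomorphism_def fun_eq_iff bij_is_surj surj_f_inv_f)
    \<comment> \<open>Composition with the smooth inverse would make \<open>f\<close> smooth. So
      both sides take the default value 0.\<close>
    then have "\<not> smooth_fun M (f \<circ> \<phi>)" using False smooth_fun_comp[of "inv \<phi>" "f \<circ> \<phi>"] \<phi> by (auto simp: diffeomorphism_def)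
    then show ?thesis using False by (simp add: push_vec_def coord_vec_nonsmooth)
  qed
qed

lemma push_vec_tangent:
  assumes \<phi>: "diffeomorphism M \<phi>" and v: "v \<in> tangent_space M p"
  shows "push_vec \<phi> v \<in> tangent_space M (\<phi> p)"
proof -
  obtain k l where k: "k \<in> M" "p \<in> fst k" and l: "l \<in> M" "\<phi> p \<in> fst l" using ex_chart by blast
  obtain e where "v = coord_vec M k p e" using tangentE[OF v k] .
  then show ?thesis using push_vec_coord[OF \<phi> k l] l by simp
qed

text \<open>The converse direction is what makes a pulled-back form vanish on lists with non-tangent
  entries, as \<open>alt_forms\<close> demands.\<close>

lemma push_vec_tangent_iff:
  assumes \<phi>: "diffeomorphism M \<phi>"
  shows "push_vec \<phi> v \<in> tangent_space M (\<phi> p) \<longleftrightarrow> v \<in> tangent_space M p"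
  using push_vec_tangent[OF \<phi>, of v p] push_vec_tangent[OF diffeo_inv[OF \<phi>], of "push_vec \<phi> v" "\<phi> p"] \<phi>
  by (auto simp: diffeomorphism_def push_vec_inv bij_is_inj)

lemma tangent_push_vecE:
  assumes \<phi>: "diffeomorphism M \<phi>" and w: "w \<in> tangent_space M (\<phi> p)"
  obtains v where "v \<in> tangent_space M p" "w = push_vec \<phi> v"
proof -
  have "w = push_vec \<phi> (push_vec (inv \<phi>) w)" using \<phi> by (simp add: diffeomorphism_def push_vec_inv)
  then show ?thesis using that w push_vec_tangent_iff[OF \<phi>] by metis
qed

definition push_VF :: "('m \<Rightarrow> 'm) \<Rightarrow> ('m \<Rightarrow> 'm tvec) \<Rightarrow> 'm \<Rightarrow> 'm tvec"
  where "push_VF \<phi> X q = push_vec \<phi> (X (inv \<phi> q))"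

text \<open>Transport along \<phi> evaluates a smooth expression in the chart \<open>k\<close> at
  the preimage of a point in the chart \<open>l\<close>. These are the openness and smoothness facts
  that such compositions require.\<close>

lemma diffeo_chart_smooth:
  assumes \<phi>: "diffeomorphism M \<phi>" and k: "k \<in> M" and l: "l \<in> M"
  defines "W \<equiv> fst l \<inter> inv \<phi> -` fst k"
  shows "open W" "W \<subseteq> fst l" "open (snd l ` W)" "open (snd k ` (fst k \<inter> \<phi> -` fst l))"
    "smooth_on (snd l ` W) (\<lambda>x. snd k (inv \<phi> (chart_inv l x)))"
    "smooth_on (snd k ` (fst k \<inter> \<phi> -` fst l)) (\<lambda>x. snd l (\<phi> (chart_inv k x)))"
    "(\<lambda>x. snd k (inv \<phi> (chart_inv l x))) ` (snd l ` W) \<subseteq> snd k ` (fst k \<inter> \<phi> -` fst l)"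
proof -
  have s: "smooth_map M \<phi>" "smooth_map M (inv \<phi>)" "surj \<phi>" using \<phi> by (auto simp: diffeomorphism_def bij_is_surj)
  show "open W"
    unfolding W_def using s(2) open_domain[OF k] open_domain[OF l]
    by (auto simp: smooth_map_def intro!: open_Int open_vimage)
  show "W \<subseteq> fst l" by (simp add: W_def)
  show "open (snd l ` W)" unfolding W_def by (rule smooth_map_domain_open[OF s(2) l k open_domain[OF k]])
  show "open (snd k ` (fst k \<inter> \<phi> -` fst l))" by (rule smooth_map_domain_open[OF s(1) k l open_domain[OF l]])
  show "smooth_on (snd l ` W) (\<lambda>x. snd k (inv \<phi> (chart_inv l x)))"
    unfolding W_def by (rule smooth_mapD[OF s(2) l k])
  show "smooth_on (snd k ` (fst k \<inter> \<phi> -` fst l)) (\<lambda>x. snd l (\<phi> (chart_inv k x)))"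
    by (rule smooth_mapD[OF s(1) k l])
  show "(\<lambda>x. snd k (inv \<phi> (chart_inv l x))) ` (snd l ` W) \<subseteq> snd k ` (fst k \<inter> \<phi> -` fst l)"
    using l s(3) by (auto simp: W_def surj_f_inv_f)
qed

lemma push_VF_VF:
  assumes \<phi>: "diffeomorphism M \<phi>" and X: "X \<in> vector_fields M"
  shows "push_VF \<phi> X \<in> vector_fields M"
proof (rule VF_I)
  fix q
  obtain k l where k: "k \<in> M" "inv \<phi> q \<in> fst k" and l: "l \<in> M" "q \<in> fst l" using ex_chart by blast
  let ?W = "fst l \<inter> inv \<phi> -` fst k" and ?y = "\<lambda>x. snd k (inv \<phi> (chart_inv l x))"
  note d = diffeo_chart_smooth[OF \<phi> k(1) l(1)]
  let ?g = "\<lambda>x. FD (\<lambda>x. snd l (\<phi> (chart_inv k x))) (?y x) (vcomp k X (?y x))"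
  have X': "smooth_on (snd l ` ?W) (\<lambda>x. vcomp k X (?y x))"
    by (rule smooth_on_compose[OF onb_ebasis d(3) open_image[OF k(1)] _ VF_smooth[OF X k(1)] d(5)]) (use l in auto)
  have "smooth_on (snd l ` ?W) ?g"
    by (rule smooth_on_FD_apply[OF onb_ebasis d(3,4,7,5,6) X'])
  moreover have "push_VF \<phi> X q = coord_vec M l q (?g (snd l q))" if "q \<in> ?W" for q
  proof -
    have p: "inv \<phi> q \<in> fst k" "\<phi> (inv \<phi> q) = q" using that \<phi> by (auto simp: diffeomorphism_def bij_is_surj surj_f_inv_f)
    have "push_VF \<phi> X q = push_vec \<phi> (coord_vec M k (inv \<phi> q) (vcomp k X (snd k (inv \<phi> q))))"
      unfolding push_VF_def using VF_coord[OF X k(1) p(1)] by simp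
    also have "\<dots> = coord_vec M l q (FD (\<lambda>x. snd l (\<phi> (chart_inv k x))) (snd k (inv \<phi> q)) (vcomp k X (snd k (inv \<phi> q))))"
      using push_vec_coord[OF \<phi> k(1) p(1) l(1)] that p by simp
    finally show ?thesis using that l by simp
  qed
  ultimately show "\<exists>k\<in>M. \<exists>W g. open W \<and> q \<in> W \<and> W \<subseteq> fst k \<and> smooth_on (snd k ` W) g \<and>
      (\<forall>q\<in>W. push_VF \<phi> X q = coord_vec M k q (g (snd k q)))"
    using k l d by (intro bexI[of _ l] exI[of _ ?W] exI[of _ ?g]) auto
qed

lemma push_VF_apply: "bij \<phi> \<Longrightarrow> push_VF \<phi> X (\<phi> p) = push_vec \<phi> (X p)"
  by (simp add: push_VF_def bij_is_inj)

lemma push_vec_apply: "push_vec \<phi> v f = v (\<lambda>p. f (\<phi> p))"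
  by (simp add: push_vec_def o_def)

text \<open>Since tangent vectors are operators, the push-forward of \<open>Y\<close> applied to
  \<open>f\<close>, then composed with \<phi>, is \<open>Y\<close> applied to
  \<open>f \<circ> \<phi>\<close>. Commutators therefore correspond without any coordinates.\<close>

lemma push_VF_lie_bracket:
  "bij \<phi> \<Longrightarrow> lie_bracket (push_VF \<phi> X) (push_VF \<phi> Y) (\<phi> p) = push_vec \<phi> (lie_bracket X Y p)"
  by (simp add: fun_eq_iff lie_bracket_def push_VF_apply push_vec_apply)

lemma pull_covec_alt:
  assumes \<phi>: "diffeomorphism M \<phi>" and \<theta>: "\<theta> \<in> alt_forms M n (\<phi> p)"
  shows "pull_covec \<phi> \<theta> \<in> alt_forms M n p"
  unfolding alt_forms_def
proof (intro CollectI conjI allI ballI impI)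
  show "pull_covec \<phi> \<theta> vs = 0" if "\<not> (length vs = n \<and> set vs \<subseteq> tangent_space M p)" for vs
    using alt_zero[OF \<theta>, of "map (push_vec \<phi>) vs"] that push_vec_tangent_iff[OF \<phi>]
    by (auto simp: pull_covec_def image_subset_iff subset_iff)
  show "pull_covec \<phi> \<theta> vs = 0" if "\<not> distinct vs" for vs
    using alt_not_distinct[OF \<theta>, of "map (push_vec \<phi>) vs"] that by (auto simp: pull_covec_def distinct_map)
  show "pull_covec \<phi> \<theta> (us @ lincomb a v b w # ws) = a * pull_covec \<phi> \<theta> (us @ v # ws) + b * pull_covec \<phi> \<theta> (us @ w # ws)"
    if "v \<in> tangent_space M p" "w \<in> tangent_space M p" for us ws a b v w
    using alt_lincomb[OF \<theta> push_vec_tangent[OF \<phi> that(1)] push_vec_tangent[OF \<phi> that(2)]]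
    by (simp add: pull_covec_def push_vec_lincomb)
qed

lemma pull_form_forms:
  assumes \<phi>: "diffeomorphism M \<phi>" and \<omega>: "\<omega> \<in> forms M n"
  shows "pull_form \<phi> \<omega> \<in> forms M n"
  unfolding forms_def
proof (intro CollectI conjI allI ballI impI smooth_on_local)
  show "pull_form \<phi> \<omega> p \<in> alt_forms M n p" for p
    unfolding pull_form_def by (rule pull_covec_alt[OF \<phi> forms_alt[OF \<omega>]])
  fix k es x assume k: "k \<in> M" and es: "length (es :: 'e list) = n" and "x \<in> chart_image k"
  then obtain p where p: "p \<in> fst k" "x = snd k p" by (auto simp: chart_image_def)
  obtain l where l: "l \<in> M" "\<phi> p \<in> fst l" using ex_chart by blast
  note d = diffeo_chart_smooth[OF \<phi> k l(1)]
  let ?U = "snd k ` (fst k \<inter> \<phi> -` fst l)" and ?y = "\<lambda>x. snd l (\<phi> (chart_inv k x))"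
  have "smooth_on ?U (\<lambda>x. \<omega> (chart_inv l (?y x)) (map (coord_vec M l (chart_inv l (?y x)))
      ([] @ map (\<lambda>g. g x) (map (\<lambda>e x. FD ?y x e) es))))"
    by (rule forms_smooth_family[OF \<omega> l(1) d(4) _ d(6)]) (use k es smooth_on_FD[OF d(6)] in auto)
  then have "smooth_on ?U (\<lambda>x. pull_form \<phi> \<omega> (chart_inv k x) (map (coord_vec M k (chart_inv k x)) es))"
  proof (rule smooth_on_cong[OF d(4)])
    fix x assume "x \<in> ?U"
    then have "chart_inv k x \<in> fst k" "\<phi> (chart_inv k x) \<in> fst l" "snd k (chart_inv k x) = x" using k by auto
    then show "\<omega> (chart_inv l (?y x)) (map (coord_vec M l (chart_inv l (?y x)))
      ([] @ map (\<lambda>g. g x) (map (\<lambda>e x. FD ?y x e) es))) = 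
      pull_form \<phi> \<omega> (chart_inv k x) (map (coord_vec M k (chart_inv k x)) es)"
      using l push_vec_coord[OF \<phi> k _ l(1), of "chart_inv k x"]
      by (simp add: pull_form_def pull_covec_def comp_def)
  qed
  then show "\<exists>U. open U \<and> x \<in> U \<and> smooth_on U (\<lambda>x. pull_form \<phi> \<omega> (chart_inv k x) (map (coord_vec M k (chart_inv k x)) es))"
    using d(4) p l by blast
qed

lemma forms_diff:
  assumes "\<omega> \<in> forms M n" "\<omega>' \<in> forms M n"
  shows "(\<lambda>p vs. \<omega> p vs - \<omega>' p vs) \<in> forms M n"
  unfolding forms_def
proof (intro CollectI conjI allI ballI impI)
  fix p show "(\<lambda>vs. \<omega> p vs - \<omega>' p vs) \<in> alt_forms M n p"
    using alt_combination[OF forms_alt[OF assms(1)] forms_alt[OF assms(2)], of 1 p "-1"] by simp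
next
  fix k es assume "k \<in> M" "length (es :: 'e list) = n"
  then show "smooth_on (chart_image k) (\<lambda>x. \<omega> (chart_inv k x) (map (coord_vec M k (chart_inv k x)) es) -
     \<omega>' (chart_inv k x) (map (coord_vec M k (chart_inv k x)) es))"
    by (intro smooth_on_diff open_image forms_smooth[OF assms(1)] forms_smooth[OF assms(2)])
qed

section \<open>Local trivialisations, and sections through a given element of a fibre\<close>

lemma covec_comp_inner:
  assumes k: "k \<in> M" "p \<in> fst k" and \<theta>: "\<theta> \<in> cotangent_space M p"
  shows "\<theta> [coord_vec M k p e] = covec_comp M k p \<theta> \<bullet> e"
    and "covec_comp M k p \<theta> = (\<Sum>b\<in>ebasis. \<theta> [coord_vec M k p b] *\<^sub>R b)"
proof -
  let ?t = "\<Sum>b\<in>ebasis. \<theta> [coord_vec M k p b] *\<^sub>R b"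
  have *: "\<forall>e. \<theta> [coord_vec M k p e] = ?t \<bullet> e"
  proof
    fix e
    show "\<theta> [coord_vec M k p e] = ?t \<bullet> e"
      using linear_onb[OF onb_ebasis alt_linear[OF \<theta> k, of "[]" "[]"], of e]
      by (simp add: inner_sum_left inner_commute[of e] ac_simps)
  qed
  moreover have "t = ?t" if "\<forall>e. \<theta> [coord_vec M k p e] = t \<bullet> e" for t
  proof -
    have "\<forall>e. t \<bullet> e = ?t \<bullet> e" by (intro allI trans[OF that[rule_format, symmetric] *[rule_format]])
    then show ?thesis by (rule iffD1[OF vector_eq_rdot])
  qed
  ultimately have "covec_comp M k p \<theta> = ?t"
    unfolding covec_comp_def by (rule the_equality)
  then show "covec_comp M k p \<theta> = ?t" "\<theta> [coord_vec M k p e] = covec_comp M k p \<theta> \<bullet> e"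
    by (simp only:, simp only: *[rule_format, symmetric])
qed

lemma coord_covec:
  assumes k: "k \<in> M" "p \<in> fst k"
  shows "coord_covec M k p t \<in> cotangent_space M p"
    and "coord_covec M k p t [coord_vec M k p e] = t \<bullet> e"
    and "\<theta> \<in> cotangent_space M p \<Longrightarrow> (\<And>e. \<theta> [coord_vec M k p e] = t \<bullet> e) \<Longrightarrow> coord_covec M k p t = \<theta>"
proof -
  let ?\<theta> = "form1 p (\<lambda>v. t \<bullet> vec_comp M k p v)"
  have "?\<theta> \<in> cotangent_space M p"
    by (rule form1_alt) (simp add: vec_comp_lincomb[OF k] inner_add_right)
  then have 1: "?\<theta> \<in> cotangent_space M p \<and> (\<forall>e. ?\<theta> [coord_vec M k p e] = t \<bullet> e)"
    using k by (simp add: form1_def)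
  have 2: "\<theta> = \<theta>'" if "\<theta> \<in> cotangent_space M p \<and> (\<forall>e. \<theta> [coord_vec M k p e] = t \<bullet> e)"
    "\<theta>' \<in> cotangent_space M p \<and> (\<forall>e. \<theta>' [coord_vec M k p e] = t \<bullet> e)" for \<theta> \<theta>'
  proof (rule cotangent_eqI)
    fix Z assume "Z \<in> vector_fields M"
    then obtain e where "Z p = coord_vec M k p e" using tangentE[OF VF_tangent k] by blast
    then show "\<theta> [Z p] = \<theta>' [Z p]" using that by simp
  qed (use that in auto)
  have 3: "coord_covec M k p t = ?\<theta>"
    unfolding coord_covec_def
  proof (rule the_equality)
    fix \<theta> assume "\<theta> \<in> cotangent_space M p \<and> (\<forall>e. \<theta> [coord_vec M k p e] = t \<bullet> e)"
    then show "\<theta> = ?\<theta>" using 1 by (rule 2)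
  qed (rule 1)
  then show "coord_covec M k p t \<in> cotangent_space M p" "coord_covec M k p t [coord_vec M k p e] = t \<bullet> e"
    using 1 by auto
  show "coord_covec M k p t = \<theta>" if "\<theta> \<in> cotangent_space M p" "\<And>e. \<theta> [coord_vec M k p e] = t \<bullet> e"
    unfolding 3 by (rule 2[OF 1]) (use that in blast)
qed

lemma to_fibre_from_fibre:
  assumes k: "k \<in> M" "p \<in> fst k" and a: "a \<in> gen_tangent M p"
  shows "to_fibre M k p (from_fibre M k p a) = a"
  using a coord_covec(3)[OF k] covec_comp_inner(1)[OF k] coord_vec_vec_comp[OF k]
  by (auto simp: to_fibre_def from_fibre_def gen_tangent_def)

lemma covec_comp_smooth:
  assumes \<omega>: "\<omega> \<in> forms M 1" and k: "k \<in> M"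
  shows "smooth_on (chart_image k) (\<lambda>x. covec_comp M k (chart_inv k x) (\<omega> (chart_inv k x)))"
proof (rule smooth_on_cong[OF open_image[OF k]])
  show "smooth_on (chart_image k) (\<lambda>x. \<Sum>b\<in>ebasis. \<omega> (chart_inv k x) [coord_vec M k (chart_inv k x) b] *\<^sub>R b)"
    by (intro smooth_on_sum smooth_on_scaleR open_image k form1_coord[OF \<omega> k] smooth_on_const)
qed (simp add: covec_comp_inner(2)[OF k chart_inv_in[OF k] forms_alt[OF \<omega>]])

text \<open>The covector part is extended by an exact form, the differential of a function from
  \<open>ex_smooth_differential\<close>.\<close>

lemma gen_tangent_extend:
  assumes a: "a \<in> gen_tangent M p"
  obtains c where "c \<in> gen_sections M" "c p = a"
proof -
  have "fst a \<in> tangent_space M p" using a by (auto simp: gen_tangent_def)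
  then obtain X where X: "X \<in> vector_fields M" "X p = fst a" by (rule VF_extend)
  have \<theta>: "snd a \<in> cotangent_space M p" using a by (auto simp: gen_tangent_def)
  obtain k where k: "k \<in> M" "p \<in> fst k" using ex_chart by blast
  obtain f where f: "smooth_fun M f" "\<And>e. coord_vec M k p e f = covec_comp M k p (snd a) \<bullet> e"
    using ex_smooth_differential[OF k] by metis
  have "dfun f p = snd a"
  proof (rule cotangent_eqI[OF forms_alt[OF dfun_forms[OF f(1)]] \<theta>])
    fix Z assume Z: "Z \<in> vector_fields M"
    then have *: "Z p = coord_vec M k p (vcomp k Z (snd k p))" using VF_coord k by blast
    show "dfun f p [Z p] = snd a [Z p]"
      unfolding dfun_apply[OF VF_tangent[OF Z]] by (subst (1 2) *) (simp only: f(2) covec_comp_inner(1)[OF k \<theta>])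
  qed
  then show ?thesis
    using that[of "\<lambda>p. (X p, dfun f p)"] X dfun_forms[OF f(1)] by (simp add: gen_sections_def comp_def)
qed

end

section \<open>Automorphisms of the Courant bracket\<close>

locale courant_automorphism = smooth_manifold M
  for M :: "('m::{t2_space, second_countable_topology}, 'e::real_inner) atlas" +
  fixes H :: "'m form" and \<phi> :: "'m \<Rightarrow> 'm" and F :: "'m \<Rightarrow> 'm gvec \<Rightarrow> 'm gvec"
  assumes H: "H \<in> forms M 3"
    and diffeo: "diffeomorphism M \<phi>"
    and aut: "bundle_automorphism M \<phi> F"
    and orth: "orthogonal_map M F"
    and pres: "preserves_courant M H \<phi> F"
begin

section \<open>The action of \<open>F\<close> on fibres and sections\<close>

lemma bij_phi: "bij \<phi>"
  using diffeo by (simp add: diffeomorphism_def)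

lemma inv_phi [simp]: "inv \<phi> (\<phi> p) = p" "\<phi> (inv \<phi> p) = p"
  using bij_phi by (simp_all add: bij_is_inj bij_is_surj surj_f_inv_f)

lemma F_in: "a \<in> gen_tangent M p \<Longrightarrow> F p a \<in> gen_tangent M (\<phi> p)"
  using aut by (simp add: bundle_automorphism_def bundle_map_def)

lemma F_lincomb:
  "a \<in> gen_tangent M p \<Longrightarrow> b \<in> gen_tangent M p \<Longrightarrow>
   F p (lincomb r (fst a) s (fst b), lincomb r (snd a) s (snd b)) =
     (lincomb r (fst (F p a)) s (fst (F p b)), lincomb r (snd (F p a)) s (snd (F p b)))"
  using aut by (simp add: bundle_automorphism_def bundle_map_def)

lemma F_scale:
  "a \<in> gen_tangent M p \<Longrightarrow> 
   F p (\<lambda>g. r * fst a g, \<lambda>vs. r * snd a vs) = (\<lambda>g. r * fst (F p a) g, \<lambda>vs. r * snd (F p a) vs)"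
  using F_lincomb[of a p a r 0] by (simp add: lincomb_def)

lemma F_inj: "a \<in> gen_tangent M p \<Longrightarrow> b \<in> gen_tangent M p \<Longrightarrow> F p a = F p b \<Longrightarrow> a = b"
  using aut by (auto simp: bundle_automorphism_def bij_betw_def dest: inj_onD)

text \<open>The local expression in \<open>bundle_map\<close>, as a function of one nested pair, so
  that smooth base points and fibre coordinates can be substituted by composition.\<close>

definition F_loc :: "('m, 'e) chart \<Rightarrow> ('m, 'e) chart \<Rightarrow> 'e \<times> ('e \<times> 'e) \<Rightarrow> 'e \<times> 'e"
  where "F_loc k l z = from_fibre M l (\<phi> (chart_inv k (fst z)))
          (F (chart_inv k (fst z)) (to_fibre M k (chart_inv k (fst z)) (snd z)))"

lemma F_loc_smooth:
  assumes k: "k \<in> M" and l: "l \<in> M" and S: "open S" "y ` S \<subseteq> snd k ` (fst k \<inter> \<phi> -` fst l)" 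
    "smooth_on S y" "smooth_on S u" "smooth_on S t"
  shows "smooth_on S (\<lambda>x. F_loc k l (y x, (u x, t x)))"
proof (rule smooth_on_compose[OF onb_Times[OF onb_ebasis onb_Times[OF onb_ebasis onb_ebasis]] S(1)])
  show "smooth_on (snd k ` (fst k \<inter> \<phi> -` fst l) \<times> UNIV) (F_loc k l)"
    using aut k l by (simp add: bundle_automorphism_def bundle_map_def case_prod_unfold F_loc_def[abs_def])
  show "open (snd k ` (fst k \<inter> \<phi> -` fst l) \<times> (UNIV :: ('e \<times> 'e) set))"
    by (intro open_Times diffeo_chart_smooth(4)[OF diffeo k l]) simp
  show "smooth_on S (\<lambda>x. (y x, (u x, t x)))" by (intro smooth_on_Pair S)
qed (use S in auto)

abbreviation push_F :: "('m \<Rightarrow> 'm gvec) \<Rightarrow> 'm \<Rightarrow> 'm gvec"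
  where "push_F \<equiv> push_section \<phi> F"

lemma push_F_apply: "push_F c (\<phi> p) = F p (c p)"
  by (simp add: push_section_def)

lemma gen_sections_fibre: "c \<in> gen_sections M \<Longrightarrow> c p \<in> gen_tangent M p"
  using gen_sectionsD(3,4)[of c p] by (simp add: gen_tangent_def mem_Times_iff)

lemma push_F_coord_smooth:
  assumes c: "c \<in> gen_sections M" and k: "k \<in> M" and l: "l \<in> M"
  shows "smooth_on (snd l ` (fst l \<inter> inv \<phi> -` fst k)) (\<lambda>x. from_fibre M l (chart_inv l x) (push_F c (chart_inv l x)))"
proof (rule smooth_on_cong)
  note d = diffeo_chart_smooth[OF diffeo k l]
  let ?y = "\<lambda>x. snd k (inv \<phi> (chart_inv l x))"
  show "smooth_on (snd l ` (fst l \<inter> inv \<phi> -` fst k))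
    (\<lambda>x. F_loc k l (?y x, (vcomp k (fst \<circ> c) (?y x), covec_comp M k (chart_inv k (?y x)) ((snd \<circ> c) (chart_inv k (?y x))))))"
    by (intro F_loc_smooth[OF k l d(3,7,5)]
         smooth_on_compose[OF onb_ebasis d(3) open_image[OF k] _ VF_smooth[OF gen_sectionsD(1)[OF c] k] d(5)]
         smooth_on_compose[OF onb_ebasis d(3) open_image[OF k] _ covec_comp_smooth[OF gen_sectionsD(2)[OF c] k] d(5)])
       (use l in auto)
  show "open (snd l ` (fst l \<inter> inv \<phi> -` fst k))" by (rule d(3))
  fix x assume "x \<in> snd l ` (fst l \<inter> inv \<phi> -` fst k)"
  then have x: "inv \<phi> (chart_inv l x) \<in> fst k" using l by auto
  show "F_loc k l (?y x, (vcomp k (fst \<circ> c) (?y x), covec_comp M k (chart_inv k (?y x)) ((snd \<circ> c) (chart_inv k (?y x))))) =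
    from_fibre M l (chart_inv l x) (push_F c (chart_inv l x))"
    using to_fibre_from_fibre[OF k x gen_sections_fibre[OF c]] k x
    by (simp add: F_loc_def push_section_def from_fibre_def)
qed

lemma push_F_gen_sections:
  assumes c: "c \<in> gen_sections M"
  shows "push_F c \<in> gen_sections M"
proof -
  have fib: "push_F c q \<in> gen_tangent M q" for q
    using F_in[OF gen_sections_fibre[OF c], of "inv \<phi> q"] by (simp add: push_section_def)
  have "fst \<circ> push_F c \<in> vector_fields M"
  proof (rule VF_I)
    fix q
    obtain k l where k: "k \<in> M" "inv \<phi> q \<in> fst k" and l: "l \<in> M" "q \<in> fst l" using ex_chart by blast
    note d = diffeo_chart_smooth[OF diffeo k(1) l(1)]
    let ?W = "fst l \<inter> inv \<phi> -` fst k"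
      and ?g = "\<lambda>x. fst (from_fibre M l (chart_inv l x) (push_F c (chart_inv l x)))"
    have "smooth_on (snd l ` ?W) ?g"
      by (rule smooth_on_bounded_linear[OF bounded_linear_fst d(3) push_F_coord_smooth[OF c k(1) l(1)]])
    moreover have "(fst \<circ> push_F c) q = coord_vec M l q (?g (snd l q))" if "q \<in> ?W" for q
      using that l coord_vec_vec_comp[OF l(1), of q "fst (push_F c q)"] fib[of q] by (simp add: from_fibre_def gen_tangent_def mem_Times_iff)
    ultimately show "\<exists>k\<in>M. \<exists>W g. open W \<and> q \<in> W \<and> W \<subseteq> fst k \<and> smooth_on (snd k ` W) g \<and>
        (\<forall>q\<in>W. (fst \<circ> push_F c) q = coord_vec M k q (g (snd k q)))"
      using k l d by (intro bexI[of _ l] exI[of _ ?W] exI[of _ ?g]) auto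
  qed
  moreover have "snd \<circ> push_F c \<in> forms M 1"
    unfolding forms_def
  proof (intro CollectI conjI allI ballI impI smooth_on_local)
    show "(snd \<circ> push_F c) q \<in> alt_forms M 1 q" for q
      using fib[of q] by (simp add: gen_tangent_def mem_Times_iff)
    fix l es x assume l: "l \<in> M" and "length (es :: 'e list) = 1" and "x \<in> chart_image l"
    then obtain q e where q: "q \<in> fst l" "x = snd l q" and e: "es = [e]" by (auto simp: chart_image_def length_Suc_conv)
    obtain k where k: "k \<in> M" "inv \<phi> q \<in> fst k" using ex_chart by blast
    note d = diffeo_chart_smooth[OF diffeo k(1) l]
    let ?W = "fst l \<inter> inv \<phi> -` fst k"
    have "smooth_on (snd l ` ?W) (\<lambda>x. snd (from_fibre M l (chart_inv l x) (push_F c (chart_inv l x))) \<bullet> e)"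
      by (intro smooth_on_inner smooth_on_const d(3)
        smooth_on_bounded_linear[OF bounded_linear_snd d(3) push_F_coord_smooth[OF c k(1) l]])
    then have "smooth_on (snd l ` ?W) (\<lambda>x. (snd \<circ> push_F c) (chart_inv l x) (map (coord_vec M l (chart_inv l x)) es))"
    proof (rule smooth_on_cong[OF d(3)])
      fix x assume "x \<in> snd l ` ?W"
      then have "chart_inv l x \<in> fst l" using l by auto
      then show "snd (from_fibre M l (chart_inv l x) (push_F c (chart_inv l x))) \<bullet> e =
        (snd \<circ> push_F c) (chart_inv l x) (map (coord_vec M l (chart_inv l x)) es)"
        using covec_comp_inner(1)[OF l, of "chart_inv l x"] fib[of "chart_inv l x"] 
        by (simp add: from_fibre_def e gen_tangent_def mem_Times_iff)
    qed
    then show "\<exists>U. open U \<and> x \<in> U \<and> smooth_on U (\<lambda>x. (snd \<circ> push_F c) (chart_inv l x) (map (coord_vec M l (chart_inv l x)) es))"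
      using d(3) q k by blast
  qed
  ultimately show ?thesis by (simp add: gen_sections_def)
qed

text \<open>The hypothesis on \<open>F\<close> involves the inverse. It is instantiated at
  \<open>push_F c\<close> and \<open>push_F d\<close>, which are smooth sections by
  \<open>push_F_gen_sections\<close> and are carried back to \<open>c\<close> and
  \<open>d\<close>.\<close>

lemma F_courant:
  assumes c: "c \<in> gen_sections M" and d: "d \<in> gen_sections M"
  shows "F p (courant M H c d p) = courant M H (push_F c) (push_F d) (\<phi> p)"
proof -
  have *: "push_section (inv \<phi>) (inverse_map M \<phi> F) (push_F c) = c" if c: "c \<in> gen_sections M" for c
  proof
    fix p
    have "inv_into (gen_tangent M p) (F p) (F p (c p)) = c p"
      by (rule inv_into_f_f[OF inj_onI gen_sections_fibre[OF c]]) (rule F_inj)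
    then show "push_section (inv \<phi>) (inverse_map M \<phi> F) (push_F c) p = c p"
      using bij_phi by (simp add: push_section_def inverse_map_def inv_inv_eq)
  qed
  have "push_F (courant M H c d) = courant M H (push_F c) (push_F d)"
    using pres push_F_gen_sections[OF c] push_F_gen_sections[OF d] *[OF c] *[OF d]
    unfolding preserves_courant_def by metis
  then show ?thesis using push_F_apply[of "courant M H c d" p] by simp
qed

lemma push_F_scale:
  assumes c: "c \<in> gen_sections M"
  shows "push_F (scale_sec (\<lambda>p. f (\<phi> p)) c) = scale_sec f (push_F c)"
  using F_scale[OF gen_sections_fibre[OF c]]
  by (simp add: fun_eq_iff push_section_def scale_sec_def)

text \<open>If \<open>D = d(p)\<close> is a nonzero value of a section, comparing \<open>F[c, f d]\<close> with \<open>[F c, F(f d)]\<close> by the Leibniz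
  rule leaves \<open>(c f) F D = ((F c) (f \<circ> \<phi>\<inverse>)) F D\<close>; here \<open>c\<close> and \<open>F c\<close> act on functions through their vector
  parts, and \<open>F D \<noteq> 0\<close> since \<open>F\<close> is injective. Such \<open>D\<close> exists unless the tangent space is zero.\<close>

lemma fst_F:
  assumes a: "a \<in> gen_tangent M p"
  shows "fst (F p a) = push_vec \<phi> (fst a)"
proof (cases "\<exists>v\<in>tangent_space M p. v \<noteq> (\<lambda>f. 0)")
  case False
  have "fst a \<in> tangent_space M p" "fst (F p a) \<in> tangent_space M (\<phi> p)"
    using a F_in[OF a] by (auto simp: gen_tangent_def)
  \<comment> \<open>Both sides are the zero operator: every tangent vector at the image point is
    pushed forward from \<open>p\<close>, where only zero is available.\<close>
  then show ?thesis
    using False tangent_push_vecE[OF diffeo] by metis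
next
  case True
  then obtain v g where v: "v \<in> tangent_space M p" "v g \<noteq> 0" by fastforce
  have "(v, \<lambda>vs. 0) \<in> gen_tangent M p"
    using v forms_alt[OF forms_zero[of 1], of p] by (simp add: gen_tangent_def)
  then obtain d where d: "d \<in> gen_sections M" "d p = (v, \<lambda>vs. 0)" using gen_tangent_extend by blast
  obtain c where c: "c \<in> gen_sections M" "c p = a" using gen_tangent_extend[OF a] .
  show ?thesis
  proof
    fix f
    show "fst (F p a) f = push_vec \<phi> (fst a) f"
    proof (cases "smooth_fun M f")
      case False
      have "push_vec \<phi> (fst a) \<in> tangent_space M (\<phi> p)" "fst (F p a) \<in> tangent_space M (\<phi> p)"
        using a F_in[OF a] push_vec_tangent[OF diffeo] by (auto simp: gen_tangent_def)
      then show ?thesis using False tangent_nonsmooth by metis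
    next
      case True
      have f: "smooth_fun M (\<lambda>p. f (\<phi> p))"
        using smooth_fun_comp[OF _ True, of \<phi>] diffeo by (simp add: diffeomorphism_def comp_def)
      \<comment> \<open>\<open>r\<close> and \<open>s\<close> are the two sides of the claim at
        \<open>f\<close>. They appear as the coefficients of \<open>F p (d p)\<close> in the two
        Leibniz expansions.\<close>
      define r where "r = fst a (\<lambda>p. f (\<phi> p))"
      define s where "s = fst (F p a) f"
      let ?A = "courant M H c d p"
      have D: "d p \<in> gen_tangent M p" and A: "?A \<in> gen_tangent M p"
        using gen_sections_fibre[OF d(1)] courant_gen_tangent[OF H c(1) d(1)] by auto
      have "F p (courant M H c (scale_sec (\<lambda>p. f (\<phi> p)) d) p) = 
          courant M H (push_F c) (scale_sec f (push_F d)) (\<phi> p)"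
        using F_courant[OF c(1) scale_sec_gen_sections[OF d(1) f]] push_F_scale[OF d(1)] by simp
      then have "(lincomb (f (\<phi> p)) (fst (F p ?A)) r (fst (F p (d p))), lincomb (f (\<phi> p)) (snd (F p ?A)) r (snd (F p (d p)))) =
        (lincomb (f (\<phi> p)) (fst (F p ?A)) s (fst (F p (d p))), lincomb (f (\<phi> p)) (snd (F p ?A)) s (snd (F p (d p))))"
        unfolding courant_scale[OF H c(1) d(1) f] F_lincomb[OF A D]
          courant_scale[OF H push_F_gen_sections[OF c(1)] push_F_gen_sections[OF d(1)] True] 
          F_courant[OF c(1) d(1), symmetric] push_F_apply
        by (simp add: r_def s_def c)
      then have "F p (\<lambda>g. r * fst (d p) g, \<lambda>vs. r * snd (d p) vs) = F p (\<lambda>g. s * fst (d p) g, \<lambda>vs. s * snd (d p) vs)"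
        unfolding F_scale[OF D] by (simp add: lincomb_def fun_eq_iff)
      moreover have "(\<lambda>g. r * fst (d p) g, \<lambda>vs. r * snd (d p) vs) \<in> gen_tangent M p" for r
        using D tangent_scale alt_combination[of "snd (d p)" 1 p "snd (d p)" r 0] by (simp add: gen_tangent_def mem_Times_iff)
      ultimately have "(\<lambda>g. r * fst (d p) g) = (\<lambda>g. s * fst (d p) g)" using F_inj by (metis prod.inject)
      then have "r * v g = s * v g" using d(2) by (metis fst_conv)
      then show ?thesis using v(2) by (simp add: r_def s_def push_vec_apply)
    qed
  qed
qed

text \<open>If \<open>F\<close> is the lift of \<phi> after the exponential of a form, then the
  covector part of \<open>F\<close> on \<open>v + 0\<close>, paired with the push-forward of
  \<open>w\<close>, is that form on \<open>v\<close> and \<open>w\<close>. The definition reads this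
  backwards.\<close>

definition beta :: "'m \<Rightarrow> 'm tvec \<Rightarrow> 'm tvec \<Rightarrow> real"
  where "beta p v w = snd (F p (v, \<lambda>vs. 0)) [push_vec \<phi> w]"

definition B :: "'m form"
  where "B p = form2 p (beta p)"

lemma gen_tangent_vec: "v \<in> tangent_space M p \<Longrightarrow> (v, \<lambda>vs. 0) \<in> gen_tangent M p"
  using forms_alt[OF forms_zero[of 1], of p] by (simp add: gen_tangent_def)

text \<open>Orthogonality is applied to \<open>a\<close> and \<open>w + 0\<close>. As
  \<open>fst_F\<close> knows the vector parts of both images, the only unknown left is the covector
  part of \<open>F p a\<close> on the push-forward of \<open>w\<close>.\<close>

lemma snd_F:
  assumes a: "a \<in> gen_tangent M p" and w: "w \<in> tangent_space M p"
  shows "snd (F p a) [push_vec \<phi> w] = snd a [w] - beta p w (fst a)"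
proof -
  have "gen_inner (F p a) (F p (w, \<lambda>vs. 0)) = gen_inner a (w, \<lambda>vs. 0)"
    using orth a gen_tangent_vec[OF w] by (simp add: orthogonal_map_def)
  then show ?thesis
    by (simp add: gen_inner_def fst_F[OF a] fst_F[OF gen_tangent_vec[OF w]] beta_def)
qed

lemma beta_skew: "v \<in> tangent_space M p \<Longrightarrow> w \<in> tangent_space M p \<Longrightarrow> beta p v w = - beta p w v"
  using snd_F[OF gen_tangent_vec[of v p], of w] by (simp add: beta_def)

lemma B_alt: "B p \<in> alt_forms M 2 p"
  unfolding B_def
proof (rule form2_alt)
  fix v w z a b assume vw: "v \<in> tangent_space M p" "w \<in> tangent_space M p" and z: "z \<in> tangent_space M p"
  \<comment> \<open>Linearity is visible in the second slot of \<open>beta\<close>, where a covector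
    is evaluated; skewness moves it to the slot required by \<open>form2_alt\<close>.\<close>
  have "snd (F p (z, \<lambda>vs. 0)) \<in> cotangent_space M (\<phi> p)"
    using F_in[OF gen_tangent_vec[OF z]] by (simp add: gen_tangent_def mem_Times_iff)
  from alt_lincomb[OF this push_vec_tangent[OF diffeo vw(1)] push_vec_tangent[OF diffeo vw(2)], of "[]" a b "[]"]
  have "beta p z (lincomb a v b w) = a * beta p z v + b * beta p z w"
    by (simp add: beta_def push_vec_lincomb)
  then show "beta p (lincomb a v b w) z = a * beta p v z + b * beta p w z"
    using beta_skew[OF z] vw tangent_lincomb[OF vw] by (simp add: algebra_simps)
qed (rule beta_skew)

lemma B_apply: "v \<in> tangent_space M p \<Longrightarrow> w \<in> tangent_space M p \<Longrightarrow> B p [v, w] = beta p v w"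
  by (simp add: B_def form2_def)

lemma snd_F_B:
  assumes a: "a \<in> gen_tangent M p" and w: "w \<in> tangent_space M p"
  shows "snd (F p a) [push_vec \<phi> w] = snd a [w] + B p [fst a, w]"
proof -
  have "fst a \<in> tangent_space M p" using a by (auto simp: gen_tangent_def)
  then show ?thesis using snd_F[OF a w] beta_skew[OF _ w] B_apply[OF _ w] by simp
qed

lemma B_forms: "B \<in> forms M 2"
  unfolding forms_def
proof (intro CollectI conjI allI ballI impI smooth_on_local)
  show "B p \<in> alt_forms M 2 p" for p by (rule B_alt)
  fix k es x assume k: "k \<in> M" and "length (es :: 'e list) = 2" and "x \<in> chart_image k"
  then obtain p u v where p: "p \<in> fst k" "x = snd k p" and es: "es = [u, v]"
    by (auto simp: chart_image_def length_Suc_conv numeral_2_eq_2)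
  obtain l where l: "l \<in> M" "\<phi> p \<in> fst l" using ex_chart by blast
  note d = diffeo_chart_smooth[OF diffeo k l(1)]
  let ?U = "snd k ` (fst k \<inter> \<phi> -` fst l)" and ?y = "\<lambda>x. snd l (\<phi> (chart_inv k x))"
  \<comment> \<open>In coordinates \<open>B\<close> on \<open>u\<close> and \<open>v\<close> is the
    covector part of \<open>F\<close> on \<open>(u, 0)\<close>, paired with the derivative of \<phi>
    in direction \<open>v\<close>.\<close>
  have "smooth_on ?U (\<lambda>x. snd (F_loc k l (x, (u, 0))) \<bullet> FD ?y x v)"
    by (intro smooth_on_inner smooth_on_FD d smooth_on_bounded_linear[OF bounded_linear_snd d(4)]
        F_loc_smooth[OF k l(1) d(4) _ smooth_on_ident[OF d(4)]] smooth_on_const) simp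
  then have "smooth_on ?U (\<lambda>x. B (chart_inv k x) (map (coord_vec M k (chart_inv k x)) es))"
  proof (rule smooth_on_cong[OF d(4)])
    fix x assume "x \<in> ?U"
    then have x: "chart_inv k x \<in> fst k" "\<phi> (chart_inv k x) \<in> fst l" "snd k (chart_inv k x) = x" using k by auto
    let ?p = "chart_inv k x" and ?a = "(coord_vec M k (chart_inv k x) u, \<lambda>vs. 0)"
    have "coord_covec M k ?p 0 = (\<lambda>vs. 0)"
      using forms_alt[OF forms_zero[of 1], of ?p] by (intro coord_covec(3)[OF k x(1)]) simp_all
    then have "snd (F_loc k l (x, (u, 0))) = covec_comp M l (\<phi> ?p) (snd (F ?p ?a))"
      by (simp add: F_loc_def to_fibre_def from_fibre_def)
    moreover have "snd (F ?p ?a) \<in> cotangent_space M (\<phi> ?p)"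
      using F_in[OF gen_tangent_vec[OF coord_vec_tangent[OF k x(1)]]] by (simp add: gen_tangent_def mem_Times_iff)
    ultimately have "snd (F_loc k l (x, (u, 0))) \<bullet> FD ?y x v = snd (F ?p ?a) [push_vec \<phi> (coord_vec M k ?p v)]"
      using covec_comp_inner(1)[OF l(1) x(2)] push_vec_coord[OF diffeo k x(1) l(1) x(2)] x(3) by simp
    then show "snd (F_loc k l (x, (u, 0))) \<bullet> FD ?y x v = B ?p (map (coord_vec M k ?p) es)"
      using k x by (simp add: es B_apply beta_def)
  qed
  then show "\<exists>U. open U \<and> x \<in> U \<and> smooth_on U (\<lambda>x. B (chart_inv k x) (map (coord_vec M k (chart_inv k x)) es))"
    using d(4) p l by blast
qed

lemma F_eq:
  assumes a: "a \<in> gen_tangent M p"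
  shows "F p a = lift_diffeo \<phi> (exp_form B p a)"
proof (rule prod_eqI)
  show "fst (F p a) = fst (lift_diffeo \<phi> (exp_form B p a))"
    by (simp add: lift_diffeo_def exp_form_def fst_F[OF a])
  have ta: "fst a \<in> tangent_space M p" "snd a \<in> cotangent_space M p" using a by (auto simp: gen_tangent_def)
  have Fa: "snd (F p a) \<in> cotangent_space M (\<phi> p)" using F_in[OF a] by (auto simp: gen_tangent_def)
  have "(\<lambda>vs. B p (fst a # vs)) \<in> cotangent_space M p"
    using B_alt[of p] by (intro alt_contract ta) (simp add: numeral_2_eq_2)
  then have "(\<lambda>vs. snd a vs + B p (fst a # vs)) \<in> cotangent_space M (inv \<phi> (\<phi> p))"
    using alt_combination[OF ta(2), of _ 1 1] by simp
  then have R: "pull_covec (inv \<phi>) (\<lambda>vs. snd a vs + B p (fst a # vs)) \<in> cotangent_space M (\<phi> p)"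
    by (rule pull_covec_alt[OF diffeo_inv[OF diffeo]])
  have "snd (F p a) = pull_covec (inv \<phi>) (\<lambda>vs. snd a vs + B p (fst a # vs))"
  proof (rule cotangent_eqI[OF Fa R])
    fix Z assume "Z \<in> vector_fields M"
    then obtain w where w: "w \<in> tangent_space M p" "Z (\<phi> p) = push_vec \<phi> w"
      using tangent_push_vecE[OF diffeo VF_tangent] by metis
    show "snd (F p a) [Z (\<phi> p)] = pull_covec (inv \<phi>) (\<lambda>vs. snd a vs + B p (fst a # vs)) [Z (\<phi> p)]"
      using snd_F_B[OF a w(1)] by (simp add: w(2) pull_covec_def push_vec_inv(1)[OF bij_phi])
  qed
  then show "snd (F p a) = snd (lift_diffeo \<phi> (exp_form B p a))"
    by (simp add: lift_diffeo_def exp_form_def)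
qed

text \<open>Inserting \<open>v + 0\<close> into the normal form and pairing with the push-forward of
  \<open>w\<close> returns the form on \<open>v\<close> and \<open>w\<close>, while the same
  expression defines \<open>beta\<close>.\<close>

lemma B_unique:
  assumes B': "B' \<in> forms M 2" and eq: "\<And>p a. a \<in> gen_tangent M p \<Longrightarrow> F p a = lift_diffeo \<phi> (exp_form B' p a)"
  shows "B' = B"
proof
  fix p show "B' p = B p"
  proof (rule alt_eqI[OF forms_alt[OF B'] B_alt])
    fix vs assume "length vs = 2" "set vs \<subseteq> tangent_space M p"
    then obtain v w where v: "vs = [v, w]" "v \<in> tangent_space M p" "w \<in> tangent_space M p"
      by (auto simp: length_Suc_conv numeral_2_eq_2)
    have "snd (F p (v, \<lambda>vs. 0)) [push_vec \<phi> w] = B' p [v, w]"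
      unfolding eq[OF gen_tangent_vec[OF v(2)]]
      by (simp add: lift_diffeo_def exp_form_def pull_covec_def push_vec_inv(1)[OF bij_phi])
    then show "B' p vs = B p vs" using v by (simp add: B_apply beta_def)
  qed
qed

text \<open>For sections with zero covector part, the covector part of the bracket consists of the
  \<open>H\<close> term alone. Their images under \<open>F\<close> do have covector parts, given by
  \<open>B\<close>, so the bracket of the images contributes all derivative terms. The two
  expressions are compared on the push-forward of \<open>Z\<close>.\<close>

lemma H_formula:
  assumes X: "X \<in> vector_fields M" and Y: "Y \<in> vector_fields M" and Z: "Z \<in> vector_fields M"
  shows "pull_form \<phi> H p [X p, Y p, Z p] - H p [X p, Y p, Z p] =
    X p (\<lambda>q. B q [Y q, Z q]) - Y p (\<lambda>q. B q [X q, Z q]) + Z p (\<lambda>q. B q [X q, Y q])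
    - B p [lie_bracket X Y p, Z p] - B p [Y p, lie_bracket X Z p] + B p [X p, lie_bracket Y Z p]"
proof -
  define s where "s X p = (X p, (\<lambda>vs. 0) :: 'm covec)" for X :: "'m \<Rightarrow> 'm tvec" and p
  have s: "s X \<in> gen_sections M" if "X \<in> vector_fields M" for X
    using that forms_zero[of 1] by (simp add: gen_sections_def s_def comp_def)
  have sp: "s X p \<in> gen_tangent M p" if "X \<in> vector_fields M" for X p
    by (rule gen_sections_fibre[OF s[OF that]])
  have fs: "fst \<circ> s X = X" "fst (s X p) = X p" "snd (s X p) = (\<lambda>vs. 0)" for X p
    by (simp_all add: s_def comp_def)
  have fps: "fst \<circ> push_F (s X) = push_VF \<phi> X" if "X \<in> vector_fields M" for X
    using fst_F[OF sp[OF that]] by (simp add: fun_eq_iff push_section_def push_VF_def s_def)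
  have fpp: "fst (push_F (s X) (\<phi> p)) = push_vec \<phi> (X p)" if "X \<in> vector_fields M" for X p
    using fst_F[OF sp[OF that]] by (simp add: push_F_apply s_def)
  have spp: "snd (push_F (s X) (\<phi> p)) [push_vec \<phi> w] = B p [X p, w]" 
    if "X \<in> vector_fields M" "w \<in> tangent_space M p" for X w p
    using snd_F_B[OF sp[OF that(1)] that(2)] by (simp add: push_F_apply s_def)
  note bij = push_VF_apply[OF bij_phi] push_VF_lie_bracket[OF bij_phi]
  note tX = VF_tangent[OF X] and tY = VF_tangent[OF Y] and tZ = VF_tangent[OF Z]
  have C: "courant M H (s X) (s Y) p \<in> gen_tangent M p" 
    by (rule courant_gen_tangent[OF H s[OF X] s[OF Y]])
  \<comment> \<open>The second summand is the correction by \<open>B\<close> that \<open>F\<close>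
    adds for the vector part of the bracket.\<close>
  have "snd (F p (courant M H (s X) (s Y) p)) [push_vec \<phi> (Z p)] =
      H p [Y p, X p, Z p] + B p [lie_bracket X Y p, Z p]"
    unfolding snd_F_B[OF C tZ] snd_courant_apply[OF s[OF X] s[OF Y] Z] fst_courant
    using tangent_const[OF tX] tangent_const[OF tY] tangent_const[OF tZ] by (simp add: fs)
  moreover have "snd (courant M H (push_F (s X)) (push_F (s Y)) (\<phi> p)) [push_VF \<phi> Z (\<phi> p)] =
      X p (\<lambda>q. B q [Y q, Z q]) - B p [Y p, lie_bracket X Z p] - Y p (\<lambda>q. B q [X q, Z q])
      + Z p (\<lambda>q. B q [X q, Y q]) + B p [X p, lie_bracket Y Z p] + pull_form \<phi> H p [Y p, X p, Z p]"
    unfolding snd_courant_apply[OF push_F_gen_sections[OF s[OF X]] push_F_gen_sections[OF s[OF Y]] push_VF_VF[OF diffeo Z]]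
    unfolding fps[OF X] fps[OF Y] bij fpp[OF X] fpp[OF Y]
    by (simp add: push_vec_apply bij fpp spp X Y Z tX tY tZ VF_tangent lie_bracket_VF pull_form_def pull_covec_def)
  moreover have "F p (courant M H (s X) (s Y) p) = courant M H (push_F (s X)) (push_F (s Y)) (\<phi> p)"
    by (rule F_courant[OF s[OF X] s[OF Y]])
  \<comment> \<open>The double contraction puts \<open>Y\<close> before \<open>X\<close>; both
    \<open>H\<close> terms change sign when the natural order is restored.\<close>
  moreover have "H p [Y p, X p, Z p] = - H p [X p, Y p, Z p]"
    "pull_form \<phi> H p [Y p, X p, Z p] = - pull_form \<phi> H p [X p, Y p, Z p]"
    using alt_swap[OF forms_alt[OF H] tY tX] alt_swap[OF forms_alt[OF pull_form_forms[OF diffeo H]] tY tX] by auto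
  ultimately show ?thesis by (simp add: bij)
qed

lemma ext_deriv_B: "ext_deriv M 2 B = (\<lambda>p vs. pull_form \<phi> H p vs - H p vs)"
proof (rule ext_deriv_eqI)
  show "(\<lambda>p vs. pull_form \<phi> H p vs - H p vs) \<in> forms M (Suc 2)"
    using forms_diff[OF pull_form_forms[OF diffeo H] H] by simp
  fix Xs :: "('m \<Rightarrow> 'm tvec) list" and p
  assume Xs: "length Xs = Suc 2" "set Xs \<subseteq> vector_fields M"
  then obtain X Y Z where XYZ: "Xs = [X, Y, Z]" by (auto simp: length_Suc_conv numeral_2_eq_2)
  then have V: "X \<in> vector_fields M" "Y \<in> vector_fields M" "Z \<in> vector_fields M" using Xs by auto
  \<comment> \<open>The invariant formula puts the bracket in front, whereas
    \<open>H_formula\<close> has it behind in these two terms.\<close>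
  have 1: "B p [lie_bracket X Z p, Y p] = - B p [Y p, lie_bracket X Z p]"
    "B p [lie_bracket Y Z p, X p] = - B p [X p, lie_bracket Y Z p]"
    by (intro alt_swap[OF B_alt] VF_tangent lie_bracket_VF V)+
  show "pull_form \<phi> H p (map (\<lambda>X. X p) Xs) - H p (map (\<lambda>X. X p) Xs) =
        (\<Sum>i<Suc 2. (- 1) ^ i * (Xs ! i) p (\<lambda>q. B q (map (\<lambda>X. X q) (omit i Xs)))) +
        (\<Sum>j<Suc 2. \<Sum>i<j. (- 1) ^ (i + j) *
           B p (lie_bracket (Xs ! i) (Xs ! j) p # map (\<lambda>X. X p) (omit i (omit j Xs))))"
    using H_formula[OF V, of p] 1 by (simp add: XYZ omit_def numeral_2_eq_2)
qed

end

theorem proposition2p5: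
  fixes M :: "('m::{t2_space, second_countable_topology}, 'e::real_inner) atlas"
    and H :: "'m form"
    and \<phi> :: "'m \<Rightarrow> 'm"
    and F :: "'m \<Rightarrow> 'm gvec \<Rightarrow> 'm gvec"
  assumes "smooth_manifold M"
    and "H \<in> forms M 3"
    and "ext_deriv M 3 H = (\<lambda>p vs. 0)"
    and "diffeomorphism M \<phi>"
    and "bundle_automorphism M \<phi> F"
    and "orthogonal_map M F"
    and "preserves_courant M H \<phi> F"
  shows "\<exists>!B. B \<in> forms M 2 \<and>
    (\<forall>p. \<forall>a\<in>gen_tangent M p. F p a = lift_diffeo \<phi> (exp_form B p a)) \<and>
    (\<lambda>p vs. pull_form \<phi> H p vs - H p vs) = ext_deriv M 2 B"
proof -
  interpret courant_automorphism M H \<phi> F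
    using assms by (simp add: courant_automorphism_def courant_automorphism_axioms_def)
  show ?thesis
  proof (rule ex1I[of _ B])
    show "B \<in> forms M 2 \<and>
      (\<forall>p. \<forall>a\<in>gen_tangent M p. F p a = lift_diffeo \<phi> (exp_form B p a)) \<and>
      (\<lambda>p vs. pull_form \<phi> H p vs - H p vs) = ext_deriv M 2 B"
      using B_forms F_eq ext_deriv_B by simp
  next
    fix B'
    assume "B' \<in> forms M 2 \<and>
      (\<forall>p. \<forall>a\<in>gen_tangent M p. F p a = lift_diffeo \<phi> (exp_form B' p a)) \<and>
      (\<lambda>p vs. pull_form \<phi> H p vs - H p vs) = ext_deriv M 2 B'"
    then show "B' = B" by (intro B_unique) blast+
  qed
qed

end
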